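(* Let $N\ge2$, let $\mathbf 1_N$ be the $N\times N$ matrix with all entries $1$, let $v_{ij}$ ($1\le i,j\le N$) be the canonical generators of $C(\mathbb G_{\mathbf 1_N}^\infty)$, and let $C(\mathbb H_{\mathbf 1_N})$ be the $C^*$-subalgebra of $C(\mathbb G_{\mathbf 1_N}^\infty)$ generated by all the elements $v_{ij}v_{ij}^*$ and $v_{ij}^*v_{ij}$. There exists a surjective $*$-homomorphism $$\pi:C(\mathbb H_{\mathbf 1_N})\to C(\mathbb S_N^+\times\mathbb S_N^+)$$ mapping $v_{ij}v_{ij}^*$ to $P_{ij}$ and $v_{ij}^*v_{ij}$ to $Q_{ij}$ for all $1\le i,j\le N$, where $(P_{ij})_{i,j=1}^N$ and $(Q_{ij})_{i,j=1}^N$ are the magic unitaries generating respectively the first and second copies of $C(\mathbb S_N^+)$.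
   Context: A magic unitary is a square matrix of projections in a unital $C^*$-algebra with all rows and columns summing to $1$. $C(\mathbb G_{\mathbf 1_N}^\infty)$ is the universal unital $C^*$-algebra generated by partial isometries $(v_{ij})_{1\le i,j\le N}$ such that: (I) the matrices $p=(v_{ij}v_{ij}^* )$ and $q=(v_{ij}^*v_{ij})$ are magic unitaries preserving the (constant) Perron--Frobenius eigenvector of $\mathbf 1_N$; (II) $\mathbf 1_Np=q\mathbf 1_N$; (III) for all $n\in\mathbb N$ and all $i_1,\dots,i_n,j_1,\dots,j_n\in\{1,\dots,N\}$, $v_{i_1j_1}\cdots v_{i_nj_n}$ is a partial isometry. Its coproduct is $v_{ij}\mapsto\sum_kv_{ik}\otimes v_{kj}$; it restricts to $C(\mathbb H_{\mathbf 1_N})$, making $\mathbb H_{\mathbf 1_N}$ a compact quantum group. $\mathbb S_N^+$ is the quantum permutation group: $C(\mathbb S_N^+)$ is the universal unital $C^*$-algebra generated by the entries of an $N\times N$ magic unitary, with coproduct $P_{ij}\mapsto\sum_kP_{ik}\otimes P_{kj}$. $C(\mathbb S_N^+\times\mathbb S_N^+)=C(\mathbb S_N^+)\otimes C(\mathbb S_N^+)$, with $\otimes$ the minimal tensor product. *)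

theory Defs
  imports "HOL-Analysis.Analysis" "HOL-Library.Poly_Mapping" "HOL-Algebra.Module"
begin

section \<open>Carrier-based *-algebras over the complex numbers\<close>

text \<open>The same record type serves for C*-algebras and for seminormed *-algebras that have not yet
  been separated and completed; \<open>nrm\<close> is the norm, respectively the seminorm.\<close>

record 'a star_algebra = "(complex, 'a) module" +
  star :: "'a \<Rightarrow> 'a"
  nrm :: "'a \<Rightarrow> real"

definition diff :: "('a, 'm) star_algebra_scheme \<Rightarrow> 'a \<Rightarrow> 'a \<Rightarrow> 'a" where
  "diff A x y = x \<oplus>\<^bsub>A\<^esub> ((-1) \<odot>\<^bsub>A\<^esub> y)"

definition star_hom ::
  "('a, 'm) star_algebra_scheme \<Rightarrow> ('b, 'k) star_algebra_scheme \<Rightarrow> ('a \<Rightarrow> 'b) \<Rightarrow> bool" where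
  "star_hom A B \<phi> \<longleftrightarrow>
     (\<forall>x\<in>carrier A. \<phi> x \<in> carrier B) \<and>
     (\<forall>x\<in>carrier A. \<forall>y\<in>carrier A. \<phi> (x \<oplus>\<^bsub>A\<^esub> y) = \<phi> x \<oplus>\<^bsub>B\<^esub> \<phi> y) \<and>
     (\<forall>c. \<forall>x\<in>carrier A. \<phi> (c \<odot>\<^bsub>A\<^esub> x) = c \<odot>\<^bsub>B\<^esub> \<phi> x) \<and>
     (\<forall>x\<in>carrier A. \<forall>y\<in>carrier A. \<phi> (x \<otimes>\<^bsub>A\<^esub> y) = \<phi> x \<otimes>\<^bsub>B\<^esub> \<phi> y) \<and>
     (\<forall>x\<in>carrier A. \<phi> (star A x) = star B (\<phi> x))"

definition cstar_subalgebra :: "('a, 'm) star_algebra_scheme \<Rightarrow> 'a set \<Rightarrow> bool" where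
  "cstar_subalgebra A B \<longleftrightarrow>
     B \<subseteq> carrier A \<and> \<zero>\<^bsub>A\<^esub> \<in> B \<and>
     (\<forall>x\<in>B. \<forall>y\<in>B. x \<oplus>\<^bsub>A\<^esub> y \<in> B \<and> x \<otimes>\<^bsub>A\<^esub> y \<in> B) \<and>
     (\<forall>c. \<forall>x\<in>B. c \<odot>\<^bsub>A\<^esub> x \<in> B) \<and>
     (\<forall>x\<in>B. star A x \<in> B) \<and>
     (\<forall>f. \<forall>x\<in>carrier A. (\<forall>n. f n \<in> B) \<longrightarrow> (\<lambda>n. nrm A (diff A (f n) x)) \<longlonglongrightarrow> 0 \<longrightarrow> x \<in> B)"

definition cstar_generated ::
  "('a, 'm) star_algebra_scheme \<Rightarrow> 'a set \<Rightarrow> ('a, 'm) star_algebra_scheme" where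
  "cstar_generated A S = A\<lparr>carrier := \<Inter>{B. cstar_subalgebra A B \<and> S \<subseteq> B}\<rparr>"


section \<open>Separated completion of a seminormed *-algebra\<close>

text \<open>Elements are classes of Cauchy sequences modulo sequences that are null for the seminorm, so
  that passing to the quotient by \<open>{x. nrm A x = 0}\<close> is part of the construction. In particular the
  algebraic laws need only hold in \<open>A\<close> up to elements of seminorm 0.\<close>

definition cauchy_seqs :: "('a, 'm) star_algebra_scheme \<Rightarrow> (nat \<Rightarrow> 'a) set" where
  "cauchy_seqs A = {f. (\<forall>n. f n \<in> carrier A) \<and>
     (\<forall>e>0. \<exists>M. \<forall>m\<ge>M. \<forall>n\<ge>M. nrm A (diff A (f m) (f n)) < e)}"

definition cauchy_rel :: "('a, 'm) star_algebra_scheme \<Rightarrow> ((nat \<Rightarrow> 'a) \<times> (nat \<Rightarrow> 'a)) set" where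
  "cauchy_rel A = {(f, g). f \<in> cauchy_seqs A \<and> g \<in> cauchy_seqs A \<and>
     (\<lambda>n. nrm A (diff A (f n) (g n))) \<longlonglongrightarrow> 0}"

definition embed :: "('a, 'm) star_algebra_scheme \<Rightarrow> 'a \<Rightarrow> (nat \<Rightarrow> 'a) set" where
  "embed A a = cauchy_rel A `` {\<lambda>_. a}"

definition completion :: "('a, 'm) star_algebra_scheme \<Rightarrow> (nat \<Rightarrow> 'a) set star_algebra" where
  "completion A = \<lparr>
     carrier = cauchy_seqs A // cauchy_rel A,
     monoid.mult = (\<lambda>X Y. \<Union>f\<in>X. \<Union>g\<in>Y. cauchy_rel A `` {\<lambda>n. f n \<otimes>\<^bsub>A\<^esub> g n}),
     one = embed A \<one>\<^bsub>A\<^esub>,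
     zero = embed A \<zero>\<^bsub>A\<^esub>,
     add = (\<lambda>X Y. \<Union>f\<in>X. \<Union>g\<in>Y. cauchy_rel A `` {\<lambda>n. f n \<oplus>\<^bsub>A\<^esub> g n}),
     smult = (\<lambda>c X. \<Union>f\<in>X. cauchy_rel A `` {\<lambda>n. c \<odot>\<^bsub>A\<^esub> f n}),
     star = (\<lambda>X. \<Union>f\<in>X. cauchy_rel A `` {\<lambda>n. star A (f n)}),
     nrm = (\<lambda>X. THE r. \<forall>f\<in>X. (\<lambda>n. nrm A (f n)) \<longlonglongrightarrow> r)\<rparr>"


section \<open>Universal unital C*-algebras\<close>

text \<open>Words in the letters \<open>g\<close> (encoded as \<open>(g, False)\<close>) and \<open>g*\<close> (encoded as \<open>(g, True)\<close>). They
  are written additively only because the convolution product of \<^typ>\<open>'a \<Rightarrow>\<^sub>0 'b\<close> expects the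
  monoid of exponents to be additive; concatenation is not commutative.\<close>

datatype 'g word = Word "('g \<times> bool) list"

instantiation word :: (type) monoid_add
begin

definition zero_word :: "'g word" where
  "zero_word = Word []"

fun plus_word :: "'g word \<Rightarrow> 'g word \<Rightarrow> 'g word" where
  "plus_word (Word xs) (Word ys) = Word (xs @ ys)"

instance
proof
  fix a b c :: "'a word"
  show "a + b + c = a + (b + c)" by (cases a; cases b; cases c) simp
  show "0 + a = a" by (cases a) (simp add: zero_word_def)
  show "a + 0 = a" by (cases a) (simp add: zero_word_def)
qed

end

fun word_star :: "'g word \<Rightarrow> 'g word" where
  "word_star (Word xs) = Word (rev (map (\<lambda>(g, b). (g, \<not> b)) xs))"

text \<open>The free unital complex *-algebra on \<^typ>\<open>'g\<close>: noncommutative *-polynomials.\<close>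

type_synonym 'g free_star = "'g word \<Rightarrow>\<^sub>0 complex"

definition gen :: "'g \<Rightarrow> 'g free_star" where
  "gen g = Poly_Mapping.single (Word [(g, False)]) 1"

definition free_scale :: "complex \<Rightarrow> 'g free_star \<Rightarrow> 'g free_star" where
  "free_scale c x = Poly_Mapping.map ((*) c) x"

definition free_adj :: "'g free_star \<Rightarrow> 'g free_star" where
  "free_adj x = (\<Sum>w\<in>Poly_Mapping.keys x.
     Poly_Mapping.single (word_star w) (cnj (Poly_Mapping.lookup x w)))"

definition cstar_seminorm :: "('g free_star \<Rightarrow> real) \<Rightarrow> bool" where
  "cstar_seminorm p \<longleftrightarrow>
     (\<forall>x y. p (x + y) \<le> p x + p y) \<and>
     (\<forall>c x. p (free_scale c x) = cmod c * p x) \<and>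
     (\<forall>x y. p (x * y) \<le> p x * p y) \<and>
     (\<forall>x. p (free_adj x * x) = (p x)\<^sup>2)"

text \<open>A set \<open>R\<close> of *-polynomials stands for the relations \<open>r = 0\<close>, \<open>r \<in> R\<close>. The C*-seminorms on the
  quotient of the free *-algebra by the *-ideal generated by \<open>R\<close> are the C*-seminorms on the free
  *-algebra vanishing on \<open>R\<close>; the universal C*-algebra is the separated completion for the largest
  one. The supremum is finite if, for instance, the relations make all generators partial
  isometries or projections, as is the case below.\<close>

definition universal_seminorm :: "'g free_star set \<Rightarrow> 'g free_star \<Rightarrow> real" where
  "universal_seminorm R x = (SUP p\<in>{p. cstar_seminorm p \<and> (\<forall>r\<in>R. p r = 0)}. p x)"

definition free_star_algebra :: "'g free_star set \<Rightarrow> 'g free_star star_algebra" where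
  "free_star_algebra R = \<lparr>
     carrier = UNIV, monoid.mult = (*), one = 1, zero = 0, add = (+),
     smult = free_scale, star = free_adj, nrm = universal_seminorm R\<rparr>"

type_synonym 'g universal_elem = "(nat \<Rightarrow> 'g free_star) set"

definition universal_cstar :: "'g free_star set \<Rightarrow> 'g universal_elem star_algebra" where
  "universal_cstar R = completion (free_star_algebra R)"

definition universal_gen :: "'g free_star set \<Rightarrow> 'g \<Rightarrow> 'g universal_elem" where
  "universal_gen R g = embed (free_star_algebra R) (gen g)"


section \<open>Minimal tensor product\<close>

text \<open>Vectors of \<open>\<ell>\<^sup>2(X)\<close> are extended by 0 outside \<open>X\<close>.\<close>

definition ell2 :: "'i set \<Rightarrow> ('i \<Rightarrow> complex) set" where
  "ell2 X = {\<xi>. (\<forall>i. i \<notin> X \<longrightarrow> \<xi> i = 0) \<and> (\<lambda>i. (cmod (\<xi> i))\<^sup>2) summable_on X}"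

definition ell2_inner :: "('i \<Rightarrow> complex) \<Rightarrow> ('i \<Rightarrow> complex) \<Rightarrow> complex" where
  "ell2_inner \<xi> \<eta> = (\<Sum>\<^sub>\<infinity>i. cnj (\<xi> i) * \<eta> i)"

definition ell2_norm :: "('i \<Rightarrow> complex) \<Rightarrow> real" where
  "ell2_norm \<xi> = sqrt (\<Sum>\<^sub>\<infinity>i. (cmod (\<xi> i))\<^sup>2)"

definition bounded_op :: "'i set \<Rightarrow> (('i \<Rightarrow> complex) \<Rightarrow> ('i \<Rightarrow> complex)) \<Rightarrow> bool" where
  "bounded_op X T \<longleftrightarrow>
     (\<forall>\<xi>\<in>ell2 X. T \<xi> \<in> ell2 X) \<and>
     (\<forall>\<xi>\<in>ell2 X. \<forall>\<eta>\<in>ell2 X. T (\<lambda>i. \<xi> i + \<eta> i) = (\<lambda>i. T \<xi> i + T \<eta> i)) \<and>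
     (\<forall>c. \<forall>\<xi>\<in>ell2 X. T (\<lambda>i. c * \<xi> i) = (\<lambda>i. c * T \<xi> i)) \<and>
     (\<exists>C. \<forall>\<xi>\<in>ell2 X. ell2_norm (T \<xi>) \<le> C * ell2_norm \<xi>)"

definition op_norm :: "'i set \<Rightarrow> (('i \<Rightarrow> complex) \<Rightarrow> ('i \<Rightarrow> complex)) \<Rightarrow> real" where
  "op_norm X T = (SUP \<xi>\<in>{\<xi>\<in>ell2 X. ell2_norm \<xi> \<le> 1}. ell2_norm (T \<xi>))"

text \<open>A *-homomorphism from \<open>A\<close> to the bounded operators on \<open>\<ell>\<^sup>2(X)\<close>; it may be degenerate.\<close>

definition representation ::
  "('a, 'm) star_algebra_scheme \<Rightarrow> 'i set \<Rightarrow> ('a \<Rightarrow> ('i \<Rightarrow> complex) \<Rightarrow> ('i \<Rightarrow> complex)) \<Rightarrow> bool" where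
  "representation A X \<rho> \<longleftrightarrow>
     (\<forall>a\<in>carrier A. bounded_op X (\<rho> a)) \<and>
     (\<forall>a\<in>carrier A. \<forall>b\<in>carrier A. \<forall>\<xi>\<in>ell2 X. \<rho> (a \<oplus>\<^bsub>A\<^esub> b) \<xi> = (\<lambda>i. \<rho> a \<xi> i + \<rho> b \<xi> i)) \<and>
     (\<forall>c. \<forall>a\<in>carrier A. \<forall>\<xi>\<in>ell2 X. \<rho> (c \<odot>\<^bsub>A\<^esub> a) \<xi> = (\<lambda>i. c * \<rho> a \<xi> i)) \<and>
     (\<forall>a\<in>carrier A. \<forall>b\<in>carrier A. \<forall>\<xi>\<in>ell2 X. \<rho> (a \<otimes>\<^bsub>A\<^esub> b) \<xi> = \<rho> a (\<rho> b \<xi>)) \<and>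
     (\<forall>a\<in>carrier A. \<forall>\<xi>\<in>ell2 X. \<forall>\<eta>\<in>ell2 X.
        ell2_inner (\<rho> (star A a) \<xi>) \<eta> = ell2_inner \<xi> (\<rho> a \<eta>))"

text \<open>With \<open>\<ell>\<^sup>2(X) \<otimes> \<ell>\<^sup>2(Y) = \<ell>\<^sup>2(X \<times> Y)\<close>, this is \<open>T \<otimes> S = (T \<otimes> 1)(1 \<otimes> S)\<close>, each factor acting on
  the slices of a vector in its own variable.\<close>

definition op_tensor ::
  "(('i \<Rightarrow> complex) \<Rightarrow> ('i \<Rightarrow> complex)) \<Rightarrow> (('j \<Rightarrow> complex) \<Rightarrow> ('j \<Rightarrow> complex)) \<Rightarrow>
   ('i \<times> 'j \<Rightarrow> complex) \<Rightarrow> ('i \<times> 'j \<Rightarrow> complex)" where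
  "op_tensor T S \<zeta> = (\<lambda>(x, y). T (\<lambda>x'. S (\<lambda>y'. \<zeta> (x', y')) y) x)"

text \<open>A list \<open>[(a\<^sub>1, b\<^sub>1), \<dots>, (a\<^sub>n, b\<^sub>n)]\<close> represents \<open>a\<^sub>1 \<otimes> b\<^sub>1 + \<dots> + a\<^sub>n \<otimes> b\<^sub>n\<close> in the
  algebraic tensor product. The spatial norm of such an element is the supremum of its operator
  norms under all \<open>\<rho> \<otimes> \<sigma>\<close>, where \<open>\<rho>\<close> and \<open>\<sigma>\<close> are representations of the two factors. Representing
  on \<open>\<ell>\<^sup>2(X)\<close> with \<open>X\<close> a set of elements of the type \<^typ>\<open>'a\<close> of the algebra is no restriction: the
  Hilbert space of a cyclic representation of \<open>A\<close> has dimension at most the cardinality of \<open>A\<close>, and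
  cyclic representations suffice to compute the supremum. Two lists represent the same algebraic
  tensor iff their difference has spatial norm 0, so the bilinearity relations are imposed by
  \<^const>\<open>completion\<close>.\<close>

definition min_tensor_norm ::
  "('a, 'm) star_algebra_scheme \<Rightarrow> ('b, 'k) star_algebra_scheme \<Rightarrow> ('a \<times> 'b) list \<Rightarrow> real" where
  "min_tensor_norm A B t = Sup {op_norm (X \<times> Y) (\<lambda>\<zeta> z. \<Sum>(a, b)\<leftarrow>t. op_tensor (\<rho> a) (\<sigma> b) \<zeta> z)
     | (X :: 'a set) (Y :: 'b set) \<rho> \<sigma>. representation A X \<rho> \<and> representation B Y \<sigma>}"

definition alg_tensor ::
  "('a, 'm) star_algebra_scheme \<Rightarrow> ('b, 'k) star_algebra_scheme \<Rightarrow> ('a \<times> 'b) list star_algebra" where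
  "alg_tensor A B = \<lparr>
     carrier = lists (carrier A \<times> carrier B),
     monoid.mult = (\<lambda>s t. [(a \<otimes>\<^bsub>A\<^esub> a', b \<otimes>\<^bsub>B\<^esub> b'). (a, b) \<leftarrow> s, (a', b') \<leftarrow> t]),
     one = [(\<one>\<^bsub>A\<^esub>, \<one>\<^bsub>B\<^esub>)],
     zero = [],
     add = (@),
     smult = (\<lambda>c. map (\<lambda>(a, b). (c \<odot>\<^bsub>A\<^esub> a, b))),
     star = map (\<lambda>(a, b). (star A a, star B b)),
     nrm = min_tensor_norm A B\<rparr>"

definition min_tensor ::
  "('a, 'm) star_algebra_scheme \<Rightarrow> ('b, 'k) star_algebra_scheme \<Rightarrow>
   (nat \<Rightarrow> ('a \<times> 'b) list) set star_algebra" where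
  "min_tensor A B = completion (alg_tensor A B)"

definition elem_tensor ::
  "('a, 'm) star_algebra_scheme \<Rightarrow> ('b, 'k) star_algebra_scheme \<Rightarrow> 'a \<Rightarrow> 'b \<Rightarrow>
   (nat \<Rightarrow> ('a \<times> 'b) list) set" where
  "elem_tensor A B a b = embed (alg_tensor A B) [(a, b)]"


section \<open>Relations\<close>

definition projection_rels :: "'g free_star \<Rightarrow> 'g free_star set" where
  "projection_rels x = {free_adj x - x, x * x - x}"

definition partial_isometry_rel :: "'g free_star \<Rightarrow> 'g free_star" where
  "partial_isometry_rel x = x * free_adj x * x - x"

definition magic_unitary_rels :: "('n::finite \<Rightarrow> 'n \<Rightarrow> 'g free_star) \<Rightarrow> 'g free_star set" where
  "magic_unitary_rels u =
     (\<Union>i. \<Union>j. projection_rels (u i j)) \<union>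
     range (\<lambda>i. (\<Sum>j\<in>UNIV. u i j) - 1) \<union>
     range (\<lambda>j. (\<Sum>i\<in>UNIV. u i j) - 1)"

text \<open>\<open>u \<xi> = \<xi>\<close>, where \<open>\<xi>\<close> is viewed as a vector with entries in \<open>\<complex>1\<close>.\<close>

definition preserves_rels ::
  "('n::finite \<Rightarrow> 'n \<Rightarrow> 'g free_star) \<Rightarrow> complex ^ 'n \<Rightarrow> 'g free_star set" where
  "preserves_rels u \<xi> =
     range (\<lambda>i. (\<Sum>j\<in>UNIV. free_scale (\<xi> $ j) (u i j)) - free_scale (\<xi> $ i) 1)"

text \<open>\<open>M u = w M\<close> for a scalar matrix \<open>M\<close>.\<close>

definition intertwines_rels ::
  "complex ^ 'n ^ 'n \<Rightarrow> ('n::finite \<Rightarrow> 'n \<Rightarrow> 'g free_star) \<Rightarrow> ('n \<Rightarrow> 'n \<Rightarrow> 'g free_star) \<Rightarrow>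
   'g free_star set" where
  "intertwines_rels M u w =
     {(\<Sum>k\<in>UNIV. free_scale (M $ i $ k) (u k j)) - (\<Sum>k\<in>UNIV. free_scale (M $ k $ j) (w i k))
      | i j. True}"


section \<open>The quantum groups\<close>

text \<open>The index set \<open>{1, \<dots>, N}\<close> is rendered by a finite type \<^typ>\<open>'n\<close> with \<open>CARD('n) = N\<close>.\<close>

definition ones_matrix :: "complex ^ 'n ^ 'n" where
  "ones_matrix = (\<chi> i j. 1)"

definition pf_vector :: "complex ^ 'n" where
  "pf_vector = (\<chi> i. 1)"

lemma ones_matrix_pf_vector:
  "ones_matrix *v (pf_vector :: complex ^ 'n) = of_nat CARD('n::finite) *s pf_vector"
  by (simp add: ones_matrix_def pf_vector_def matrix_vector_mult_def vec_eq_iff)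

definition G_rels :: "('n::finite \<times> 'n) free_star set" where
  "G_rels =
     (let v = (\<lambda>i j. gen (i, j));
          p = (\<lambda>i j. v i j * free_adj (v i j));
          q = (\<lambda>i j. free_adj (v i j) * v i j)
      in {partial_isometry_rel (v i j) | i j. True} \<union>
         magic_unitary_rels p \<union> preserves_rels p pf_vector \<union>
         magic_unitary_rels q \<union> preserves_rels q pf_vector \<union>
         intertwines_rels ones_matrix p q \<union>
         {partial_isometry_rel (prod_list (map (\<lambda>(i, j). v i j) w)) | w. True})"

definition C_G :: "('n::finite \<times> 'n) universal_elem star_algebra" where
  "C_G = universal_cstar G_rels"

definition v_gen :: "'n::finite \<Rightarrow> 'n \<Rightarrow> ('n \<times> 'n) universal_elem" where
  "v_gen i j = universal_gen G_rels (i, j)"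

definition v_range :: "'n::finite \<Rightarrow> 'n \<Rightarrow> ('n \<times> 'n) universal_elem" where
  "v_range i j = v_gen i j \<otimes>\<^bsub>C_G\<^esub> star C_G (v_gen i j)"

definition v_source :: "'n::finite \<Rightarrow> 'n \<Rightarrow> ('n \<times> 'n) universal_elem" where
  "v_source i j = star C_G (v_gen i j) \<otimes>\<^bsub>C_G\<^esub> v_gen i j"

definition C_H :: "('n::finite \<times> 'n) universal_elem star_algebra" where
  "C_H = cstar_generated C_G ({v_range i j | i j. True} \<union> {v_source i j | i j. True})"

definition S_rels :: "('n::finite \<times> 'n) free_star set" where
  "S_rels = magic_unitary_rels (\<lambda>i j. gen (i, j))"

definition C_S :: "('n::finite \<times> 'n) universal_elem star_algebra" where
  "C_S = universal_cstar S_rels"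

definition u_gen :: "'n::finite \<Rightarrow> 'n \<Rightarrow> ('n \<times> 'n) universal_elem" where
  "u_gen i j = universal_gen S_rels (i, j)"

type_synonym 'n SS_elem =
  "(nat \<Rightarrow> (('n \<times> 'n) universal_elem \<times> ('n \<times> 'n) universal_elem) list) set"

definition C_SS :: "'n::finite SS_elem star_algebra" where
  "C_SS = min_tensor C_S C_S"

definition P_gen :: "'n::finite \<Rightarrow> 'n \<Rightarrow> 'n SS_elem" where
  "P_gen i j = elem_tensor C_S C_S (u_gen i j) \<one>\<^bsub>C_S\<^esub>"

definition Q_gen :: "'n::finite \<Rightarrow> 'n \<Rightarrow> 'n SS_elem" where
  "Q_gen i j = elem_tensor C_S C_S \<one>\<^bsub>C_S\<^esub> (u_gen i j)"

end

theory Submission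
  imports Defs
begin

text \<open>
  Let \<open>\<rho>\<close> and \<open>\<sigma>\<close> be representations of \<open>C(S\<^sub>N\<^sup>+)\<close> on \<open>H\<close> and \<open>K\<close>. On \<open>\<ell>\<^sup>2(\<int>) \<otimes> H \<otimes> K\<close> combine the
  shift along \<open>\<int>\<close> with magic unitaries \<open>\<kappa> n\<close> acting on the \<open>n\<close>-th summand \<open>H \<otimes> K\<close>, namely
  \<open>\<kappa> 0 = \<rho>(u) \<otimes> 1\<close>, \<open>\<kappa> 1 = 1 \<otimes> \<sigma>(u)\<close> and the identity matrix for all other \<open>n\<close>. The resulting operators
  \<open>v\<^sub>i\<^sub>j\<close> satisfy the relations of \<open>C(G)\<close>: a word in them is a power of the shift times projections that belong to
  different \<open>\<kappa> n\<close>, hence commute. On the summand \<open>n = 0\<close>, the elements \<open>v\<^sub>i\<^sub>j v\<^sub>i\<^sub>j*\<close> and \<open>v\<^sub>i\<^sub>j* v\<^sub>i\<^sub>j\<close>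
  are \<open>\<rho>(u\<^sub>i\<^sub>j) \<otimes> 1\<close> and \<open>1 \<otimes> \<sigma>(u\<^sub>i\<^sub>j)\<close>. So the minimal tensor norm of a polynomial in the \<open>P\<^sub>i\<^sub>j\<close> and
  \<open>Q\<^sub>i\<^sub>j\<close> is at most the norm of the corresponding element of \<open>C(G)\<close>, which gives \<open>\<pi>\<close>.

  The range of \<open>\<pi>\<close> is dense. It is closed because elements of norm \<open>r\<close> in it have approximate preimages of
  norm at most a fixed multiple of \<open>r\<close>: replace a self-adjoint preimage \<open>h\<close> by a polynomial approximation
  of \<open>sin h\<close>, which is bounded independently of \<open>h\<close>.
\<close>

section \<open>The free *-algebra and its C*-seminorms\<close>

text \<open>The relation that shapes the construction is the last one in \<open>G_rels\<close>. A
  product of two partial isometries is a partial isometry iff the source projection of the left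
  factor commutes with the range projection of the right one. Since the entries of one magic unitary
  need not commute with each other, a word must never meet the same \<open>\<kappa> n\<close> at two
  places. The shift guarantees this: every letter works one level away from its neighbours. A cyclic
  shift would return to a level already used, and the one-sided shift is not unitary, so its range
  projections would not sum to 1; hence the integers.

  The second obstacle is that before separation nothing is an algebra in the strict sense: lists
  obey the laws of a tensor product only up to seminorm 0, and a polynomial in the projections has
  no canonical list. So \<pi> starts as a relation, and one norm inequality gives independence of
  choices as well as extension to limits.

  Finally, the supremum defining the minimal tensor norm has to be finite. This rests on
  contractivity of representations of C(S), which \<open>representation\<close> does not demand and
  which is derived from a Neumann series.\<close>

lemma word_star_involutive [simp]: "word_star (word_star w) = w"
  by (cases w) (simp add: rev_map[symmetric] case_prod_beta o_def)

lemma word_star_plus: "word_star (v + w) = word_star w + word_star v"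
  by (cases v; cases w) simp

lemma word_star_eq_iff: "word_star v = w \<longleftrightarrow> v = word_star w"
  by auto

lemma word_star_zero [simp]: "word_star 0 = 0"
  by (simp add: zero_word_def)

lemma free_scale_conv_mult: "free_scale c x = Poly_Mapping.single 0 c * x"
  by (simp add: free_scale_def mult_map_scale_conv_mult)

lemma lookup_free_scale [simp]: "Poly_Mapping.lookup (free_scale c x) w = c * Poly_Mapping.lookup x w"
  unfolding free_scale_def by (simp add: Poly_Mapping.map.rep_eq when_def)

lemma lookup_free_adj [simp]:
  "Poly_Mapping.lookup (free_adj x) w = cnj (Poly_Mapping.lookup x (word_star w))"
proof -
  have "Poly_Mapping.lookup (free_adj x) w =
      (\<Sum>v\<in>Poly_Mapping.keys x. if v = word_star w then cnj (Poly_Mapping.lookup x v) else 0)"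
    unfolding free_adj_def lookup_sum
    by (intro sum.cong) (auto simp: lookup_single when_def word_star_eq_iff)
  also have "\<dots> = cnj (Poly_Mapping.lookup x (word_star w))"
    by (simp add: in_keys_iff)
  finally show ?thesis .
qed

lemma free_scale_simps:
  "free_scale c (x + y) = free_scale c x + free_scale c y"
  "free_scale (c + d) x = free_scale c x + free_scale d x"
  "free_scale c (free_scale d x) = free_scale (c * d) x"
  "free_scale 1 x = x"
  "free_scale 0 x = 0"
  "free_scale c 0 = 0"
  "free_scale c (- x) = - free_scale c x"
  "free_scale c (x - y) = free_scale c x - free_scale c y"
  "free_scale (-1) x = - x"
  by (rule poly_mapping_eqI; simp add: lookup_add lookup_minus algebra_simps)+

lemma free_scale_mult_left: "free_scale c x * y = free_scale c (x * y)"
  by (simp add: free_scale_conv_mult mult.assoc)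

lemma free_scale_single: "free_scale c (Poly_Mapping.single w d) = Poly_Mapping.single w (c * d)"
  by (simp add: free_scale_conv_mult mult_single)

lemma free_adj_simps:
  "free_adj (x + y) = free_adj x + free_adj y"
  "free_adj (x - y) = free_adj x - free_adj y"
  "free_adj (- x) = - free_adj x"
  "free_adj (free_scale c x) = free_scale (cnj c) (free_adj x)"
  "free_adj (free_adj x) = x"
  "free_adj 0 = 0"
  by (rule poly_mapping_eqI; simp add: lookup_add lookup_minus)+

lemma free_adj_single: "free_adj (Poly_Mapping.single w c) = Poly_Mapping.single (word_star w) (cnj c)"
  by (rule poly_mapping_eqI) (auto simp: lookup_single when_def word_star_eq_iff)

lemma free_star_induct [case_names zero single add]:
  assumes "P 0" "\<And>w c. P (Poly_Mapping.single w c)" "\<And>x y. P x \<Longrightarrow> P y \<Longrightarrow> P (x + y)"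
  shows "P (x :: 'g free_star)"
proof (induction x rule: update_induct)
  case const
  show ?case by (rule assms(1))
next
  case (update f w c)
  have "Poly_Mapping.update w c f = f + Poly_Mapping.single w c"
    using update(1)
    by (intro poly_mapping_eqI)
       (auto simp: lookup_update lookup_add lookup_single when_def in_keys_iff)
  then show ?case using update assms by auto
qed

text \<open>A scalar is a polynomial supported at the empty word. Such polynomials are central
  although the convolution product is not commutative; this is checked on monomials.\<close>

lemma free_scale_mult_right: "x * free_scale c y = free_scale c (x * y)"
proof -
  have "x * Poly_Mapping.single 0 c = Poly_Mapping.single 0 c * x"
    by (induction x rule: free_star_induct) (simp_all add: mult_single algebra_simps)
  then show ?thesis
    by (simp add: free_scale_conv_mult mult.assoc[symmetric])
qed

lemma free_adj_mult: "free_adj (x * y) = free_adj y * free_adj x"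
proof (induction x rule: free_star_induct)
  case (single v c)
  show ?case
    by (induction y rule: free_star_induct)
       (simp_all add: free_adj_simps free_adj_single mult_single word_star_plus algebra_simps)
qed (simp_all add: free_adj_simps algebra_simps)

lemma free_adj_one [simp]: "free_adj 1 = 1"
  using free_adj_single[of 0 1] by simp

lemma single_Word_eq:
  "Poly_Mapping.single (Word xs) 1 =
     prod_list (map (\<lambda>(g, b). if b then free_adj (gen g) else gen g) xs)"
proof (induction xs)
  case Nil
  then show ?case by (simp flip: zero_word_def)
next
  case (Cons a xs)
  have "Poly_Mapping.single (Word (a # xs)) (1::complex) =
      Poly_Mapping.single (Word [a]) 1 * Poly_Mapping.single (Word xs) 1"
    by (simp add: mult_single)
  then show ?case
    using Cons by (cases a) (auto simp: gen_def free_adj_single)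
qed

text \<open>For properties known only on generators. Adjoints of generators form a base case of
  their own, so no induction step for \<open>free_adj\<close> is required.\<close>

lemma free_star_gen_induct [case_names one gen adj add mult scale]:
  assumes "P 1" "\<And>g. P (gen g)" "\<And>g. P (free_adj (gen g))"
    and add: "\<And>x y. P x \<Longrightarrow> P y \<Longrightarrow> P (x + y)" and mult: "\<And>x y. P x \<Longrightarrow> P y \<Longrightarrow> P (x * y)"
    and scale: "\<And>c x. P x \<Longrightarrow> P (free_scale c x)"
  shows "P (x :: 'g free_star)"
proof (induction x rule: free_star_induct)
  case zero
  show ?case using scale[OF assms(1), of 0] by (simp add: free_scale_simps)
next
  case (single w c)
  obtain xs where w: "w = Word xs" by (cases w)
  have "P (Poly_Mapping.single (Word xs) 1)"
    unfolding single_Word_eq by (induction xs) (auto simp: assms split: if_splits)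
  from scale[OF this, of c] show ?case by (simp add: w free_scale_single)
qed (rule add)

context
  fixes p :: "'g free_star \<Rightarrow> real"
  assumes p: "cstar_seminorm p"
begin

lemma cstar_seminorm_add: "p (x + y) \<le> p x + p y"
  and cstar_seminorm_scale: "p (free_scale c x) = cmod c * p x"
  and cstar_seminorm_mult: "p (x * y) \<le> p x * p y"
  and cstar_seminorm_cstar: "p (free_adj x * x) = (p x)\<^sup>2"
  using p by (auto simp: cstar_seminorm_def)

lemma cstar_seminorm_zero [simp]: "p 0 = 0"
  using cstar_seminorm_scale[of 0 0] by (simp add: free_scale_simps)

lemma cstar_seminorm_minus: "p (- x) = p x"
  using cstar_seminorm_scale[of "-1" x] by (simp add: free_scale_simps)

lemma cstar_seminorm_minus_commute: "p (x - y) = p (y - x)"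
  using cstar_seminorm_minus[of "x - y"] by simp

lemma cstar_seminorm_nonneg [simp]: "0 \<le> p x"
  using cstar_seminorm_add[of x "- x"] by (simp add: cstar_seminorm_minus)

lemma cstar_seminorm_diff: "p (x - y) \<le> p x + p y"
  using cstar_seminorm_add[of x "- y"] by (simp add: cstar_seminorm_minus)

lemma cstar_seminorm_triangle: "p (x - z) \<le> p (x - y) + p (y - z)"
  using cstar_seminorm_add[of "x - y" "y - z"] by simp

lemma cstar_seminorm_abs_diff: "\<bar>p x - p y\<bar> \<le> p (x - y)"
  using cstar_seminorm_add[of "x - y" y] cstar_seminorm_add[of "y - x" x]
  by (simp add: cstar_seminorm_minus_commute abs_le_iff)

text \<open>The C*-identity and submultiplicativity give
  \<open>(p x)\<^sup>2 \<le> p (free_adj x) * p x\<close>. Cancel \<open>p x\<close> unless it is 0,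
  then apply the result to the adjoint as well.\<close>

lemma cstar_seminorm_adj: "p (free_adj x) = p x"
proof -
  have "p x \<le> p (free_adj x)" for x
    using cstar_seminorm_cstar[of x] cstar_seminorm_mult[of "free_adj x" x]
      cstar_seminorm_nonneg[of x] cstar_seminorm_nonneg[of "free_adj x"]
    by (cases "p x = 0") (auto simp: power2_eq_square)
  from this[of x] this[of "free_adj x"] show ?thesis
    by (simp add: free_adj_simps)
qed

text \<open>The C*-identity at 1 says that \<open>p 1\<close> is idempotent, hence 0 or 1. The value
  0 does occur, for the zero seminorm.\<close>

lemma cstar_seminorm_one_le: "p 1 \<le> 1"
proof -
  have "p 1 = (p 1)\<^sup>2" using cstar_seminorm_cstar[of 1] by simp
  then show ?thesis
    by (metis cstar_seminorm_nonneg le_numeral_extra(4) mult_cancel_left2 power2_eq_square zero_le_one)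
qed

lemma cstar_seminorm_power: "p (x ^ Suc n) \<le> p x ^ Suc n"
proof (induction n)
  case (Suc n)
  have "p (x ^ Suc (Suc n)) \<le> p x * p (x ^ Suc n)"
    using cstar_seminorm_mult[of x "x ^ Suc n"] by simp
  also have "\<dots> \<le> p x * p x ^ Suc n"
    by (intro mult_left_mono Suc) simp
  finally show ?case by simp
qed simp

lemma cstar_seminorm_power': "p (x ^ n) \<le> p x ^ n"
  by (cases n) (use cstar_seminorm_one_le cstar_seminorm_power in auto)

lemma cstar_seminorm_eqI: "p (x - y) = 0 \<Longrightarrow> p x = p y"
  using cstar_seminorm_abs_diff[of x y] by simp

text \<open>Up to elements of seminorm 0, \<open>free_adj x * x\<close> is a self-adjoint
  idempotent, so its seminorm equals its own square and is 0 or 1. The C*-identity passes this to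
  \<open>x\<close>.\<close>

lemma cstar_seminorm_le_one:
  assumes "p (x * free_adj x * x - x) = 0"
  shows "p x \<le> 1"
proof -
  let ?h = "free_adj x * x"
  have "p (?h * ?h - ?h) \<le> p (free_adj x) * p (x * free_adj x * x - x)"
    using cstar_seminorm_mult[of "free_adj x" "x * free_adj x * x - x"] by (simp add: algebra_simps)
  then have "p (?h * ?h - ?h) = 0"
    using assms by (simp add: order_antisym)
  then have "p (?h * ?h) = p ?h" by (rule cstar_seminorm_eqI)
  moreover have "p (?h * ?h) = (p ?h)\<^sup>2"
    using cstar_seminorm_cstar[of ?h] by (simp add: free_adj_mult free_adj_simps)
  ultimately have "p ?h = 0 \<or> p ?h = 1"
    by (metis mult_cancel_left2 power2_eq_square)
  then have "(p x)\<^sup>2 \<le> 1"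
    by (auto simp: cstar_seminorm_cstar)
  then show ?thesis by (simp add: power_le_one_iff abs_square_le_1)
qed

text \<open>The right-hand side is the l1-norm of the coefficients and does not depend on
  \<open>p\<close>. This uniform bound is what makes the supremum over all admissible seminorms
  finite.\<close>

lemma cstar_seminorm_le_length:
  assumes "\<And>g. p (gen g) \<le> 1"
  shows "p x \<le> (\<Sum>w\<in>Poly_Mapping.keys x. cmod (Poly_Mapping.lookup x w))"
proof -
  have word: "p (Poly_Mapping.single w 1) \<le> 1" for w
  proof -
    obtain xs where w: "w = Word xs" by (cases w)
    show ?thesis unfolding w single_Word_eq
    proof (induction xs)
      case Nil
      show ?case using cstar_seminorm_one_le by simp
    next
      case (Cons a xs)
      define y where "y = (case a of (g, b) \<Rightarrow> if b then free_adj (gen g) else gen g)"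
      define z where "z = prod_list (map (\<lambda>(g, b). if b then free_adj (gen g) else gen g) xs)"
      have "p y \<le> 1" unfolding y_def
        using assms by (auto simp: cstar_seminorm_adj split: prod.splits)
      moreover have "p z \<le> 1" using Cons by (simp add: z_def)
      ultimately have "p y * p z \<le> 1"
        by (simp add: mult_le_one)
      then have "p (y * z) \<le> 1"
        using cstar_seminorm_mult[of y z] by linarith
      then show ?case by (simp add: y_def z_def)
    qed
  qed
  have "x = (\<Sum>w\<in>Poly_Mapping.keys x. free_scale (Poly_Mapping.lookup x w) (Poly_Mapping.single w 1))"
    by (rule poly_mapping_eqI)
       (simp add: lookup_sum lookup_single when_def in_keys_iff if_distrib[of "(*) _"] cong: if_cong)
  moreover have "p (\<Sum>w\<in>A. free_scale (f w) (Poly_Mapping.single w 1)) \<le> (\<Sum>w\<in>A. cmod (f w))"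
    if "finite A" for A f
    using that
  proof (induction A rule: finite_induct)
    case (insert a A)
    have "p (free_scale (f a) (Poly_Mapping.single a 1)) \<le> cmod (f a)"
      using word[of a] by (simp add: cstar_seminorm_scale mult_left_le)
    then show ?case
      using insert cstar_seminorm_add[of "free_scale (f a) (Poly_Mapping.single a 1)"
          "\<Sum>w\<in>A. free_scale (f w) (Poly_Mapping.single w 1)"] by simp
  qed simp
  ultimately show ?thesis by (metis finite_keys)
qed

end

lemma square_le_of_le_sqrt: "0 \<le> a \<Longrightarrow> a \<le> sqrt b \<Longrightarrow> a\<^sup>2 \<le> b"
  using power_mono[of a "sqrt b" 2] order_trans[of 0 a "sqrt b"] by simp

text \<open>Squaring is increasing on nonnegative reals and therefore commutes with the supremum;
  this carries the C*-identity over. The other laws pass to the supremum directly.\<close>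

lemma cstar_seminorm_SUP:
  assumes "\<P> \<noteq> {}" "\<And>p. p \<in> \<P> \<Longrightarrow> cstar_seminorm p" "\<And>x. bdd_above ((\<lambda>p. p x) ` \<P>)"
  shows "cstar_seminorm (\<lambda>x. SUP p\<in>\<P>. p x)"
proof -
  have le: "p x \<le> (SUP p\<in>\<P>. p x)" if "p \<in> \<P>" for p x
    using assms(3) that by (rule cSUP_upper2) simp
  have nonneg: "0 \<le> (SUP p\<in>\<P>. p x)" for x
    using assms le cstar_seminorm_nonneg by (metis ex_in_conv order_trans)
  show ?thesis
    unfolding cstar_seminorm_def
  proof (intro conjI allI)
    fix x y
    show "(SUP p\<in>\<P>. p (x + y)) \<le> (SUP p\<in>\<P>. p x) + (SUP p\<in>\<P>. p y)"
      using assms(1)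
    proof (rule cSUP_least)
      fix p assume p: "p \<in> \<P>"
      show "p (x + y) \<le> (SUP p\<in>\<P>. p x) + (SUP p\<in>\<P>. p y)"
        using cstar_seminorm_add[OF assms(2)[OF p], of x y] le[OF p, of x] le[OF p, of y] by linarith
    qed
    show "(SUP p\<in>\<P>. p (x * y)) \<le> (SUP p\<in>\<P>. p x) * (SUP p\<in>\<P>. p y)"
      using assms(1)
    proof (rule cSUP_least)
      fix p assume p: "p \<in> \<P>"
      show "p (x * y) \<le> (SUP p\<in>\<P>. p x) * (SUP p\<in>\<P>. p y)"
        using cstar_seminorm_mult[OF assms(2)[OF p], of x y] le[OF p, of x] le[OF p, of y]
          cstar_seminorm_nonneg[OF assms(2)[OF p]] nonneg
        by (meson mult_mono order_trans)
    qed
  next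
    fix c x
    have "(SUP p\<in>\<P>. p (free_scale c x)) = (SUP p\<in>\<P>. cmod c * p x)"
      by (intro SUP_cong refl cstar_seminorm_scale assms)
    also have "\<dots> = cmod c * (SUP p\<in>\<P>. p x)"
    proof -
      have "cmod c * Sup ((\<lambda>p. p x) ` \<P>) = (SUP r\<in>(\<lambda>p. p x) ` \<P>. cmod c * r)"
        by (rule continuous_at_Sup_mono)
           (use assms in \<open>auto intro!: continuous_intros mult_left_mono simp: mono_def\<close>)
      then show ?thesis by (simp add: image_image)
    qed
    finally show "(SUP p\<in>\<P>. p (free_scale c x)) = cmod c * (SUP p\<in>\<P>. p x)" .
  next
    fix x
    have "(SUP p\<in>\<P>. p (free_adj x * x)) = (SUP p\<in>\<P>. (p x)\<^sup>2)"
      by (intro SUP_cong refl cstar_seminorm_cstar assms)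
    also have "\<dots> = (SUP p\<in>\<P>. p x)\<^sup>2"
    proof (rule antisym)
      show "(SUP p\<in>\<P>. (p x)\<^sup>2) \<le> (SUP p\<in>\<P>. p x)\<^sup>2"
        using assms(1) by (rule cSUP_least) (auto intro!: power_mono le cstar_seminorm_nonneg assms)
      have bdd: "bdd_above ((\<lambda>p. (p x)\<^sup>2) ` \<P>)"
        by (rule bdd_aboveI2[where M = "(SUP p\<in>\<P>. p x)\<^sup>2"])
           (auto intro!: power_mono le cstar_seminorm_nonneg assms)
      have "(SUP p\<in>\<P>. p x) \<le> sqrt (SUP p\<in>\<P>. (p x)\<^sup>2)"
        using assms(1) by (rule cSUP_least) (auto intro!: real_le_rsqrt cSUP_upper bdd)
      then show "(SUP p\<in>\<P>. p x)\<^sup>2 \<le> (SUP p\<in>\<P>. (p x)\<^sup>2)"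
        
        by (rule square_le_of_le_sqrt[OF nonneg])
    qed
    finally show "(SUP p\<in>\<P>. p (free_adj x * x)) = (SUP p\<in>\<P>. p x)\<^sup>2" .
  qed
qed

text \<open>Excludes that \<open>universal_seminorm R\<close> is the supremum of an unbounded set,
  whose value would be unspecified. The bound 1 is the one that projections and partial isometries
  satisfy.\<close>

definition bounding_rels :: "'g free_star set \<Rightarrow> bool" where
  "bounding_rels R \<longleftrightarrow> (\<forall>p. cstar_seminorm p \<longrightarrow> (\<forall>r\<in>R. p r = 0) \<longrightarrow> (\<forall>g. p (gen g) \<le> 1))"

lemma cstar_seminorm_null: "cstar_seminorm (\<lambda>_. 0)"
  by (simp add: cstar_seminorm_def)

context
  fixes R :: "'g free_star set"
  assumes R: "bounding_rels R"
begin

lemma universal_bdd_above: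
  "bdd_above ((\<lambda>p. p x) ` {p. cstar_seminorm p \<and> (\<forall>r\<in>R. p r = 0)})"
  by (rule bdd_aboveI2[where M = "\<Sum>w\<in>Poly_Mapping.keys x. cmod (Poly_Mapping.lookup x w)"])
     (use R in \<open>auto simp: bounding_rels_def intro!: cstar_seminorm_le_length\<close>)

lemma le_universal_seminorm:
  assumes "cstar_seminorm p" "\<And>r. r \<in> R \<Longrightarrow> p r = 0"
  shows "p x \<le> universal_seminorm R x"
  unfolding universal_seminorm_def using assms
  by (intro cSUP_upper universal_bdd_above) auto

lemma cstar_seminorm_universal: "cstar_seminorm (universal_seminorm R)"
  unfolding universal_seminorm_def[abs_def]
  by (rule cstar_seminorm_SUP) (use cstar_seminorm_null universal_bdd_above in auto)

lemma universal_seminorm_rel: "r \<in> R \<Longrightarrow> universal_seminorm R r = 0"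
proof (rule antisym)
  assume "r \<in> R"
  then show "universal_seminorm R r \<le> 0" unfolding universal_seminorm_def
    by (intro cSUP_least) (use cstar_seminorm_null in auto)
qed (rule cstar_seminorm_nonneg[OF cstar_seminorm_universal])

end

lemma bounding_S_rels: "bounding_rels (S_rels :: ('n::finite \<times> 'n) free_star set)"
  unfolding bounding_rels_def
proof safe
  fix p :: "('n \<times> 'n) free_star \<Rightarrow> real" and i j :: 'n
  assume p: "cstar_seminorm p" and r: "\<forall>r\<in>S_rels. p r = 0"
  let ?x = "gen (i, j) :: ('n \<times> 'n) free_star"
  have "free_adj ?x - ?x \<in> S_rels" "?x * ?x - ?x \<in> S_rels"
    by (auto simp: S_rels_def magic_unitary_rels_def projection_rels_def)
  with r have 1: "p (free_adj ?x - ?x) = 0" and 2: "p (?x * ?x - ?x) = 0" by auto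
  \<comment> \<open>A projection is a partial isometry: the defect of the latter is written as a
    combination of the two projection relations, each of seminorm 0.\<close>
  have "p (?x * free_adj ?x * ?x - ?x) =
      p (?x * (free_adj ?x - ?x) * ?x + (?x * (?x * ?x - ?x) + (?x * ?x - ?x)))"
    by (simp add: algebra_simps)
  also have "\<dots> \<le> p (?x * (free_adj ?x - ?x) * ?x) + (p (?x * (?x * ?x - ?x)) + p (?x * ?x - ?x))"
    using cstar_seminorm_add[OF p] by (meson add_left_mono order_trans)
  also have "\<dots> \<le> (p ?x * p (free_adj ?x - ?x)) * p ?x + (p ?x * p (?x * ?x - ?x) + p (?x * ?x - ?x))"
    using cstar_seminorm_mult[OF p] cstar_seminorm_nonneg[OF p]
    by (intro add_mono order_refl) (meson mult_right_mono order_trans)+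
  also have "\<dots> = 0" using 1 2 by simp
  finally show "p ?x \<le> 1"
    using cstar_seminorm_nonneg[OF p] by (intro cstar_seminorm_le_one[OF p]) (simp add: order_antisym)
qed

lemma bounding_G_rels: "bounding_rels (G_rels :: ('n::finite \<times> 'n) free_star set)"
  unfolding bounding_rels_def
proof safe
  fix p :: "('n \<times> 'n) free_star \<Rightarrow> real" and i j :: 'n
  assume p: "cstar_seminorm p" and r: "\<forall>r\<in>G_rels. p r = 0"
  have "partial_isometry_rel (gen (i, j)) \<in> G_rels"
    unfolding G_rels_def Let_def by blast
  with r show "p (gen (i, j)) \<le> 1"
    by (intro cstar_seminorm_le_one[OF p]) (auto simp: partial_isometry_rel_def)
qed

section \<open>Completions\<close>

lemma UN_eq_const: "a \<in> A \<Longrightarrow> (\<And>x. x \<in> A \<Longrightarrow> F x = C) \<Longrightarrow> (\<Union>x\<in>A. F x) = C"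
  by blast

locale star_carrier =
  fixes A :: "('a, 'm) star_algebra_scheme" (structure)
  assumes zero_closed [simp]: "\<zero> \<in> carrier A"
    and one_closed [simp]: "\<one> \<in> carrier A"
    and add_closed [simp]: "x \<in> carrier A \<Longrightarrow> y \<in> carrier A \<Longrightarrow> x \<oplus> y \<in> carrier A"
    and mult_closed [simp]: "x \<in> carrier A \<Longrightarrow> y \<in> carrier A \<Longrightarrow> x \<otimes> y \<in> carrier A"
    and smult_closed [simp]: "x \<in> carrier A \<Longrightarrow> c \<odot>\<^bsub>A\<^esub> x \<in> carrier A"
    and star_closed [simp]: "x \<in> carrier A \<Longrightarrow> star A x \<in> carrier A"

text \<open>Everything is phrased through norms of differences instead of algebraic identities.
  Lists representing tensors violate distributivity and even the law that \<open>x - x\<close> is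
  zero, but satisfy all of these inequalities.\<close>

locale seminormed_star_algebra = star_carrier A
  for A :: "('a, 'm) star_algebra_scheme" (structure) +
  assumes dist_zero: "x \<in> carrier A \<Longrightarrow> nrm A (diff A x \<zero>) = nrm A x"
    and dist_refl: "x \<in> carrier A \<Longrightarrow> nrm A (diff A x x) = 0"
    and dist_sym: "x \<in> carrier A \<Longrightarrow> y \<in> carrier A \<Longrightarrow> nrm A (diff A x y) = nrm A (diff A y x)"
    and dist_triangle: "x \<in> carrier A \<Longrightarrow> y \<in> carrier A \<Longrightarrow> z \<in> carrier A \<Longrightarrow>
      nrm A (diff A x z) \<le> nrm A (diff A x y) + nrm A (diff A y z)"
    and dist_add: "x \<in> carrier A \<Longrightarrow> y \<in> carrier A \<Longrightarrow> x' \<in> carrier A \<Longrightarrow> y' \<in> carrier A \<Longrightarrow>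
      nrm A (diff A (x \<oplus> y) (x' \<oplus> y')) \<le> nrm A (diff A x x') + nrm A (diff A y y')"
    and dist_smult: "x \<in> carrier A \<Longrightarrow> y \<in> carrier A \<Longrightarrow>
      nrm A (diff A (c \<odot>\<^bsub>A\<^esub> x) (c \<odot>\<^bsub>A\<^esub> y)) \<le> cmod c * nrm A (diff A x y)"
    and dist_mult: "x \<in> carrier A \<Longrightarrow> y \<in> carrier A \<Longrightarrow> x' \<in> carrier A \<Longrightarrow> y' \<in> carrier A \<Longrightarrow>
      nrm A (diff A (x \<otimes> y) (x' \<otimes> y')) \<le>
        nrm A x * nrm A (diff A y y') + nrm A (diff A x x') * nrm A y'"
    and dist_star: "x \<in> carrier A \<Longrightarrow> y \<in> carrier A \<Longrightarrow>
      nrm A (diff A (star A x) (star A y)) \<le> nrm A (diff A x y)"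
    and dist_diff: "x \<in> carrier A \<Longrightarrow> y \<in> carrier A \<Longrightarrow> z \<in> carrier A \<Longrightarrow>
      nrm A (diff A x (y \<oplus> z)) = nrm A (diff A (diff A x y) z)"
begin

abbreviation d :: "'a \<Rightarrow> 'a \<Rightarrow> real" where
  "d x y \<equiv> nrm A (diff A x y)"

abbreviation cls :: "(nat \<Rightarrow> 'a) \<Rightarrow> (nat \<Rightarrow> 'a) set" where
  "cls f \<equiv> cauchy_rel A `` {f}"

lemma diff_closed [simp]: "x \<in> carrier A \<Longrightarrow> y \<in> carrier A \<Longrightarrow> diff A x y \<in> carrier A"
  by (simp add: diff_def)

lemma dist_nonneg [simp]:
  assumes "x \<in> carrier A" "y \<in> carrier A"
  shows "0 \<le> d x y"
  using dist_triangle[OF assms assms(1)] dist_refl[OF assms(1)] dist_sym[OF assms] by linarith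

lemma nrm_nonneg [simp]:
  assumes "x \<in> carrier A"
  shows "0 \<le> nrm A x"
  using dist_nonneg[OF assms zero_closed] dist_zero[OF assms] by simp

lemma nrm_lipschitz:
  assumes "x \<in> carrier A" "y \<in> carrier A"
  shows "\<bar>nrm A x - nrm A y\<bar> \<le> d x y"
  using dist_triangle[OF assms zero_closed] dist_triangle[OF assms(2,1) zero_closed]
    dist_zero[OF assms(1)] dist_zero[OF assms(2)] dist_sym[OF assms] by linarith

text \<open>With the product filter the Cauchy condition becomes a limit statement, so closure under
  the operations follows from the usual limit rules instead of epsilon arguments.\<close>

lemma cauchy_seqs_iff:
  "f \<in> cauchy_seqs A \<longleftrightarrow> (\<forall>n. f n \<in> carrier A) \<and>
     ((\<lambda>z. d (f (fst z)) (f (snd z))) \<longlongrightarrow> 0) (sequentially \<times>\<^sub>F sequentially)"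
  (is "_ \<longleftrightarrow> ?C \<and> ?L")
proof -
  have "?L \<longleftrightarrow> (\<forall>e>0. \<exists>M. \<forall>m\<ge>M. \<forall>n\<ge>M. d (f m) (f n) < e)" if ?C
    using that unfolding tendsto_iff eventually_prod_sequentially
    by (force simp: dist_sym)
  then show ?thesis by (auto simp: cauchy_seqs_def)
qed

lemma cauchy_seqs_carrier: "f \<in> cauchy_seqs A \<Longrightarrow> f n \<in> carrier A"
  by (simp add: cauchy_seqs_def)

lemma cauchy_seqsD:
  "f \<in> cauchy_seqs A \<Longrightarrow>
     ((\<lambda>z. d (f (fst z)) (f (snd z))) \<longlongrightarrow> 0) (sequentially \<times>\<^sub>F sequentially)"
  by (simp add: cauchy_seqs_iff)

lemma cauchy_seqsI:
  assumes "\<And>n. g n \<in> carrier A" "(h \<longlongrightarrow> 0) (sequentially \<times>\<^sub>F sequentially)"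
    and "\<And>m n. d (g m) (g n) \<le> h (m, n)"
  shows "g \<in> cauchy_seqs A"
  unfolding cauchy_seqs_iff
proof (intro conjI allI assms(1) Lim_null_comparison[OF always_eventually assms(2)])
  fix z :: "nat \<times> nat"
  show "norm (d (g (fst z)) (g (snd z))) \<le> h z"
    using assms(3)[of "fst z" "snd z"] dist_nonneg[OF assms(1) assms(1)] by simp
qed

lemma cauchy_seqs_bound:
  assumes f: "f \<in> cauchy_seqs A"
    and le: "\<And>n. g n \<in> carrier A" "\<And>m n. d (g m) (g n) \<le> C * d (f m) (f n)"
  shows "g \<in> cauchy_seqs A"
  by (rule cauchy_seqsI[OF le(1) tendsto_mult_right_zero[OF cauchy_seqsD[OF f], of C]])
     (simp add: le(2))

lemma cauchy_const: "a \<in> carrier A \<Longrightarrow> (\<lambda>_. a) \<in> cauchy_seqs A"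
  by (auto simp: cauchy_seqs_def dist_refl)

lemma nrm_convergent:
  assumes f: "f \<in> cauchy_seqs A"
  shows "convergent (\<lambda>n. nrm A (f n))"
proof (rule real_Cauchy_convergent, rule metric_CauchyI)
  fix e :: real
  assume "e > 0"
  with f obtain M where "\<forall>m\<ge>M. \<forall>n\<ge>M. d (f m) (f n) < e"
    by (auto simp: cauchy_seqs_def)
  then show "\<exists>M. \<forall>m\<ge>M. \<forall>n\<ge>M. dist (nrm A (f m)) (nrm A (f n)) < e"
    unfolding dist_real_def
    by (intro exI[of _ M] allI impI le_less_trans[OF nrm_lipschitz]) (auto simp: cauchy_seqs_carrier[OF f])
qed

lemma nrm_bounded:
  assumes "f \<in> cauchy_seqs A"
  obtains K where "K > 0" "\<And>n. nrm A (f n) \<le> K"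
  using convergent_imp_Bseq[OF nrm_convergent[OF assms]] by (auto simp: Bseq_def abs_le_iff)

lemma cauchy_add:
  assumes f: "f \<in> cauchy_seqs A" and g: "g \<in> cauchy_seqs A"
  shows "(\<lambda>n. f n \<oplus> g n) \<in> cauchy_seqs A"
proof (rule cauchy_seqsI)
  note [simp] = cauchy_seqs_carrier[OF f] cauchy_seqs_carrier[OF g]
  show "((\<lambda>z. d (f (fst z)) (f (snd z)) + d (g (fst z)) (g (snd z))) \<longlongrightarrow> 0)
      (sequentially \<times>\<^sub>F sequentially)"
    by (rule tendsto_add_zero[OF cauchy_seqsD[OF f] cauchy_seqsD[OF g]])
qed (auto intro: dist_add simp: cauchy_seqs_carrier[OF f] cauchy_seqs_carrier[OF g])

lemma cauchy_mult:
  assumes f: "f \<in> cauchy_seqs A" and g: "g \<in> cauchy_seqs A"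
  shows "(\<lambda>n. f n \<otimes> g n) \<in> cauchy_seqs A"
proof -
  note [simp] = cauchy_seqs_carrier[OF f] cauchy_seqs_carrier[OF g]
  obtain K L where K: "K > 0" "\<And>n. nrm A (f n) \<le> K" and L: "L > 0" "\<And>n. nrm A (g n) \<le> L"
    using nrm_bounded f g by metis
  show ?thesis
  proof (rule cauchy_seqsI)
    show "((\<lambda>z. K * d (g (fst z)) (g (snd z)) + d (f (fst z)) (f (snd z)) * L) \<longlongrightarrow> 0)
        (sequentially \<times>\<^sub>F sequentially)"
      by (intro tendsto_add_zero tendsto_mult_right_zero tendsto_mult_left_zero cauchy_seqsD f g)
    fix m n
    have "d (f m \<otimes> g m) (f n \<otimes> g n) \<le> nrm A (f m) * d (g m) (g n) + d (f m) (f n) * nrm A (g n)"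
      using f g by (intro dist_mult) auto
    also have "\<dots> \<le> K * d (g m) (g n) + d (f m) (f n) * L"
      using f g K L by (intro add_mono mult_right_mono mult_left_mono) auto
    finally show "d (f m \<otimes> g m) (f n \<otimes> g n) \<le>
        K * d (g (fst (m, n))) (g (snd (m, n))) + d (f (fst (m, n))) (f (snd (m, n))) * L"
      by simp
  qed simp
qed

lemma cauchy_smult: "f \<in> cauchy_seqs A \<Longrightarrow> (\<lambda>n. c \<odot>\<^bsub>A\<^esub> f n) \<in> cauchy_seqs A"
  by (rule cauchy_seqs_bound[where C = "cmod c"]) (auto intro: dist_smult simp: cauchy_seqs_carrier)

lemma cauchy_star: "f \<in> cauchy_seqs A \<Longrightarrow> (\<lambda>n. star A (f n)) \<in> cauchy_seqs A"
  by (rule cauchy_seqs_bound[where C = 1]) (auto intro: dist_star simp: cauchy_seqs_carrier)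

lemma cauchy_diff:
  "f \<in> cauchy_seqs A \<Longrightarrow> g \<in> cauchy_seqs A \<Longrightarrow> (\<lambda>n. diff A (f n) (g n)) \<in> cauchy_seqs A"
  unfolding diff_def by (intro cauchy_add cauchy_smult)

lemma cauchy_rel_iff:
  "(f, g) \<in> cauchy_rel A \<longleftrightarrow>
     f \<in> cauchy_seqs A \<and> g \<in> cauchy_seqs A \<and> (\<lambda>n. d (f n) (g n)) \<longlonglongrightarrow> 0"
  by (simp add: cauchy_rel_def)

lemma equiv_cauchy_rel: "equiv (cauchy_seqs A) (cauchy_rel A)"
proof (rule equivI)
  show "cauchy_rel A \<subseteq> cauchy_seqs A \<times> cauchy_seqs A"
    by (auto simp: cauchy_rel_iff)
  show "refl_on (cauchy_seqs A) (cauchy_rel A)"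
    by (auto simp: refl_on_def cauchy_rel_iff dist_refl cauchy_seqs_carrier)
  show "sym (cauchy_rel A)"
  proof (rule symI)
    fix f g
    assume *: "(f, g) \<in> cauchy_rel A"
    then have "(\<lambda>n. d (g n) (f n)) = (\<lambda>n. d (f n) (g n))"
      by (auto simp: fun_eq_iff cauchy_rel_iff intro!: dist_sym cauchy_seqs_carrier)
    with * show "(g, f) \<in> cauchy_rel A" by (simp add: cauchy_rel_iff)
  qed
  show "trans (cauchy_rel A)"
  proof (rule transI)
    fix f g h
    assume *: "(f, g) \<in> cauchy_rel A" "(g, h) \<in> cauchy_rel A"
    then have lim: "(\<lambda>n. d (f n) (g n) + d (g n) (h n)) \<longlonglongrightarrow> 0"
      by (intro tendsto_add_zero) (auto simp: cauchy_rel_iff)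
    have "(\<lambda>n. d (f n) (h n)) \<longlonglongrightarrow> 0"
      by (rule Lim_null_comparison[OF always_eventually lim])
         (use * in \<open>auto intro!: dist_triangle simp: cauchy_rel_iff cauchy_seqs_carrier\<close>)
    with * show "(f, h) \<in> cauchy_rel A" by (auto simp: cauchy_rel_iff)
  qed
qed

lemma cls_eq_iff:
  "f \<in> cauchy_seqs A \<Longrightarrow> g \<in> cauchy_seqs A \<Longrightarrow> cls f = cls g \<longleftrightarrow> (\<lambda>n. d (f n) (g n)) \<longlonglongrightarrow> 0"
  using eq_equiv_class_iff[OF equiv_cauchy_rel, of f g] by (simp add: cauchy_rel_iff)

lemma cls_eqI:
  assumes "f \<in> cauchy_seqs A" "g \<in> cauchy_seqs A" "h \<longlonglongrightarrow> 0" "\<And>n. d (f n) (g n) \<le> h n"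
  shows "cls f = cls g"
  unfolding cls_eq_iff[OF assms(1,2)]
  by (rule Lim_null_comparison[OF always_eventually assms(3)]) (use assms in \<open>auto simp: cauchy_seqs_carrier\<close>)

lemma in_cls_self: "f \<in> cauchy_seqs A \<Longrightarrow> f \<in> cls f"
  using equiv_class_self[OF equiv_cauchy_rel] .

lemma in_cls_iff: "f \<in> cls g \<longleftrightarrow> f \<in> cauchy_seqs A \<and> g \<in> cauchy_seqs A \<and> cls f = cls g"
  using equiv_class_eq_iff[OF equiv_cauchy_rel, of g f] by auto

lemma in_clsD:
  assumes "f \<in> cls g"
  shows "f \<in> cauchy_seqs A" "g \<in> cauchy_seqs A" "(\<lambda>n. d (f n) (g n)) \<longlonglongrightarrow> 0"
proof -
  show f: "f \<in> cauchy_seqs A" and g: "g \<in> cauchy_seqs A"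
    using assms by (simp_all only: in_cls_iff)
  show "(\<lambda>n. d (f n) (g n)) \<longlonglongrightarrow> 0"
    using assms cls_eq_iff[OF f g] by (simp only: in_cls_iff)
qed

lemma carrier_completion: "carrier (completion A) = cauchy_seqs A // cauchy_rel A"
  by (simp add: completion_def)

lemma cls_closed: "f \<in> cauchy_seqs A \<Longrightarrow> cls f \<in> carrier (completion A)"
  by (simp add: carrier_completion quotientI)

lemma completionE:
  assumes "X \<in> carrier (completion A)"
  obtains f where "f \<in> cauchy_seqs A" "X = cls f"
  using assms unfolding carrier_completion by (auto elim: quotientE)

text \<open>\<open>completion\<close> takes a union over all representatives. It collapses to a
  single class because every choice of representatives yields the same one.\<close>

lemma completion_add:
  assumes f: "f \<in> cauchy_seqs A" and g: "g \<in> cauchy_seqs A"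
  shows "cls f \<oplus>\<^bsub>completion A\<^esub> cls g = cls (\<lambda>n. f n \<oplus> g n)"
proof -
  have eq: "cls (\<lambda>n. f' n \<oplus> g' n) = cls (\<lambda>n. f n \<oplus> g n)" if "f' \<in> cls f" "g' \<in> cls g" for f' g'
  proof -
    note f' = in_clsD[OF that(1)] and g' = in_clsD[OF that(2)]
    show ?thesis
      by (rule cls_eqI[OF cauchy_add[OF f'(1) g'(1)] cauchy_add[OF f g] tendsto_add_zero[OF f'(3) g'(3)]])
         (intro dist_add cauchy_seqs_carrier f f'(1) g g'(1))
  qed
  have "(\<Union>f'\<in>cls f. \<Union>g'\<in>cls g. cls (\<lambda>n. f' n \<oplus> g' n)) = cls (\<lambda>n. f n \<oplus> g n)"
    by (intro UN_eq_const[OF in_cls_self[OF f]] UN_eq_const[OF in_cls_self[OF g]] eq)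
  then show ?thesis by (simp add: completion_def)
qed

lemma completion_mult:
  assumes f: "f \<in> cauchy_seqs A" and g: "g \<in> cauchy_seqs A"
  shows "cls f \<otimes>\<^bsub>completion A\<^esub> cls g = cls (\<lambda>n. f n \<otimes> g n)"
proof -
  have eq: "cls (\<lambda>n. f' n \<otimes> g' n) = cls (\<lambda>n. f n \<otimes> g n)" if fg: "f' \<in> cls f" "g' \<in> cls g" for f' g'
  proof -
    note f' = in_clsD[OF fg(1)] and g' = in_clsD[OF fg(2)]
    note car = cauchy_seqs_carrier[OF f] cauchy_seqs_carrier[OF g]
      cauchy_seqs_carrier[OF f'(1)] cauchy_seqs_carrier[OF g'(1)]
    obtain K L where K: "K > 0" "\<And>n. nrm A (f' n) \<le> K" and L: "L > 0" "\<And>n. nrm A (g n) \<le> L"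
      using nrm_bounded f'(1) g by metis
    show ?thesis
    proof (rule cls_eqI[OF cauchy_mult[OF f'(1) g'(1)] cauchy_mult[OF f g]])
      show "(\<lambda>n. K * d (g' n) (g n) + d (f' n) (f n) * L) \<longlonglongrightarrow> 0"
        by (intro tendsto_add_zero tendsto_mult_right_zero tendsto_mult_left_zero f'(3) g'(3))
      fix n
      have "d (f' n \<otimes> g' n) (f n \<otimes> g n) \<le> nrm A (f' n) * d (g' n) (g n) + d (f' n) (f n) * nrm A (g n)"
        by (intro dist_mult car)
      also have "\<dots> \<le> K * d (g' n) (g n) + d (f' n) (f n) * L"
        using car K L by (intro add_mono mult_right_mono mult_left_mono) auto
      finally show "d (f' n \<otimes> g' n) (f n \<otimes> g n) \<le> K * d (g' n) (g n) + d (f' n) (f n) * L" .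
    qed
  qed
  have "(\<Union>f'\<in>cls f. \<Union>g'\<in>cls g. cls (\<lambda>n. f' n \<otimes> g' n)) = cls (\<lambda>n. f n \<otimes> g n)"
    by (intro UN_eq_const[OF in_cls_self[OF f]] UN_eq_const[OF in_cls_self[OF g]] eq)
  then show ?thesis by (simp add: completion_def)
qed

lemma completion_smult:
  assumes f: "f \<in> cauchy_seqs A"
  shows "c \<odot>\<^bsub>completion A\<^esub> cls f = cls (\<lambda>n. c \<odot>\<^bsub>A\<^esub> f n)"
proof -
  have eq: "cls (\<lambda>n. c \<odot>\<^bsub>A\<^esub> f' n) = cls (\<lambda>n. c \<odot>\<^bsub>A\<^esub> f n)" if "f' \<in> cls f" for f'
  proof -
    note f' = in_clsD[OF that]
    show ?thesis
      by (rule cls_eqI[OF cauchy_smult[OF f'(1)] cauchy_smult[OF f] tendsto_mult_right_zero[OF f'(3), of "cmod c"]])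
         (intro dist_smult cauchy_seqs_carrier f f'(1))
  qed
  have "(\<Union>f'\<in>cls f. cls (\<lambda>n. c \<odot>\<^bsub>A\<^esub> f' n)) = cls (\<lambda>n. c \<odot>\<^bsub>A\<^esub> f n)"
    by (intro UN_eq_const[OF in_cls_self[OF f]] eq)
  then show ?thesis by (simp add: completion_def)
qed

lemma completion_star:
  assumes f: "f \<in> cauchy_seqs A"
  shows "star (completion A) (cls f) = cls (\<lambda>n. star A (f n))"
proof -
  have eq: "cls (\<lambda>n. star A (f' n)) = cls (\<lambda>n. star A (f n))" if "f' \<in> cls f" for f'
  proof -
    note f' = in_clsD[OF that]
    show ?thesis
      by (rule cls_eqI[OF cauchy_star[OF f'(1)] cauchy_star[OF f] f'(3)])
         (intro dist_star cauchy_seqs_carrier f f'(1))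
  qed
  have "(\<Union>f'\<in>cls f. cls (\<lambda>n. star A (f' n))) = cls (\<lambda>n. star A (f n))"
    by (intro UN_eq_const[OF in_cls_self[OF f]] eq)
  then show ?thesis by (simp add: completion_def)
qed

lemma completion_diff:
  assumes f: "f \<in> cauchy_seqs A" and g: "g \<in> cauchy_seqs A"
  shows "diff (completion A) (cls f) (cls g) = cls (\<lambda>n. diff A (f n) (g n))"
  using assms by (simp add: diff_def completion_add completion_smult cauchy_smult)

lemma completion_zero: "\<zero>\<^bsub>completion A\<^esub> = cls (\<lambda>_. \<zero>)"
  by (simp add: completion_def embed_def)

lemma completion_one: "\<one>\<^bsub>completion A\<^esub> = cls (\<lambda>_. \<one>)"
  by (simp add: completion_def embed_def)

lemma completion_nrm:
  assumes f: "f \<in> cauchy_seqs A"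
  shows "(\<lambda>n. nrm A (f n)) \<longlonglongrightarrow> nrm (completion A) (cls f)"
proof -
  obtain r where r: "(\<lambda>n. nrm A (f n)) \<longlonglongrightarrow> r"
    using nrm_convergent[OF f] by (auto simp: convergent_def)
  have "(\<lambda>n. nrm A (f' n)) \<longlonglongrightarrow> r" if "f' \<in> cls f" for f'
  proof -
    have "(\<lambda>n. nrm A (f' n) - nrm A (f n)) \<longlonglongrightarrow> 0"
    proof (rule Lim_null_comparison)
      show "(\<lambda>n. d (f' n) (f n)) \<longlonglongrightarrow> 0" by (rule in_clsD(3)[OF that])
      show "\<forall>\<^sub>F n in sequentially. norm (nrm A (f' n) - nrm A (f n)) \<le> d (f' n) (f n)"
        using in_clsD(1,2)[OF that] by (auto intro!: always_eventually nrm_lipschitz simp: cauchy_seqs_carrier)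
    qed
    from tendsto_add[OF this r] show ?thesis by simp
  qed
  then have "nrm (completion A) (cls f) = r"
    using in_cls_self[OF f] unfolding completion_def
    by (auto intro!: the_equality intro: LIMSEQ_unique)
  with r show ?thesis by simp
qed

lemma completion_nrm_embed: "a \<in> carrier A \<Longrightarrow> nrm (completion A) (embed A a) = nrm A a"
  using completion_nrm[OF cauchy_const] by (simp add: embed_def LIMSEQ_const_iff)

lemma embed_closed: "a \<in> carrier A \<Longrightarrow> embed A a \<in> carrier (completion A)"
  by (simp add: embed_def cls_closed cauchy_const)

lemma embed_hom:
  "a \<in> carrier A \<Longrightarrow> b \<in> carrier A \<Longrightarrow> embed A a \<oplus>\<^bsub>completion A\<^esub> embed A b = embed A (a \<oplus> b)"
  "a \<in> carrier A \<Longrightarrow> b \<in> carrier A \<Longrightarrow> embed A a \<otimes>\<^bsub>completion A\<^esub> embed A b = embed A (a \<otimes> b)"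
  "a \<in> carrier A \<Longrightarrow> c \<odot>\<^bsub>completion A\<^esub> embed A a = embed A (c \<odot>\<^bsub>A\<^esub> a)"
  "a \<in> carrier A \<Longrightarrow> star (completion A) (embed A a) = embed A (star A a)"
  by (simp_all add: embed_def completion_add completion_mult completion_smult completion_star cauchy_const)

lemma embed_eq_iff:
  "a \<in> carrier A \<Longrightarrow> b \<in> carrier A \<Longrightarrow> embed A a = embed A b \<longleftrightarrow> d a b = 0"
  unfolding embed_def by (subst cls_eq_iff) (auto simp: cauchy_const LIMSEQ_const_iff)

lemma embed_tendsto:
  assumes f: "f \<in> cauchy_seqs A"
  shows "(\<lambda>n. nrm (completion A) (diff (completion A) (embed A (f n)) (cls f))) \<longlonglongrightarrow> 0"
proof (rule metric_LIMSEQ_I)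
  note [simp] = cauchy_seqs_carrier[OF f]
  fix e :: real
  assume e: "e > 0"
  then obtain M where M: "\<forall>m\<ge>M. \<forall>n\<ge>M. d (f m) (f n) < e / 2"
    using f unfolding cauchy_seqs_def by (auto dest: spec[of _ "e / 2"])
  have "dist (nrm (completion A) (diff (completion A) (embed A (f m)) (cls f))) 0 < e" if "m \<ge> M" for m
  proof -
    have c: "(\<lambda>_. f m) \<in> cauchy_seqs A" using f by (simp add: cauchy_const)
    have l: "(\<lambda>n. d (f m) (f n)) \<longlonglongrightarrow> nrm (completion A) (diff (completion A) (embed A (f m)) (cls f))"
      unfolding embed_def completion_diff[OF c f] using completion_nrm[OF cauchy_diff[OF c f]] .
    have "nrm (completion A) (diff (completion A) (embed A (f m)) (cls f)) \<le> e / 2"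
      by (rule tendsto_upperbound[OF l]) (use M that in \<open>auto simp: eventually_sequentially intro: less_imp_le\<close>)
    moreover have "0 \<le> nrm (completion A) (diff (completion A) (embed A (f m)) (cls f))"
      by (rule tendsto_lowerbound[OF l]) (use f in \<open>auto intro!: always_eventually\<close>)
    ultimately show ?thesis using e by simp
  qed
  then show "\<exists>M. \<forall>n\<ge>M. dist (nrm (completion A) (diff (completion A) (embed A (f n)) (cls f))) 0 < e"
    by blast
qed

text \<open>Allows a representative to be thinned out or stripped of initial terms, so that a
  quantitative bound holds from the first index on.\<close>

lemma cauchy_subseq:
  assumes f: "f \<in> cauchy_seqs A" and r: "strict_mono r"
  shows "f \<circ> r \<in> cauchy_seqs A" "cls (f \<circ> r) = cls f"
proof -
  show fr: "f \<circ> r \<in> cauchy_seqs A"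
    unfolding cauchy_seqs_iff comp_def
  proof (intro conjI allI)
    have "filterlim (\<lambda>z. (r (fst z), r (snd z))) (sequentially \<times>\<^sub>F sequentially)
        (sequentially \<times>\<^sub>F sequentially)"
      by (intro filterlim_Pair filterlim_compose[OF filterlim_subseq[OF r]] filterlim_fst filterlim_snd)
    from filterlim_compose[OF cauchy_seqsD[OF f] this]
    show "((\<lambda>z. d (f (r (fst z))) (f (r (snd z)))) \<longlongrightarrow> 0) (sequentially \<times>\<^sub>F sequentially)"
      by simp
  qed (use f in \<open>auto simp: cauchy_seqs_carrier\<close>)
  have "filterlim (\<lambda>n. (r n, n)) (sequentially \<times>\<^sub>F sequentially) sequentially"
    using filterlim_subseq[OF r] by (intro filterlim_Pair filterlim_ident)
  then have "(\<lambda>n. d (f (r n)) (f n)) \<longlonglongrightarrow> 0"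
    using filterlim_compose[OF cauchy_seqsD[OF f]] by fastforce
  then show "cls (f \<circ> r) = cls f"
    using cls_eq_iff[OF fr f] by simp
qed

lemma star_carrier_completion: "star_carrier (completion A)"
proof
  show "\<zero>\<^bsub>completion A\<^esub> \<in> carrier (completion A)" "\<one>\<^bsub>completion A\<^esub> \<in> carrier (completion A)"
    unfolding completion_zero completion_one by (intro cls_closed cauchy_const; simp)+
  fix X assume "X \<in> carrier (completion A)"
  then obtain f where f: "f \<in> cauchy_seqs A" "X = cls f" by (rule completionE)
  show "star (completion A) X \<in> carrier (completion A)" "c \<odot>\<^bsub>completion A\<^esub> X \<in> carrier (completion A)" for c
    unfolding f(2) completion_star[OF f(1)] completion_smult[OF f(1)]
    by (intro cls_closed cauchy_star cauchy_smult f)+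
  fix Y assume "Y \<in> carrier (completion A)"
  then obtain g where g: "g \<in> cauchy_seqs A" "Y = cls g" by (rule completionE)
  show "X \<oplus>\<^bsub>completion A\<^esub> Y \<in> carrier (completion A)" "X \<otimes>\<^bsub>completion A\<^esub> Y \<in> carrier (completion A)"
    unfolding f(2) g(2) completion_add[OF f(1) g(1)] completion_mult[OF f(1) g(1)]
    by (intro cls_closed cauchy_add cauchy_mult f g)+
qed

end

section \<open>The metric of the completion\<close>

context seminormed_star_algebra
begin

abbreviation D :: "(nat \<Rightarrow> 'a) set \<Rightarrow> (nat \<Rightarrow> 'a) set \<Rightarrow> real" where
  "D X Y \<equiv> nrm (completion A) (diff (completion A) X Y)"

lemma completion_dist:
  assumes f: "f \<in> cauchy_seqs A" and g: "g \<in> cauchy_seqs A"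
  shows "(\<lambda>n. d (f n) (g n)) \<longlonglongrightarrow> D (cls f) (cls g)"
  unfolding completion_diff[OF f g] by (rule completion_nrm[OF cauchy_diff[OF f g]])

lemma completion_dist_sym:
  assumes "X \<in> carrier (completion A)" "Y \<in> carrier (completion A)"
  shows "D X Y = D Y X"
proof -
  obtain f g where f: "f \<in> cauchy_seqs A" "X = cls f" and g: "g \<in> cauchy_seqs A" "Y = cls g"
    using assms by (meson completionE)
  have "(\<lambda>n. d (f n) (g n)) = (\<lambda>n. d (g n) (f n))"
    by (rule ext) (intro dist_sym cauchy_seqs_carrier f g)
  then show ?thesis
    using completion_dist[OF f(1) g(1)] completion_dist[OF g(1) f(1)] f g
    by (auto intro: LIMSEQ_unique)
qed

lemma completion_dist_triangle:
  assumes "X \<in> carrier (completion A)" "Y \<in> carrier (completion A)" "Z \<in> carrier (completion A)"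
  shows "D X Z \<le> D X Y + D Y Z"
proof -
  obtain f g h where f: "f \<in> cauchy_seqs A" "X = cls f" and g: "g \<in> cauchy_seqs A" "Y = cls g"
    and h: "h \<in> cauchy_seqs A" "Z = cls h"
    using assms by (meson completionE)
  show ?thesis unfolding f(2) g(2) h(2)
    by (rule tendsto_le[OF sequentially_bot tendsto_add completion_dist])
       (auto intro!: always_eventually dist_triangle completion_dist f g h cauchy_seqs_carrier)
qed

lemma completion_dist_nonneg:
  assumes "X \<in> carrier (completion A)" "Y \<in> carrier (completion A)"
  shows "0 \<le> D X Y"
proof -
  obtain f g where f: "f \<in> cauchy_seqs A" "X = cls f" and g: "g \<in> cauchy_seqs A" "Y = cls g"
    using assms by (meson completionE)
  show ?thesis unfolding f(2) g(2)
    by (rule LIMSEQ_le_const[OF completion_dist[OF f(1) g(1)]])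
       (auto intro!: dist_nonneg cauchy_seqs_carrier f g)
qed

lemma completion_dist_embed:
  "a \<in> carrier A \<Longrightarrow> b \<in> carrier A \<Longrightarrow> D (embed A a) (embed A b) = d a b"
  using completion_dist[OF cauchy_const cauchy_const, of a b] by (simp add: embed_def LIMSEQ_const_iff)

lemma completion_dist_eq_0:
  assumes "X \<in> carrier (completion A)" "Y \<in> carrier (completion A)" "D X Y = 0"
  shows "X = Y"
proof -
  obtain f g where f: "f \<in> cauchy_seqs A" "X = cls f" and g: "g \<in> cauchy_seqs A" "Y = cls g"
    using assms by (meson completionE)
  show ?thesis
    using completion_dist[OF f(1) g(1)] assms(3) cls_eq_iff[OF f(1) g(1)] f(2) g(2) by simp
qed

text \<open>No cancellation law is at hand. By \<open>dist_diff\<close>, the distance is the one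
  between \<open>x - x\<close> and \<open>y\<close>, and \<open>x - x\<close> has seminorm
  0.\<close>

lemma dist_increment:
  assumes "x \<in> carrier A" "y \<in> carrier A"
  shows "d x (x \<oplus> y) \<le> nrm A y"
  using assms dist_triangle[OF diff_closed[OF assms(1,1)] zero_closed assms(2)]
    dist_zero[OF diff_closed[OF assms(1,1)]] dist_refl[OF assms(1)] dist_diff[OF assms(1,1,2)]
    dist_sym[OF zero_closed assms(2)] dist_zero[OF assms(2)]
  by linarith

lemma cauchy_geometric:
  assumes x: "\<And>n. x n \<in> carrier A" and q: "0 \<le> q" "q < 1"
    and le: "\<And>n. d (x n) (x (Suc n)) \<le> K * q ^ n"
  shows "x \<in> cauchy_seqs A"
proof (rule cauchy_seqsI[OF x])
  define L where "L = K / (1 - q)"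
  have K: "0 \<le> K" using le[of 0] dist_nonneg[OF x x, of 0 "Suc 0"] by simp
  then have L: "0 \<le> L" using q by (simp add: L_def)
  \<comment> \<open>Since \<open>K = L * (1 - q)\<close>, the geometric sum telescopes; the exact
    difference of powers is kept to let the induction close.\<close>
  have tail: "d (x m) (x (m + k)) \<le> L * (q ^ m - q ^ (m + k))" for m k
  proof (induction k)
    case (Suc k)
    have "d (x m) (x (m + Suc k)) \<le> d (x m) (x (m + k)) + d (x (m + k)) (x (Suc (m + k)))"
      using dist_triangle[OF x x x] by simp
    also have "\<dots> \<le> L * (q ^ m - q ^ (m + k)) + K * q ^ (m + k)"
      using Suc le by (intro add_mono) auto
    also have "K = L * (1 - q)" using q by (simp add: L_def)
    finally show ?case by (simp add: algebra_simps)
  qed (simp add: dist_refl x)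
  have le': "d (x m) (x n) \<le> L * (q ^ m + q ^ n)" if "m \<le> n" for m n
  proof -
    have "d (x m) (x n) \<le> L * (q ^ m - q ^ n)"
      using tail[of m "n - m"] that by simp
    also have "\<dots> \<le> L * (q ^ m + q ^ n)"
      using L q by (intro mult_left_mono) auto
    finally show ?thesis .
  qed
  show "d (x m) (x n) \<le> L * (q ^ fst (m, n) + q ^ snd (m, n))" for m n
    using le'[of m n] le'[of n m] dist_sym[OF x x, of m n] by (cases "m \<le> n") (auto simp: add.commute)
  have "(\<lambda>n. q ^ n) \<longlonglongrightarrow> 0" using q by (intro LIMSEQ_power_zero) auto
  then show "((\<lambda>z. L * (q ^ fst z + q ^ snd z)) \<longlongrightarrow> 0) (sequentially \<times>\<^sub>F sequentially)"
    by (intro tendsto_mult_right_zero tendsto_add_zero)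
       (rule filterlim_compose[OF _ filterlim_fst] filterlim_compose[OF _ filterlim_snd], assumption)+
qed

end

section \<open>Homomorphisms between completions obtained from contractive relations\<close>

text \<open>The relation \<open>\<Gamma>\<close> plays the role of a *-homomorphism that need not be well-defined before
  separation.\<close>

locale star_relation = A: seminormed_star_algebra A + B: seminormed_star_algebra B
  for A :: "('a, 'm) star_algebra_scheme" and B :: "('b, 'k) star_algebra_scheme" +
  fixes \<Gamma> :: "('a \<times> 'b) set"
  assumes carrier: "(a, b) \<in> \<Gamma> \<Longrightarrow> a \<in> carrier A \<and> b \<in> carrier B"
    and zero: "(\<zero>\<^bsub>A\<^esub>, \<zero>\<^bsub>B\<^esub>) \<in> \<Gamma>"
    and add: "(a, b) \<in> \<Gamma> \<Longrightarrow> (a', b') \<in> \<Gamma> \<Longrightarrow> (a \<oplus>\<^bsub>A\<^esub> a', b \<oplus>\<^bsub>B\<^esub> b') \<in> \<Gamma>"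
    and mult: "(a, b) \<in> \<Gamma> \<Longrightarrow> (a', b') \<in> \<Gamma> \<Longrightarrow> (a \<otimes>\<^bsub>A\<^esub> a', b \<otimes>\<^bsub>B\<^esub> b') \<in> \<Gamma>"
    and smult: "(a, b) \<in> \<Gamma> \<Longrightarrow> (c \<odot>\<^bsub>A\<^esub> a, c \<odot>\<^bsub>B\<^esub> b) \<in> \<Gamma>"
    and star: "(a, b) \<in> \<Gamma> \<Longrightarrow> (star A a, star B b) \<in> \<Gamma>"
    and contraction: "(a, b) \<in> \<Gamma> \<Longrightarrow> nrm B b \<le> nrm A a"
begin

lemma diff: "(a, b) \<in> \<Gamma> \<Longrightarrow> (a', b') \<in> \<Gamma> \<Longrightarrow> (diff A a a', diff B b b') \<in> \<Gamma>"
  unfolding diff_def by (intro add smult)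

lemma dist_contraction: "(a, b) \<in> \<Gamma> \<Longrightarrow> (a', b') \<in> \<Gamma> \<Longrightarrow> B.d b b' \<le> A.d a a'"
  by (intro contraction diff)

lemma cauchy_image:
  assumes f: "f \<in> cauchy_seqs A" and fg: "\<And>n. (f n, g n) \<in> \<Gamma>"
  shows "g \<in> cauchy_seqs B"
  by (rule B.cauchy_seqsI[OF _ A.cauchy_seqsD[OF f]]) (use fg carrier dist_contraction in auto)

definition dom :: "(nat \<Rightarrow> 'a) set set" where
  "dom = {A.cls f | f. f \<in> cauchy_seqs A \<and> (\<forall>n. f n \<in> Domain \<Gamma>)}"

definition hom :: "(nat \<Rightarrow> 'a) set \<Rightarrow> (nat \<Rightarrow> 'b) set" where
  "hom X = (THE Z. \<exists>f g. f \<in> cauchy_seqs A \<and> (\<forall>n. (f n, g n) \<in> \<Gamma>) \<and> X = A.cls f \<and> Z = B.cls g)"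

text \<open>Contractivity applied to differences: if two sequences of first components have a null
  difference, then so do any partners chosen for them. Thus \<open>hom\<close> depends neither on
  the representative nor on the choice of partners.\<close>

lemma hom_cls:
  assumes f: "f \<in> cauchy_seqs A" and fg: "\<And>n. (f n, g n) \<in> \<Gamma>"
  shows "hom (A.cls f) = B.cls g"
  unfolding hom_def
proof (rule the_equality)
  show "\<exists>f' g'. f' \<in> cauchy_seqs A \<and> (\<forall>n. (f' n, g' n) \<in> \<Gamma>) \<and> A.cls f = A.cls f' \<and> B.cls g = B.cls g'"
    using f fg by blast
  fix Z
  assume "\<exists>f' g'. f' \<in> cauchy_seqs A \<and> (\<forall>n. (f' n, g' n) \<in> \<Gamma>) \<and> A.cls f = A.cls f' \<and> Z = B.cls g'"
  then obtain f' g' where f': "f' \<in> cauchy_seqs A" and fg': "\<And>n. (f' n, g' n) \<in> \<Gamma>"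
    and eq: "A.cls f = A.cls f'" and Z: "Z = B.cls g'"
    by blast
  show "Z = B.cls g" unfolding Z
  proof (rule B.cls_eqI[OF cauchy_image[OF f' fg'] cauchy_image[OF f fg]])
    show "(\<lambda>n. A.d (f' n) (f n)) \<longlonglongrightarrow> 0"
      using eq A.cls_eq_iff[OF f' f] by simp
    show "B.d (g' n) (g n) \<le> A.d (f' n) (f n)" for n
      by (rule dist_contraction[OF fg' fg])
  qed
qed

lemma domE:
  assumes "X \<in> dom"
  obtains f g where "f \<in> cauchy_seqs A" "\<And>n. (f n, g n) \<in> \<Gamma>" "g \<in> cauchy_seqs B"
    "X = A.cls f" "hom X = B.cls g"
proof -
  obtain f where f: "f \<in> cauchy_seqs A" "\<forall>n. f n \<in> Domain \<Gamma>" "X = A.cls f"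
    using assms by (auto simp: dom_def)
  then have "\<forall>n. \<exists>b. (f n, b) \<in> \<Gamma>" by blast
  then obtain g where g: "\<And>n. (f n, g n) \<in> \<Gamma>" by metis
  show ?thesis
    using that[OF f(1) g cauchy_image[OF f(1) g] f(3)] hom_cls[OF f(1) g] f(3) by blast
qed

lemma domI: "f \<in> cauchy_seqs A \<Longrightarrow> (\<And>n. (f n, g n) \<in> \<Gamma>) \<Longrightarrow> A.cls f \<in> dom"
  unfolding dom_def by (auto intro: DomainI)

lemma hom_embed:
  assumes "(a, b) \<in> \<Gamma>"
  shows "embed A a \<in> dom" "hom (embed A a) = embed B b"
  using domI[OF A.cauchy_const, of a "\<lambda>_. b"] hom_cls[OF A.cauchy_const, of a "\<lambda>_. b"] assms carrier[OF assms]
  by (auto simp: embed_def)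

lemma dom_subset: "dom \<subseteq> carrier (completion A)"
  by (auto simp: dom_def A.cls_closed)

text \<open>Diagonal choice: each \<open>F n\<close> is replaced by an embedded element of the
  domain within \<open>1 / (n + 1)\<close>. These elements converge to \<open>X\<close>, hence form
  a Cauchy sequence whose class is \<open>X\<close>.\<close>

lemma dom_closed:
  assumes F: "\<And>n. F n \<in> dom" and X: "X \<in> carrier (completion A)"
    and lim: "(\<lambda>n. A.D (F n) X) \<longlonglongrightarrow> 0"
  shows "X \<in> dom"
proof -
  have FC: "F n \<in> carrier (completion A)" for n using F dom_subset by blast
  have "\<exists>a\<in>Domain \<Gamma>. A.D (embed A a) (F n) < inverse (real (Suc n))" for n
  proof -
    obtain f g where f: "f \<in> cauchy_seqs A" "\<And>n. (f n, g n) \<in> \<Gamma>" "F n = A.cls f"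
      using domE[OF F[of n]] by metis
    have "\<forall>\<^sub>F m in sequentially. A.D (embed A (f m)) (F n) < inverse (real (Suc n))"
      using A.embed_tendsto[OF f(1)] unfolding f(3) by (rule order_tendstoD) simp
    then obtain m where "A.D (embed A (f m)) (F n) < inverse (real (Suc n))"
      by (auto simp: eventually_sequentially)
    then show ?thesis using f(2)[of m] by auto
  qed
  then obtain p where p: "\<And>n. p n \<in> Domain \<Gamma>" "\<And>n. A.D (embed A (p n)) (F n) < inverse (real (Suc n))"
    by metis
  have pA: "p n \<in> carrier A" for n using p(1)[of n] carrier by auto
  note pC = A.embed_closed[OF pA]
  define h where "h n = A.D (embed A (p n)) X" for n
  have lim': "(\<lambda>n. inverse (real (Suc n)) + A.D (F n) X) \<longlonglongrightarrow> 0"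
    using LIMSEQ_inverse_real_of_nat lim by (rule tendsto_add_zero)
  have "0 \<le> h n" for n
    unfolding h_def by (intro A.completion_dist_nonneg pC X)
  moreover have "h n \<le> inverse (real (Suc n)) + A.D (F n) X" for n
    using A.completion_dist_triangle[OF pC FC X, of n n] p(2)[of n] unfolding h_def by linarith
  ultimately have h: "h \<longlonglongrightarrow> 0"
    by (intro Lim_null_comparison[OF always_eventually lim'] allI) simp
  have pc: "p \<in> cauchy_seqs A"
  proof (rule A.cauchy_seqsI[OF pA])
    show "((\<lambda>z. h (fst z) + h (snd z)) \<longlongrightarrow> 0) (sequentially \<times>\<^sub>F sequentially)"
      by (intro tendsto_add_zero filterlim_compose[OF h] filterlim_fst filterlim_snd)
    show "A.d (p m) (p n) \<le> h (fst (m, n)) + h (snd (m, n))" for m n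
      using A.completion_dist_triangle[OF pC X pC, of m n] A.completion_dist_sym[OF X pC, of n]
      by (simp add: h_def A.completion_dist_embed pA)
  qed
  have "(\<lambda>n. A.D (embed A (p n)) (A.cls p) + h n) \<longlonglongrightarrow> 0"
    by (intro tendsto_add_zero A.embed_tendsto pc h)
  moreover have "A.D (A.cls p) X \<le> A.D (embed A (p n)) (A.cls p) + h n" for n
    using A.completion_dist_triangle[OF A.cls_closed[OF pc] pC X, of n]
      A.completion_dist_sym[OF A.cls_closed[OF pc] pC, of n] by (simp add: h_def)
  ultimately have "A.D (A.cls p) X \<le> 0"
    by (intro LIMSEQ_le_const) auto
  moreover have "0 \<le> A.D (A.cls p) X"
    by (intro A.completion_dist_nonneg A.cls_closed pc X)
  ultimately have "X = A.cls p"
    using A.completion_dist_eq_0[OF A.cls_closed[OF pc] X] by simp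
  then show ?thesis using pc p(1) by (auto simp: dom_def)
qed

lemma cstar_subalgebra_dom: "cstar_subalgebra (completion A) dom"
  unfolding cstar_subalgebra_def
proof (intro conjI ballI allI impI dom_subset)
  show "\<zero>\<^bsub>completion A\<^esub> \<in> dom"
    using hom_embed(1)[OF zero] by (simp add: A.completion_zero embed_def)
next
  fix X Y assume "X \<in> dom" "Y \<in> dom"
  then obtain f g f' g' where f: "f \<in> cauchy_seqs A" "\<And>n. (f n, g n) \<in> \<Gamma>" "X = A.cls f"
    and f': "f' \<in> cauchy_seqs A" "\<And>n. (f' n, g' n) \<in> \<Gamma>" "Y = A.cls f'"
    by (metis domE)
  show "X \<oplus>\<^bsub>completion A\<^esub> Y \<in> dom"
    unfolding f(3) f'(3) A.completion_add[OF f(1) f'(1)]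
    by (rule domI[OF A.cauchy_add[OF f(1) f'(1)] add[OF f(2) f'(2)]])
  show "X \<otimes>\<^bsub>completion A\<^esub> Y \<in> dom"
    unfolding f(3) f'(3) A.completion_mult[OF f(1) f'(1)]
    by (rule domI[OF A.cauchy_mult[OF f(1) f'(1)] mult[OF f(2) f'(2)]])
next
  fix c X assume "X \<in> dom"
  then obtain f g where f: "f \<in> cauchy_seqs A" "\<And>n. (f n, g n) \<in> \<Gamma>" "X = A.cls f"
    by (metis domE)
  show "c \<odot>\<^bsub>completion A\<^esub> X \<in> dom"
    unfolding f(3) A.completion_smult[OF f(1)]
    by (rule domI[OF A.cauchy_smult[OF f(1)] smult[OF f(2)]])
next
  fix X assume "X \<in> dom"
  then obtain f g where f: "f \<in> cauchy_seqs A" "\<And>n. (f n, g n) \<in> \<Gamma>" "X = A.cls f"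
    by (metis domE)
  show "star (completion A) X \<in> dom"
    unfolding f(3) A.completion_star[OF f(1)]
    by (rule domI[OF A.cauchy_star[OF f(1)] star[OF f(2)]])
qed (use dom_closed in auto)

text \<open>\<open>dom\<close> is a C*-subalgebra. Conversely every element of it is a limit of
  embedded elements of the domain, which by \<open>gen\<close> lie in every C*-subalgebra containing
  \<open>S\<close>.\<close>

lemma carrier_cstar_generated:
  assumes "\<And>a. a \<in> S \<Longrightarrow> a \<in> embed A ` Domain \<Gamma>"
    and gen: "\<And>M a b. cstar_subalgebra (completion A) M \<Longrightarrow> S \<subseteq> M \<Longrightarrow> (a, b) \<in> \<Gamma> \<Longrightarrow> embed A a \<in> M"
  shows "carrier (cstar_generated (completion A) S) = dom"
proof -
  have "S \<subseteq> dom" using assms(1) hom_embed(1) by fastforce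
  moreover have "dom \<subseteq> M" if M: "cstar_subalgebra (completion A) M" "S \<subseteq> M" for M
  proof
    fix X assume X: "X \<in> dom"
    then obtain f g where f: "f \<in> cauchy_seqs A" "\<And>n. (f n, g n) \<in> \<Gamma>" "X = A.cls f"
      by (metis domE)
    have "\<forall>n. embed A (f n) \<in> M" using gen[OF M f(2)] by blast
    moreover have "X \<in> carrier (completion A)" using X dom_subset by blast
    moreover have "Y \<in> M" if "\<forall>n. F n \<in> M" "Y \<in> carrier (completion A)" "(\<lambda>n. A.D (F n) Y) \<longlonglongrightarrow> 0" for F Y
      using M(1) that by (simp add: cstar_subalgebra_def)
    ultimately show "X \<in> M"
      using A.embed_tendsto[OF f(1)] unfolding f(3) by simp
  qed
  ultimately show ?thesis
    using cstar_subalgebra_dom by (auto simp: cstar_generated_def)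
qed

lemma star_hom_hom:
  assumes "C = completion A\<lparr>carrier := dom\<rparr>"
  shows "star_hom C (completion B) hom"
  unfolding star_hom_def assms
proof (simp, intro conjI ballI allI)
  fix X assume X: "X \<in> dom"
  then obtain f g where f: "f \<in> cauchy_seqs A" "\<And>n. (f n, g n) \<in> \<Gamma>" "g \<in> cauchy_seqs B" "X = A.cls f"
    "hom X = B.cls g"
    by (metis domE)
  show "hom X \<in> carrier (completion B)"
    using f by (simp add: B.cls_closed)
  show "hom (star (completion A) X) = star (completion B) (hom X)"
    unfolding f(5) unfolding f(4) A.completion_star[OF f(1)] B.completion_star[OF f(3)]
    by (rule hom_cls[OF A.cauchy_star[OF f(1)] star[OF f(2)]])
  show "hom (c \<odot>\<^bsub>completion A\<^esub> X) = c \<odot>\<^bsub>completion B\<^esub> hom X" for c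
    unfolding f(5) unfolding f(4) A.completion_smult[OF f(1)] B.completion_smult[OF f(3)]
    by (rule hom_cls[OF A.cauchy_smult[OF f(1)] smult[OF f(2)]])
  fix Y assume Y: "Y \<in> dom"
  then obtain f' g' where f': "f' \<in> cauchy_seqs A" "\<And>n. (f' n, g' n) \<in> \<Gamma>" "g' \<in> cauchy_seqs B" "Y = A.cls f'"
    "hom Y = B.cls g'"
    by (metis domE)
  show "hom (X \<oplus>\<^bsub>completion A\<^esub> Y) = hom X \<oplus>\<^bsub>completion B\<^esub> hom Y"
    unfolding f(5) f'(5) unfolding f(4) f'(4) A.completion_add[OF f(1) f'(1)] B.completion_add[OF f(3) f'(3)]
    by (rule hom_cls[OF A.cauchy_add[OF f(1) f'(1)] add[OF f(2) f'(2)]])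
  show "hom (X \<otimes>\<^bsub>completion A\<^esub> Y) = hom X \<otimes>\<^bsub>completion B\<^esub> hom Y"
    unfolding f(5) f'(5) unfolding f(4) f'(4) A.completion_mult[OF f(1) f'(1)] B.completion_mult[OF f(3) f'(3)]
    by (rule hom_cls[OF A.cauchy_mult[OF f(1) f'(1)] mult[OF f(2) f'(2)]])
qed

text \<open>Successive approximation, as in the open mapping theorem.\<close>

lemma hom_surj:
  assumes C: "0 \<le> C"
    and lift: "\<And>a b. (a, b) \<in> \<Gamma> \<Longrightarrow>
      \<exists>a' b'. (a', b') \<in> \<Gamma> \<and> nrm A a' \<le> C * nrm B b \<and> B.d b b' \<le> nrm B b / 2"
    and dense: "\<And>b e. b \<in> carrier B \<Longrightarrow> 0 < e \<Longrightarrow> \<exists>(a', b') \<in> \<Gamma>. B.d b b' < e"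
  shows "hom ` dom = carrier (completion B)"
proof (rule equalityI)
  show "hom ` dom \<subseteq> carrier (completion B)"
    by (auto elim!: domE simp: B.cls_closed)
  show "carrier (completion B) \<subseteq> hom ` dom"
  proof
    fix Z assume "Z \<in> carrier (completion B)"
    then obtain g where g: "g \<in> cauchy_seqs B" "Z = B.cls g" by (rule B.completionE)
    have "\<exists>M. \<forall>m\<ge>M. \<forall>n\<ge>M. B.d (g m) (g n) < (1/2) ^ k" for k :: nat
      using g(1) unfolding cauchy_seqs_def by simp
    then obtain M where M: "\<And>k m n. M k \<le> m \<Longrightarrow> M k \<le> n \<Longrightarrow> B.d (g m) (g n) < (1/2) ^ k"
      by metis
    \<comment> \<open>Summing the thresholds makes \<open>r\<close> strictly increasing and at least
      \<open>M n\<close>, so that \<open>g\<close> moves by less than \<open>(1/2) ^ n\<close>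
      between consecutive chosen indices.\<close>
    define r where "r n = (\<Sum>k\<le>n. Suc (M k))" for n
    have r: "strict_mono r" by (rule strict_mono_Suc_iff[THEN iffD2]) (simp add: r_def)
    have Mr: "M n \<le> r n" for n
      using member_le_sum[of n "{..n}" "\<lambda>k. Suc (M k)"] by (simp add: r_def)
    have gr: "B.d (g (r n)) (g (r (Suc n))) < (1/2) ^ n" for n
      using Mr[of n] strict_monoD[OF r, of n "Suc n"] by (intro M) auto
    note gB = B.cauchy_seqs_carrier[OF g(1)]
    have "\<exists>a b. (a, b) \<in> \<Gamma> \<and> B.d (g (r n)) b < (1/2) ^ n" for n
      using dense[OF gB, of "(1/2) ^ n" "r n"] by auto
    then obtain a b where ab: "\<And>n. (a n, b n) \<in> \<Gamma>" and b: "\<And>n. B.d (g (r n)) (b n) < (1/2) ^ n"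
      by metis
    have bB: "b n \<in> carrier B" for n using carrier[OF ab] by blast
    \<comment> \<open>One unit for each leg: from \<open>b n\<close> to \<open>g\<close>, along
      \<open>g\<close>, and back to the next \<open>b\<close>.\<close>
    have bb: "B.d (b n) (b (Suc n)) \<le> 3 * (1/2) ^ n" for n
    proof -
      have "B.d (b n) (b (Suc n)) \<le> B.d (b n) (g (r n)) + B.d (g (r n)) (b (Suc n))"
        by (intro B.dist_triangle gB bB)
      moreover have "B.d (g (r n)) (b (Suc n)) \<le> B.d (g (r n)) (g (r (Suc n))) + B.d (g (r (Suc n))) (b (Suc n))"
        by (intro B.dist_triangle gB bB)
      moreover have "(1/2::real) ^ Suc n \<le> (1/2) ^ n" by simp
      ultimately show ?thesis
        using b[of n] b[of "Suc n"] gr[of n] B.dist_sym[OF gB bB, of "r n" n] by linarith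
    qed
    \<comment> \<open>The lift of the defect between \<open>b n\<close> and the current image
      \<open>y\<close> is added to \<open>x\<close>. This moves \<open>x\<close> by at most
      \<open>C\<close> times the defect and halves the defect.\<close>
    define step where "step n z z' \<longleftrightarrow>
      A.d (fst z) (fst z') \<le> C * B.d (b n) (snd z) \<and> B.d (b n) (snd z') \<le> B.d (b n) (snd z) / 2" for n z z'
    have "\<exists>z. \<forall>n. z n \<in> \<Gamma> \<and> step n (z n) (z (Suc n))"
    proof (rule dependent_nat_choice)
      show "\<exists>z. z \<in> \<Gamma>" using zero by blast
      fix z n assume z: "z \<in> \<Gamma>"
      obtain x y where xy: "z = (x, y)" by (cases z)
      note xyC = carrier[OF z[unfolded xy]]
      obtain a' b' where ab': "(a', b') \<in> \<Gamma>" "nrm A a' \<le> C * B.d (b n) y"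
        "B.d (diff B (b n) y) b' \<le> B.d (b n) y / 2"
        using lift[OF diff[OF ab[of n] z[unfolded xy]]] by blast
      note abC' = carrier[OF ab'(1)]
      have "step n z (x \<oplus>\<^bsub>A\<^esub> a', y \<oplus>\<^bsub>B\<^esub> b')"
        using A.dist_increment[of x a'] ab' abC' xyC B.dist_diff[of "b n" y b'] bB
        by (simp add: step_def xy)
      then show "\<exists>z'. z' \<in> \<Gamma> \<and> step n z z'"
        using add[OF z[unfolded xy] ab'(1)] by blast
    qed
    then obtain z where z: "\<And>n. z n \<in> \<Gamma>" "\<And>n. step n (z n) (z (Suc n))" by blast
    define x y where "x n = fst (z n)" and "y n = snd (z n)" for n
    have xy: "(x n, y n) \<in> \<Gamma>" for n using z(1) by (simp add: x_def y_def)
    note xyC = carrier[OF xy]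
    have step: "A.d (x n) (x (Suc n)) \<le> C * B.d (b n) (y n)" "B.d (b n) (y (Suc n)) \<le> B.d (b n) (y n) / 2" for n
      using z(2)[of n] by (auto simp: step_def x_def y_def)
    \<comment> \<open>Halving the defect and then letting the target drift by
      \<open>3 * (1/2) ^ n\<close> gives decay at a rate strictly between 1/2 and 1. With rate 3/4
      the induction requires \<open>3 + K/2 \<le> 3/4 * K\<close>, that is
      \<open>12 \<le> K\<close>; the other summand starts it.\<close>
    define K where "K = 12 + B.d (b 0) (y 0)"
    have e: "B.d (b n) (y n) \<le> K * (3/4) ^ n" for n
    proof (induction n)
      case (Suc n)
      have "B.d (b (Suc n)) (y (Suc n)) \<le> B.d (b (Suc n)) (b n) + B.d (b n) (y (Suc n))"
        using xyC bB by (intro B.dist_triangle) auto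
      also have "\<dots> \<le> 3 * (1/2) ^ n + K * (3/4) ^ n / 2"
        using step(2)[of n] Suc bb[of n] B.dist_sym[OF bB bB, of n "Suc n"] by linarith
      also have "(1/2) ^ n \<le> (3/4::real) ^ n" by (intro power_mono) auto
      also have "3 * (3/4) ^ n + K * (3/4) ^ n / 2 \<le> K * (3/4) ^ Suc n"
      proof -
        have "12 \<le> K" unfolding K_def using xyC[of 0] bB[of 0] by simp
        from mult_right_mono[OF this, of "(3/4) ^ n"] show ?thesis by (simp add: algebra_simps)
      qed
      finally show ?case by simp
    qed (simp add: K_def)
    have x: "x \<in> cauchy_seqs A"
    proof (rule A.cauchy_geometric[where q = "3/4" and K = "C * K"])
      show "A.d (x n) (x (Suc n)) \<le> C * K * (3/4) ^ n" for n
        using step(1)[of n] mult_left_mono[OF e C, of n] by (simp add: mult.assoc)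
    qed (use xyC in auto)
    note y = cauchy_image[OF x xy]
    have "B.cls y = B.cls (g \<circ> r)"
    proof (rule B.cls_eqI[OF y B.cauchy_subseq(1)[OF g(1) r]])
      show "(\<lambda>n. K * (3/4) ^ n + (1/2) ^ n) \<longlonglongrightarrow> 0"
        by (intro tendsto_add_zero tendsto_mult_right_zero LIMSEQ_power_zero) auto
      show "B.d (y n) ((g \<circ> r) n) \<le> K * (3/4) ^ n + (1/2) ^ n" for n
        using B.dist_triangle[of "y n" "b n" "g (r n)"] e[of n] b[of n] xyC[of n] bB[of n] gB[of "r n"]
          B.dist_sym[of "y n" "b n"] B.dist_sym[of "g (r n)" "b n"] by simp
    qed
    then have "Z = hom (A.cls x)"
      using hom_cls[OF x xy] B.cauchy_subseq(2)[OF g(1) r] g(2) by simp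
    then show "Z \<in> hom ` dom"
      using domI[OF x xy] by blast
  qed
qed

end

section \<open>Square-summable families and bounded operators\<close>

lemma ell2_support: "\<xi> \<in> ell2 X \<Longrightarrow> i \<notin> X \<Longrightarrow> \<xi> i = 0"
  by (simp add: ell2_def)

lemma ell2_summable:
  assumes "\<xi> \<in> ell2 X"
  shows "(\<lambda>i. (cmod (\<xi> i))\<^sup>2) summable_on UNIV"
proof -
  have "(\<lambda>i. (cmod (\<xi> i))\<^sup>2) summable_on UNIV \<longleftrightarrow> (\<lambda>i. (cmod (\<xi> i))\<^sup>2) summable_on X"
    by (rule summable_on_cong_neutral) (use assms in \<open>auto simp: ell2_def\<close>)
  then show ?thesis using assms by (simp add: ell2_def)
qed

lemma ell2_norm_nonneg [simp]: "0 \<le> ell2_norm \<xi>"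
  by (simp add: ell2_norm_def infsum_nonneg)

lemma ell2_norm_power2: "(ell2_norm \<xi>)\<^sup>2 = (\<Sum>\<^sub>\<infinity>i. (cmod (\<xi> i))\<^sup>2)"
  by (simp add: ell2_norm_def infsum_nonneg)

lemma sum_le_ell2_norm:
  assumes "\<xi> \<in> ell2 X" "finite F"
  shows "(\<Sum>i\<in>F. (cmod (\<xi> i))\<^sup>2) \<le> (ell2_norm \<xi>)\<^sup>2"
  unfolding ell2_norm_power2
  by (rule finite_sum_le_infsum[OF ell2_summable[OF assms(1)] assms(2)]) auto

lemma L2_set_le_ell2_norm:
  assumes "\<xi> \<in> ell2 X" "finite F"
  shows "L2_set (\<lambda>i. cmod (\<xi> i)) F \<le> ell2_norm \<xi>"
  unfolding L2_set_def by (rule real_le_lsqrt) (use sum_le_ell2_norm[OF assms] in \<open>auto intro: sum_nonneg\<close>)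

lemma ell2I:
  assumes supp: "\<And>i. i \<notin> X \<Longrightarrow> \<xi> i = 0"
    and le: "\<And>F. finite F \<Longrightarrow> (\<Sum>i\<in>F. (cmod (\<xi> i))\<^sup>2) \<le> c\<^sup>2" and c: "0 \<le> c"
  shows "\<xi> \<in> ell2 X" "ell2_norm \<xi> \<le> c"
proof -
  have sum: "(\<lambda>i. (cmod (\<xi> i))\<^sup>2) summable_on Y" for Y
    by (rule nonneg_bdd_above_summable_on) (auto intro!: bdd_aboveI2[of _ _ "c\<^sup>2"] le)
  then show "\<xi> \<in> ell2 X" using supp by (simp add: ell2_def)
  have "(\<Sum>\<^sub>\<infinity>i. (cmod (\<xi> i))\<^sup>2) \<le> c\<^sup>2"
    by (rule infsum_le_finite_sums[OF sum le])
  then show "ell2_norm \<xi> \<le> c" unfolding ell2_norm_def by (intro real_le_lsqrt c)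
qed

lemma ell2I_L2_set:
  assumes supp: "\<And>i. i \<notin> X \<Longrightarrow> \<xi> i = 0"
    and le: "\<And>F. finite F \<Longrightarrow> L2_set (\<lambda>i. cmod (\<xi> i)) F \<le> c"
  shows "\<xi> \<in> ell2 X" "ell2_norm \<xi> \<le> c"
proof -
  have c: "0 \<le> c" using le[of "{}"] by simp
  have "(\<Sum>i\<in>F. (cmod (\<xi> i))\<^sup>2) \<le> c\<^sup>2" if "finite F" for F
    using le[OF that] c unfolding L2_set_def by (simp add: real_sqrt_le_iff' sum_nonneg sqrt_le_D)
  from ell2I[OF supp this c] show "\<xi> \<in> ell2 X" "ell2_norm \<xi> \<le> c" by auto
qed

lemma
  assumes \<xi>: "\<xi> \<in> ell2 X" and \<eta>: "\<eta> \<in> ell2 X"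
  shows ell2_add: "(\<lambda>i. \<xi> i + \<eta> i) \<in> ell2 X"
    and ell2_norm_add: "ell2_norm (\<lambda>i. \<xi> i + \<eta> i) \<le> ell2_norm \<xi> + ell2_norm \<eta>"
proof -
  have "L2_set (\<lambda>i. cmod (\<xi> i + \<eta> i)) F \<le> ell2_norm \<xi> + ell2_norm \<eta>" if "finite F" for F
  proof -
    have "L2_set (\<lambda>i. cmod (\<xi> i + \<eta> i)) F \<le> L2_set (\<lambda>i. cmod (\<xi> i) + cmod (\<eta> i)) F"
      by (intro L2_set_mono norm_triangle_ineq norm_ge_zero)
    also have "\<dots> \<le> L2_set (\<lambda>i. cmod (\<xi> i)) F + L2_set (\<lambda>i. cmod (\<eta> i)) F"
      by (rule L2_set_triangle_ineq)
    also have "\<dots> \<le> ell2_norm \<xi> + ell2_norm \<eta>"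
      by (intro add_mono L2_set_le_ell2_norm[OF \<xi> that] L2_set_le_ell2_norm[OF \<eta> that])
    finally show ?thesis .
  qed
  note * = ell2I_L2_set[of X "\<lambda>i. \<xi> i + \<eta> i", OF _ this]
  show "(\<lambda>i. \<xi> i + \<eta> i) \<in> ell2 X" "ell2_norm (\<lambda>i. \<xi> i + \<eta> i) \<le> ell2_norm \<xi> + ell2_norm \<eta>"
    using \<xi> \<eta> by (auto intro!: * simp: ell2_support)
qed

lemma ell2_zero [simp]: "(\<lambda>_. 0) \<in> ell2 X"
  by (simp add: ell2_def)

lemma ell2_norm_zero [simp]: "ell2_norm (\<lambda>_. 0) = 0"
  by (simp add: ell2_norm_def)

lemma ell2_norm_scale: "ell2_norm (\<lambda>i. c * \<xi> i) = cmod c * ell2_norm \<xi>"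
  by (simp add: ell2_norm_def norm_mult power_mult_distrib infsum_cmult_right' real_sqrt_mult)

lemma ell2_scale: "\<xi> \<in> ell2 X \<Longrightarrow> (\<lambda>i. c * \<xi> i) \<in> ell2 X"
  by (auto simp: ell2_def norm_mult power_mult_distrib intro: summable_on_cmult_right)

lemma ell2_diff: "\<xi> \<in> ell2 X \<Longrightarrow> \<eta> \<in> ell2 X \<Longrightarrow> (\<lambda>i. \<xi> i - \<eta> i) \<in> ell2 X"
  using ell2_add[of \<xi> X "\<lambda>i. -1 * \<eta> i"] ell2_scale[of \<eta> X "-1"] by simp

lemma ell2_norm_eq_0:
  assumes "\<xi> \<in> ell2 X" "ell2_norm \<xi> = 0"
  shows "\<xi> i = 0"
  using sum_le_ell2_norm[OF assms(1), of "{i}"] assms(2) by simp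

lemma ell2_inner_summable:
  assumes \<xi>: "\<xi> \<in> ell2 X" and \<eta>: "\<eta> \<in> ell2 X"
  shows "(\<lambda>i. cmod (cnj (\<xi> i) * \<eta> i)) summable_on UNIV"
    and "(\<Sum>\<^sub>\<infinity>i. cmod (cnj (\<xi> i) * \<eta> i)) \<le> ell2_norm \<xi> * ell2_norm \<eta>"
proof -
  have *: "(\<Sum>i\<in>F. cmod (cnj (\<xi> i) * \<eta> i)) \<le> ell2_norm \<xi> * ell2_norm \<eta>" if "finite F" for F
  proof -
    have "(\<Sum>i\<in>F. cmod (cnj (\<xi> i) * \<eta> i)) \<le> L2_set (\<lambda>i. cmod (\<xi> i)) F * L2_set (\<lambda>i. cmod (\<eta> i)) F"
      using L2_set_mult_ineq[of "\<lambda>i. cmod (\<xi> i)" "\<lambda>i. cmod (\<eta> i)" F] by (simp add: norm_mult)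
    also have "\<dots> \<le> ell2_norm \<xi> * ell2_norm \<eta>"
      by (intro mult_mono L2_set_le_ell2_norm[OF \<xi> that] L2_set_le_ell2_norm[OF \<eta> that]) auto
    finally show ?thesis .
  qed
  then show sum: "(\<lambda>i. cmod (cnj (\<xi> i) * \<eta> i)) summable_on UNIV"
    by (intro nonneg_bdd_above_summable_on) (auto intro!: bdd_aboveI2)
  show "(\<Sum>\<^sub>\<infinity>i. cmod (cnj (\<xi> i) * \<eta> i)) \<le> ell2_norm \<xi> * ell2_norm \<eta>"
    by (rule infsum_le_finite_sums[OF sum *])
qed

lemma ell2_inner_summable':
  "\<xi> \<in> ell2 X \<Longrightarrow> \<eta> \<in> ell2 X \<Longrightarrow> (\<lambda>i. cnj (\<xi> i) * \<eta> i) summable_on UNIV"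
  by (rule abs_summable_summable[OF ell2_inner_summable(1)])

lemma Cauchy_Schwarz_ell2:
  assumes "\<xi> \<in> ell2 X" "\<eta> \<in> ell2 X"
  shows "cmod (ell2_inner \<xi> \<eta>) \<le> ell2_norm \<xi> * ell2_norm \<eta>"
  unfolding ell2_inner_def
  using norm_infsum_bound[OF ell2_inner_summable(1)[OF assms]] ell2_inner_summable(2)[OF assms] by linarith

lemma ell2_inner_self:
  assumes "\<xi> \<in> ell2 X"
  shows "ell2_inner \<xi> \<xi> = of_real ((ell2_norm \<xi>)\<^sup>2)"
proof -
  have "ell2_inner \<xi> \<xi> = (\<Sum>\<^sub>\<infinity>i. of_real ((cmod (\<xi> i))\<^sup>2))"
    unfolding ell2_inner_def by (intro infsum_cong) (metis complex_norm_square mult.commute)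
  also have "\<dots> = of_real (\<Sum>\<^sub>\<infinity>i. (cmod (\<xi> i))\<^sup>2)"
    by (intro infsumI has_sum_of_real_iff[THEN iffD2] has_sum_infsum ell2_summable[OF assms])
  finally show ?thesis by (simp add: ell2_norm_power2)
qed

lemma ell2_inner_commute: "ell2_inner \<eta> \<xi> = cnj (ell2_inner \<xi> \<eta>)"
  by (simp add: ell2_inner_def mult.commute flip: infsum_cnj)

lemma ell2_inner_add_right:
  "\<xi> \<in> ell2 X \<Longrightarrow> \<eta> \<in> ell2 X \<Longrightarrow> \<eta>' \<in> ell2 X \<Longrightarrow>
     ell2_inner \<xi> (\<lambda>i. \<eta> i + \<eta>' i) = ell2_inner \<xi> \<eta> + ell2_inner \<xi> \<eta>'"
  unfolding ell2_inner_def by (subst infsum_add[symmetric]) (auto intro: ell2_inner_summable' simp: distrib_left distrib_right)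

lemma ell2_inner_scale_right: "ell2_inner \<xi> (\<lambda>i. c * \<eta> i) = c * ell2_inner \<xi> \<eta>"
  by (simp add: ell2_inner_def infsum_cmult_right' mult.left_commute)

lemma ell2_inner_add_left:
  "\<xi> \<in> ell2 X \<Longrightarrow> \<eta> \<in> ell2 X \<Longrightarrow> \<xi>' \<in> ell2 X \<Longrightarrow>
     ell2_inner (\<lambda>i. \<xi> i + \<xi>' i) \<eta> = ell2_inner \<xi> \<eta> + ell2_inner \<xi>' \<eta>"
  unfolding ell2_inner_def by (subst infsum_add[symmetric]) (auto intro: ell2_inner_summable' simp: distrib_left distrib_right)

lemma ell2_inner_scale_left: "ell2_inner (\<lambda>i. c * \<xi> i) \<eta> = cnj c * ell2_inner \<xi> \<eta>"
  by (simp add: ell2_inner_def infsum_cmult_right' mult.assoc)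

lemma ell2_inner_zero_left [simp]: "ell2_inner (\<lambda>_. 0) \<eta> = 0"
  by (simp add: ell2_inner_def)

lemma ell2_inner_zero_right [simp]: "ell2_inner \<eta> (\<lambda>_. 0) = 0"
  by (simp add: ell2_inner_def)

definition delta :: "'i \<Rightarrow> 'i \<Rightarrow> complex" where
  "delta i = (\<lambda>j. if j = i then 1 else 0)"

lemma ell2_delta: "i \<in> X \<Longrightarrow> delta i \<in> ell2 X"
  unfolding ell2_def delta_def mem_Collect_eq
proof (intro conjI allI impI)
  have "(\<lambda>j. (cmod (if j = i then 1 else 0))\<^sup>2) summable_on {i}" by (rule summable_on_finite) simp
  then show "(\<lambda>j. (cmod (if j = i then 1 else 0))\<^sup>2) summable_on X" if "i \<in> X"
    using that by (subst summable_on_cong_neutral[where T = "{i}"]) auto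
qed auto

lemma ell2_inner_delta: "ell2_inner (delta i) \<xi> = \<xi> i"
proof -
  have "ell2_inner (delta i) \<xi> = (\<Sum>\<^sub>\<infinity>j\<in>{i}. \<xi> j)"
    unfolding ell2_inner_def delta_def by (rule infsum_cong_neutral) auto
  then show ?thesis by simp
qed

lemma ell2_eqI:
  assumes "\<xi> \<in> ell2 X" "\<eta> \<in> ell2 X" "\<And>\<zeta>. \<zeta> \<in> ell2 X \<Longrightarrow> ell2_inner \<zeta> \<xi> = ell2_inner \<zeta> \<eta>"
  shows "\<xi> = \<eta>"
proof
  fix i
  show "\<xi> i = \<eta> i"
    using assms(3)[OF ell2_delta, of i] assms(1,2)
    by (cases "i \<in> X") (auto simp: ell2_inner_delta ell2_support)
qed

context
  fixes X :: "'i set" and T :: "('i \<Rightarrow> complex) \<Rightarrow> 'i \<Rightarrow> complex"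
  assumes T: "bounded_op X T"
begin

lemma bounded_op_closed: "\<xi> \<in> ell2 X \<Longrightarrow> T \<xi> \<in> ell2 X"
  and bounded_op_add: "\<xi> \<in> ell2 X \<Longrightarrow> \<eta> \<in> ell2 X \<Longrightarrow> T (\<lambda>i. \<xi> i + \<eta> i) = (\<lambda>i. T \<xi> i + T \<eta> i)"
  and bounded_op_scale: "\<xi> \<in> ell2 X \<Longrightarrow> T (\<lambda>i. c * \<xi> i) = (\<lambda>i. c * T \<xi> i)"
  using T by (auto simp: bounded_op_def)

lemma bounded_op_zero: "T (\<lambda>_. 0) = (\<lambda>_. 0)"
  using bounded_op_scale[OF ell2_zero, of 0] by simp

lemma bounded_op_diff: "\<xi> \<in> ell2 X \<Longrightarrow> \<eta> \<in> ell2 X \<Longrightarrow> T (\<lambda>i. \<xi> i - \<eta> i) = (\<lambda>i. T \<xi> i - T \<eta> i)"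
  using bounded_op_add[of \<xi> "\<lambda>i. -1 * \<eta> i"] bounded_op_scale[of \<eta> "-1"] ell2_scale[of \<eta> X "-1"] by simp

lemma op_norm_bdd: "bdd_above ((\<lambda>\<xi>. ell2_norm (T \<xi>)) ` {\<xi> \<in> ell2 X. ell2_norm \<xi> \<le> 1})"
proof -
  obtain C where C: "\<And>\<xi>. \<xi> \<in> ell2 X \<Longrightarrow> ell2_norm (T \<xi>) \<le> C * ell2_norm \<xi>"
    using T unfolding bounded_op_def by blast
  have "ell2_norm (T \<xi>) \<le> \<bar>C\<bar>" if \<xi>: "\<xi> \<in> ell2 X" "ell2_norm \<xi> \<le> 1" for \<xi>
  proof -
    have "C * ell2_norm \<xi> \<le> \<bar>C\<bar> * 1"
      using \<xi>(2) by (intro mult_mono) auto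
    then show ?thesis using C[OF \<xi>(1)] by simp
  qed
  then show ?thesis by (auto intro!: bdd_aboveI2)
qed

lemma op_norm_nonneg: "0 \<le> op_norm X T"
  unfolding op_norm_def by (rule cSUP_upper2[OF op_norm_bdd, of "\<lambda>_. 0"]) auto

lemma op_norm_bound:
  assumes \<xi>: "\<xi> \<in> ell2 X"
  shows "ell2_norm (T \<xi>) \<le> op_norm X T * ell2_norm \<xi>"
proof (cases "ell2_norm \<xi> = 0")
  case True
  then have "\<xi> = (\<lambda>_. 0)" using ell2_norm_eq_0[OF \<xi>] by blast
  then show ?thesis by (simp add: bounded_op_zero)
next
  case False
  define c where "c = complex_of_real (inverse (ell2_norm \<xi>))"
  have "ell2_norm (\<lambda>i. c * \<xi> i) = 1"
    using False by (simp add: ell2_norm_scale c_def norm_inverse)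
  then have "ell2_norm (T (\<lambda>i. c * \<xi> i)) \<le> op_norm X T"
    unfolding op_norm_def using ell2_scale[OF \<xi>] by (intro cSUP_upper op_norm_bdd) auto
  then have "cmod c * ell2_norm (T \<xi>) \<le> op_norm X T"
    by (simp add: bounded_op_scale[OF \<xi>] ell2_norm_scale)
  moreover have "0 < ell2_norm \<xi>" using False ell2_norm_nonneg[of \<xi>] by linarith
  ultimately show ?thesis by (simp add: c_def norm_inverse norm_divide field_simps)
qed

end

lemma op_norm_leI:
  assumes "0 \<le> C" "\<And>\<xi>. \<xi> \<in> ell2 X \<Longrightarrow> ell2_norm (T \<xi>) \<le> C * ell2_norm \<xi>"
  shows "op_norm X T \<le> C"
  unfolding op_norm_def
proof (rule cSUP_least)
  show "{\<xi> \<in> ell2 X. ell2_norm \<xi> \<le> 1} \<noteq> {}" using ell2_zero[of X] by fastforce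
  fix \<xi> assume "\<xi> \<in> {\<xi> \<in> ell2 X. ell2_norm \<xi> \<le> 1}"
  then show "ell2_norm (T \<xi>) \<le> C"
    using assms(2)[of \<xi>] mult_left_le[OF _ assms(1), of "ell2_norm \<xi>"] by simp
qed

lemma bounded_opI:
  assumes "\<And>\<xi>. \<xi> \<in> ell2 X \<Longrightarrow> T \<xi> \<in> ell2 X"
    and "\<And>\<xi> \<eta>. \<xi> \<in> ell2 X \<Longrightarrow> \<eta> \<in> ell2 X \<Longrightarrow> T (\<lambda>i. \<xi> i + \<eta> i) = (\<lambda>i. T \<xi> i + T \<eta> i)"
    and "\<And>c \<xi>. \<xi> \<in> ell2 X \<Longrightarrow> T (\<lambda>i. c * \<xi> i) = (\<lambda>i. c * T \<xi> i)"
    and "\<And>\<xi>. \<xi> \<in> ell2 X \<Longrightarrow> ell2_norm (T \<xi>) \<le> C * ell2_norm \<xi>"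
  shows "bounded_op X T"
  using assms unfolding bounded_op_def by blast

lemma bounded_op_comp:
  assumes S: "bounded_op X S" and T: "bounded_op X T"
  shows "bounded_op X (\<lambda>\<xi>. S (T \<xi>))"
proof (rule bounded_opI)
  fix \<xi> assume \<xi>: "\<xi> \<in> ell2 X"
  have "ell2_norm (S (T \<xi>)) \<le> op_norm X S * ell2_norm (T \<xi>)"
    by (rule op_norm_bound[OF S bounded_op_closed[OF T \<xi>]])
  also have "\<dots> \<le> op_norm X S * (op_norm X T * ell2_norm \<xi>)"
    by (rule mult_left_mono[OF op_norm_bound[OF T \<xi>] op_norm_nonneg[OF S]])
  finally show "ell2_norm (S (T \<xi>)) \<le> op_norm X S * op_norm X T * ell2_norm \<xi>" by simp
qed (simp_all add: bounded_op_closed[OF S] bounded_op_closed[OF T] bounded_op_add[OF S] bounded_op_add[OF T]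
    bounded_op_scale[OF S] bounded_op_scale[OF T])

lemma bounded_op_null: "bounded_op X (\<lambda>_ _. 0)"
  by (rule bounded_opI[where C = 0]) simp_all

lemma bounded_op_plus:
  assumes S: "bounded_op X S" and T: "bounded_op X T"
  shows "bounded_op X (\<lambda>\<xi> i. S \<xi> i + T \<xi> i)"
proof (rule bounded_opI)
  fix \<xi> assume \<xi>: "\<xi> \<in> ell2 X"
  have "ell2_norm (\<lambda>i. S \<xi> i + T \<xi> i) \<le> ell2_norm (S \<xi>) + ell2_norm (T \<xi>)"
    by (rule ell2_norm_add[OF bounded_op_closed[OF S \<xi>] bounded_op_closed[OF T \<xi>]])
  also have "\<dots> \<le> op_norm X S * ell2_norm \<xi> + op_norm X T * ell2_norm \<xi>"
    by (rule add_mono[OF op_norm_bound[OF S \<xi>] op_norm_bound[OF T \<xi>]])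
  finally show "ell2_norm (\<lambda>i. S \<xi> i + T \<xi> i) \<le> (op_norm X S + op_norm X T) * ell2_norm \<xi>"
    by (simp add: algebra_simps)
qed (auto simp: bounded_op_add[OF S] bounded_op_add[OF T] bounded_op_scale[OF S] bounded_op_scale[OF T]
    algebra_simps intro!: ell2_add bounded_op_closed[OF S] bounded_op_closed[OF T])

lemma bounded_op_times:
  assumes S: "bounded_op X S"
  shows "bounded_op X (\<lambda>\<xi> i. c * S \<xi> i)"
proof (rule bounded_opI)
  fix \<xi> assume "\<xi> \<in> ell2 X"
  then show "ell2_norm (\<lambda>i. c * S \<xi> i) \<le> (cmod c * op_norm X S) * ell2_norm \<xi>"
    using mult_left_mono[OF op_norm_bound[OF S], of \<xi> "cmod c"] by (simp add: ell2_norm_scale)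
qed (auto simp: bounded_op_add[OF S] bounded_op_scale[OF S] algebra_simps intro!: ell2_scale bounded_op_closed[OF S])

section \<open>Adjoint pairs and the C*-identity for operators\<close>

definition adjoints :: "'i set \<Rightarrow> (('i \<Rightarrow> complex) \<Rightarrow> ('i \<Rightarrow> complex)) \<Rightarrow> (('i \<Rightarrow> complex) \<Rightarrow> ('i \<Rightarrow> complex)) \<Rightarrow> bool" where
  "adjoints X T T' \<longleftrightarrow> bounded_op X T \<and> bounded_op X T' \<and>
     (\<forall>\<xi>\<in>ell2 X. \<forall>\<eta>\<in>ell2 X. ell2_inner (T' \<xi>) \<eta> = ell2_inner \<xi> (T \<eta>))"

lemma adjoints_sym: "adjoints X T T' \<Longrightarrow> adjoints X T' T"
  unfolding adjoints_def by (metis ell2_inner_commute)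

lemma adjointsD:
  assumes "adjoints X T T'"
  shows "bounded_op X T" "bounded_op X T'"
    "\<xi> \<in> ell2 X \<Longrightarrow> \<eta> \<in> ell2 X \<Longrightarrow> ell2_inner (T' \<xi>) \<eta> = ell2_inner \<xi> (T \<eta>)"
  using assms unfolding adjoints_def by blast+

lemma adjointsI:
  assumes "bounded_op X T" "bounded_op X T'"
    "\<And>\<xi> \<eta>. \<xi> \<in> ell2 X \<Longrightarrow> \<eta> \<in> ell2 X \<Longrightarrow> ell2_inner (T' \<xi>) \<eta> = ell2_inner \<xi> (T \<eta>)"
  shows "adjoints X T T'"
  using assms unfolding adjoints_def by blast

lemma adjoints_comp:
  assumes S: "adjoints X S S'" and T: "adjoints X T T'"
  shows "adjoints X (\<lambda>\<xi>. S (T \<xi>)) (\<lambda>\<xi>. T' (S' \<xi>))"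
proof (rule adjointsI[OF bounded_op_comp[OF adjointsD(1)[OF S] adjointsD(1)[OF T]]
      bounded_op_comp[OF adjointsD(2)[OF T] adjointsD(2)[OF S]]])
  fix \<xi> \<eta> assume *: "\<xi> \<in> ell2 X" "\<eta> \<in> ell2 X"
  show "ell2_inner (T' (S' \<xi>)) \<eta> = ell2_inner \<xi> (S (T \<eta>))"
    using adjointsD(3)[OF T bounded_op_closed[OF adjointsD(2)[OF S] *(1)] *(2)]
      adjointsD(3)[OF S *(1) bounded_op_closed[OF adjointsD(1)[OF T] *(2)]] by simp
qed

text \<open>The squared norm of \<open>T' \<xi>\<close> is the inner product of \<open>\<xi>\<close>
  with \<open>T (T' \<xi>)\<close>. Apply Cauchy-Schwarz and cancel one factor. With
  \<open>adjoints_sym\<close> this yields equality of the two norms.\<close>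

lemma op_norm_adjoints_le:
  assumes "adjoints X T T'"
  shows "op_norm X T' \<le> op_norm X T"
proof (rule op_norm_leI)
  have T: "bounded_op X T" "bounded_op X T'" using assms by (auto simp: adjoints_def)
  show "0 \<le> op_norm X T" by (rule op_norm_nonneg[OF T(1)])
  fix \<xi> assume \<xi>: "\<xi> \<in> ell2 X"
  have "complex_of_real ((ell2_norm (T' \<xi>))\<^sup>2) = ell2_inner \<xi> (T (T' \<xi>))"
    using adjointsD(3)[OF assms \<xi> bounded_op_closed[OF T(2) \<xi>]] ell2_inner_self[OF bounded_op_closed[OF T(2) \<xi>]] by simp
  then have "(ell2_norm (T' \<xi>))\<^sup>2 = cmod (ell2_inner \<xi> (T (T' \<xi>)))"
    by (metis norm_of_real abs_of_nonneg zero_le_power2)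
  also have "\<dots> \<le> ell2_norm \<xi> * ell2_norm (T (T' \<xi>))"
    by (rule Cauchy_Schwarz_ell2[OF \<xi> bounded_op_closed[OF T(1) bounded_op_closed[OF T(2) \<xi>]]])
  also have "\<dots> \<le> ell2_norm \<xi> * (op_norm X T * ell2_norm (T' \<xi>))"
    by (rule mult_left_mono[OF op_norm_bound[OF T(1) bounded_op_closed[OF T(2) \<xi>]]]) simp
  finally have "ell2_norm (T' \<xi>) * ell2_norm (T' \<xi>) \<le> ell2_norm (T' \<xi>) * (op_norm X T * ell2_norm \<xi>)"
    by (simp add: power2_eq_square mult_ac)
  then show "ell2_norm (T' \<xi>) \<le> op_norm X T * ell2_norm \<xi>"
    using op_norm_nonneg[OF T(1)] ell2_norm_nonneg[of "T' \<xi>"]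
    by (cases "ell2_norm (T' \<xi>) = 0") (auto simp: mult_le_cancel_left)
qed

text \<open>For the lower bound, the squared norm of \<open>T \<xi>\<close> equals the inner product
  of \<open>T' (T \<xi>)\<close> with \<open>\<xi>\<close>, which Cauchy-Schwarz bounds by the norm
  of the composite.\<close>

lemma op_norm_cstar:
  assumes "adjoints X T T'"
  shows "op_norm X (\<lambda>\<xi>. T' (T \<xi>)) = (op_norm X T)\<^sup>2"
proof (rule antisym)
  have T: "bounded_op X T" "bounded_op X T'" using assms by (auto simp: adjoints_def)
  show "op_norm X (\<lambda>\<xi>. T' (T \<xi>)) \<le> (op_norm X T)\<^sup>2"
  proof (rule op_norm_leI)
    fix \<xi> assume \<xi>: "\<xi> \<in> ell2 X"
    have "ell2_norm (T' (T \<xi>)) \<le> op_norm X T' * ell2_norm (T \<xi>)"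
      by (rule op_norm_bound[OF T(2) bounded_op_closed[OF T(1) \<xi>]])
    also have "\<dots> \<le> op_norm X T * (op_norm X T * ell2_norm \<xi>)"
      by (intro mult_mono op_norm_bound[OF T(1) \<xi>] op_norm_adjoints_le[OF assms] op_norm_nonneg[OF T(1)]) auto
    finally show "ell2_norm (T' (T \<xi>)) \<le> (op_norm X T)\<^sup>2 * ell2_norm \<xi>" by (simp add: power2_eq_square mult_ac)
  qed simp
  have TT: "bounded_op X (\<lambda>\<xi>. T' (T \<xi>))" by (rule bounded_op_comp[OF T(2,1)])
  have "op_norm X T \<le> sqrt (op_norm X (\<lambda>\<xi>. T' (T \<xi>)))"
  proof (rule op_norm_leI)
    fix \<xi> assume \<xi>: "\<xi> \<in> ell2 X"
    have "complex_of_real ((ell2_norm (T \<xi>))\<^sup>2) = ell2_inner (T' (T \<xi>)) \<xi>"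
      using adjointsD(3)[OF assms bounded_op_closed[OF T(1) \<xi>] \<xi>] ell2_inner_self[OF bounded_op_closed[OF T(1) \<xi>]] by simp
    then have "(ell2_norm (T \<xi>))\<^sup>2 = cmod (ell2_inner (T' (T \<xi>)) \<xi>)"
      by (metis norm_of_real abs_of_nonneg zero_le_power2)
    also have "\<dots> \<le> ell2_norm (T' (T \<xi>)) * ell2_norm \<xi>"
      by (rule Cauchy_Schwarz_ell2[OF bounded_op_closed[OF TT \<xi>] \<xi>])
    also have "\<dots> \<le> (op_norm X (\<lambda>\<xi>. T' (T \<xi>)) * ell2_norm \<xi>) * ell2_norm \<xi>"
      by (rule mult_right_mono[OF op_norm_bound[OF TT \<xi>]]) simp
    finally have "ell2_norm (T \<xi>) \<le> sqrt (op_norm X (\<lambda>\<xi>. T' (T \<xi>)) * (ell2_norm \<xi>)\<^sup>2)"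
      by (intro real_le_rsqrt) (simp add: power2_eq_square)
    then show "ell2_norm (T \<xi>) \<le> sqrt (op_norm X (\<lambda>\<xi>. T' (T \<xi>))) * ell2_norm \<xi>"
      by (simp add: real_sqrt_mult)
  qed (simp add: op_norm_nonneg[OF TT])
  then show "(op_norm X T)\<^sup>2 \<le> op_norm X (\<lambda>\<xi>. T' (T \<xi>))"
    by (rule square_le_of_le_sqrt[OF op_norm_nonneg[OF T(1)]])
qed

lemma op_norm_cong: "(\<And>\<xi>. \<xi> \<in> ell2 X \<Longrightarrow> S \<xi> = T \<xi>) \<Longrightarrow> op_norm X S = op_norm X T"
  unfolding op_norm_def by (rule SUP_cong) auto

lemma op_norm_plus_le:
  assumes S: "bounded_op X S" and T: "bounded_op X T"
  shows "op_norm X (\<lambda>\<xi> i. S \<xi> i + T \<xi> i) \<le> op_norm X S + op_norm X T"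
proof (rule op_norm_leI)
  show "0 \<le> op_norm X S + op_norm X T" using op_norm_nonneg[OF S] op_norm_nonneg[OF T] by simp
  fix \<xi> assume \<xi>: "\<xi> \<in> ell2 X"
  show "ell2_norm (\<lambda>i. S \<xi> i + T \<xi> i) \<le> (op_norm X S + op_norm X T) * ell2_norm \<xi>"
    using ell2_norm_add[OF bounded_op_closed[OF S \<xi>] bounded_op_closed[OF T \<xi>]]
      op_norm_bound[OF S \<xi>] op_norm_bound[OF T \<xi>] by (simp add: distrib_right)
qed

lemma op_norm_comp_le:
  assumes S: "bounded_op X S" and T: "bounded_op X T"
  shows "op_norm X (\<lambda>\<xi>. S (T \<xi>)) \<le> op_norm X S * op_norm X T"
proof (rule op_norm_leI)
  show "0 \<le> op_norm X S * op_norm X T" using op_norm_nonneg[OF S] op_norm_nonneg[OF T] by simp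
  fix \<xi> assume \<xi>: "\<xi> \<in> ell2 X"
  show "ell2_norm (S (T \<xi>)) \<le> (op_norm X S * op_norm X T) * ell2_norm \<xi>"
    using op_norm_bound[OF S bounded_op_closed[OF T \<xi>]]
      mult_left_mono[OF op_norm_bound[OF T \<xi>] op_norm_nonneg[OF S]] by (simp add: mult.assoc)
qed

lemma op_norm_times:
  assumes S: "bounded_op X S"
  shows "op_norm X (\<lambda>\<xi> i. c * S \<xi> i) = cmod c * op_norm X S"
proof (rule antisym)
  show le: "op_norm X (\<lambda>\<xi> i. c * S \<xi> i) \<le> cmod c * op_norm X S"
    by (rule op_norm_leI)
       (use op_norm_nonneg[OF S] op_norm_bound[OF S] in \<open>auto simp: ell2_norm_scale mult.assoc intro: mult_left_mono\<close>)
  show "cmod c * op_norm X S \<le> op_norm X (\<lambda>\<xi> i. c * S \<xi> i)"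
  proof (cases "c = 0")
    case False
    have cS: "bounded_op X (\<lambda>\<xi> i. c * S \<xi> i)" by (rule bounded_op_times[OF S])
    have "op_norm X S \<le> inverse (cmod c) * op_norm X (\<lambda>\<xi> i. c * S \<xi> i)"
    proof (rule op_norm_leI)
      fix \<xi> assume \<xi>: "\<xi> \<in> ell2 X"
      show "ell2_norm (S \<xi>) \<le> inverse (cmod c) * op_norm X (\<lambda>\<xi> i. c * S \<xi> i) * ell2_norm \<xi>"
        using op_norm_bound[OF cS \<xi>] False by (simp add: ell2_norm_scale field_simps)
    qed (simp add: op_norm_nonneg[OF cS])
    then show ?thesis using False by (simp add: field_simps)
  qed (simp add: op_norm_nonneg[OF bounded_op_null])
qed

lemma op_norm_null: "op_norm X (\<lambda>_ _. 0) = 0"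
  using op_norm_times[OF bounded_op_null, of X 0] by simp

section \<open>Representations\<close>

locale star_representation =
  fixes A :: "('a, 'm) star_algebra_scheme" and X :: "'i set"
    and \<rho> :: "'a \<Rightarrow> ('i \<Rightarrow> complex) \<Rightarrow> ('i \<Rightarrow> complex)"
  assumes rep: "representation A X \<rho>"
begin

lemma bounded: "a \<in> carrier A \<Longrightarrow> bounded_op X (\<rho> a)"
  and add: "a \<in> carrier A \<Longrightarrow> b \<in> carrier A \<Longrightarrow> \<xi> \<in> ell2 X \<Longrightarrow> \<rho> (a \<oplus>\<^bsub>A\<^esub> b) \<xi> = (\<lambda>i. \<rho> a \<xi> i + \<rho> b \<xi> i)"
  and smult: "a \<in> carrier A \<Longrightarrow> \<xi> \<in> ell2 X \<Longrightarrow> \<rho> (c \<odot>\<^bsub>A\<^esub> a) \<xi> = (\<lambda>i. c * \<rho> a \<xi> i)"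
  and mult: "a \<in> carrier A \<Longrightarrow> b \<in> carrier A \<Longrightarrow> \<xi> \<in> ell2 X \<Longrightarrow> \<rho> (a \<otimes>\<^bsub>A\<^esub> b) \<xi> = \<rho> a (\<rho> b \<xi>)"
  and inner: "a \<in> carrier A \<Longrightarrow> \<xi> \<in> ell2 X \<Longrightarrow> \<eta> \<in> ell2 X \<Longrightarrow>
    ell2_inner (\<rho> (star A a) \<xi>) \<eta> = ell2_inner \<xi> (\<rho> a \<eta>)"
  using rep unfolding representation_def by blast+

lemma closed: "a \<in> carrier A \<Longrightarrow> \<xi> \<in> ell2 X \<Longrightarrow> \<rho> a \<xi> \<in> ell2 X"
  by (rule bounded_op_closed[OF bounded])

lemma adjoints: "a \<in> carrier A \<Longrightarrow> star A a \<in> carrier A \<Longrightarrow> adjoints X (\<rho> a) (\<rho> (star A a))"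
  by (rule adjointsI[OF bounded bounded inner])

lemma diff: "a \<in> carrier A \<Longrightarrow> b \<in> carrier A \<Longrightarrow> (-1) \<odot>\<^bsub>A\<^esub> b \<in> carrier A \<Longrightarrow> \<xi> \<in> ell2 X \<Longrightarrow>
    \<rho> (diff A a b) \<xi> = (\<lambda>i. \<rho> a \<xi> i - \<rho> b \<xi> i)"
  by (simp add: diff_def add smult)

lemma op_norm_add: 
  assumes a: "a \<in> carrier A" and b: "b \<in> carrier A"
  shows "op_norm X (\<rho> (a \<oplus>\<^bsub>A\<^esub> b)) \<le> op_norm X (\<rho> a) + op_norm X (\<rho> b)"
  using op_norm_plus_le[OF bounded[OF a] bounded[OF b]] op_norm_cong[of X "\<rho> (a \<oplus>\<^bsub>A\<^esub> b)", OF add[OF a b]]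
  by simp

lemma op_norm_smult:
  assumes a: "a \<in> carrier A"
  shows "op_norm X (\<rho> (c \<odot>\<^bsub>A\<^esub> a)) = cmod c * op_norm X (\<rho> a)"
  using op_norm_times[OF bounded[OF a]] op_norm_cong[of X "\<rho> (c \<odot>\<^bsub>A\<^esub> a)", OF smult[OF a]] by simp

lemma op_norm_mult:
  assumes a: "a \<in> carrier A" and b: "b \<in> carrier A"
  shows "op_norm X (\<rho> (a \<otimes>\<^bsub>A\<^esub> b)) \<le> op_norm X (\<rho> a) * op_norm X (\<rho> b)"
  using op_norm_comp_le[OF bounded[OF a] bounded[OF b]] op_norm_cong[of X "\<rho> (a \<otimes>\<^bsub>A\<^esub> b)", OF mult[OF a b]]
  by simp

lemma op_norm_star_mult:
  assumes a: "a \<in> carrier A" "star A a \<in> carrier A"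
  shows "op_norm X (\<rho> (star A a \<otimes>\<^bsub>A\<^esub> a)) = (op_norm X (\<rho> a))\<^sup>2"
  using op_norm_cstar[OF adjoints[OF a]] op_norm_cong[of X "\<rho> (star A a \<otimes>\<^bsub>A\<^esub> a)", OF mult[OF a(2,1)]]
  by simp

end

lemma free_star_algebra_simps [simp]:
  "carrier (free_star_algebra R) = UNIV" "monoid.mult (free_star_algebra R) = (*)"
  "one (free_star_algebra R) = 1" "zero (free_star_algebra R) = 0" "add (free_star_algebra R) = (+)"
  "smult (free_star_algebra R) = free_scale" "star (free_star_algebra R) = free_adj"
  "nrm (free_star_algebra R) = universal_seminorm R"
  by (simp_all add: free_star_algebra_def)

lemma diff_free_star_algebra [simp]: "diff (free_star_algebra R) x y = x - y"
  by (simp add: diff_def free_scale_simps)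

lemma cstar_seminorm_representation:
  assumes "representation (free_star_algebra R) X \<rho>"
  shows "cstar_seminorm (\<lambda>x. op_norm X (\<rho> x))"
proof -
  interpret star_representation "free_star_algebra R" X \<rho> by unfold_locales (rule assms)
  show ?thesis unfolding cstar_seminorm_def
    using op_norm_add op_norm_smult op_norm_mult op_norm_star_mult by simp
qed

lemma seminormed_free_star_algebra:
  assumes R: "bounding_rels R"
  shows "seminormed_star_algebra (free_star_algebra R)"
proof -
  note p = cstar_seminorm_universal[OF R]
  let ?p = "universal_seminorm R"
  show ?thesis
  proof (unfold_locales; simp)
    fix x y z x' y' :: "'a free_star" and c
    show "?p 0 = 0" by (rule cstar_seminorm_zero[OF p])
    show "?p (x - y) = ?p (y - x)" by (rule cstar_seminorm_minus_commute[OF p])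
    show "?p (x - z) \<le> ?p (x - y) + ?p (y - z)" by (rule cstar_seminorm_triangle[OF p])
    show "?p (x + y - (x' + y')) \<le> ?p (x - x') + ?p (y - y')"
      using cstar_seminorm_add[OF p, of "x - x'" "y - y'"] by (simp add: algebra_simps)
    show "?p (free_scale c x - free_scale c y) \<le> cmod c * ?p (x - y)"
      using cstar_seminorm_scale[OF p, of c "x - y"] by (simp add: free_scale_simps)
    show "?p (x * y - x' * y') \<le> ?p x * ?p (y - y') + ?p (x - x') * ?p y'"
      using cstar_seminorm_add[OF p, of "x * (y - y')" "(x - x') * y'"]
        cstar_seminorm_mult[OF p, of x "y - y'"] cstar_seminorm_mult[OF p, of "x - x'" y']
      by (simp add: algebra_simps)
    show "?p (free_adj x - free_adj y) \<le> ?p (x - y)"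
      using cstar_seminorm_adj[OF p, of "x - y"] by (simp add: free_adj_simps)
    show "?p (x - (y + z)) = ?p (x - y - z)" by (simp add: algebra_simps)
  qed
qed

text \<open>\<open>le\<close> and \<open>least\<close> say that the norm is the least upper bound of
  the operator norms. Each axiom thus becomes a statement about operators, where linearity is exact
  even if it fails in \<open>A\<close>. The zero is treated by a hypothesis because
  \<open>representation\<close> does not mention it.\<close>

lemma seminormed_star_algebra_reps:
  fixes A :: "('a, 'm) star_algebra_scheme" and \<R> :: "('i set \<times> ('a \<Rightarrow> ('i \<Rightarrow> complex) \<Rightarrow> ('i \<Rightarrow> complex))) set"
  assumes "star_carrier A"
    and rep: "\<And>X \<rho>. (X, \<rho>) \<in> \<R> \<Longrightarrow> representation A X \<rho>"
    and zero: "\<And>X \<rho> \<xi>. (X, \<rho>) \<in> \<R> \<Longrightarrow> \<xi> \<in> ell2 X \<Longrightarrow> \<rho> (zero A) \<xi> = (\<lambda>_. 0)"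
    and le: "\<And>X \<rho> a. (X, \<rho>) \<in> \<R> \<Longrightarrow> a \<in> carrier A \<Longrightarrow> op_norm X (\<rho> a) \<le> nrm A a"
    and least: "\<And>a c. a \<in> carrier A \<Longrightarrow> (\<And>X \<rho>. (X, \<rho>) \<in> \<R> \<Longrightarrow> op_norm X (\<rho> a) \<le> c) \<Longrightarrow> nrm A a \<le> c"
    and nonempty: "\<R> \<noteq> {}"
  shows "seminormed_star_algebra A"
proof -
  interpret star_carrier A by fact
  note least' = least[of "diff A _ _"]
  have d [simp]: "diff A x y \<in> carrier A" if "x \<in> carrier A" "y \<in> carrier A" for x y
    using that by (simp add: diff_def)
  have nonneg: "0 \<le> nrm A a" if "a \<in> carrier A" for a
  proof -
    obtain X \<rho> where X: "(X, \<rho>) \<in> \<R>" using nonempty by auto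
    then interpret star_representation A X \<rho> by unfold_locales (rule rep)
    show ?thesis using le[OF X that] op_norm_nonneg[OF bounded[OF that]] by linarith
  qed
  have eqI: "nrm A a = nrm A b" if "a \<in> carrier A" "b \<in> carrier A"
    "\<And>X \<rho>. (X, \<rho>) \<in> \<R> \<Longrightarrow> op_norm X (\<rho> a) = op_norm X (\<rho> b)" for a b
    by (rule antisym; rule least) (use that le in \<open>auto, metis\<close>)
  have opdiff: "op_norm X (\<rho> (diff A x y)) = op_norm X (\<lambda>\<xi> i. \<rho> x \<xi> i - \<rho> y \<xi> i)"
    if X: "(X, \<rho>) \<in> \<R>" and xy: "x \<in> carrier A" "y \<in> carrier A" for X \<rho> x y
  proof -
    interpret star_representation A X \<rho> by unfold_locales (rule rep[OF X])
    show ?thesis by (rule op_norm_cong) (simp add: xy diff)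
  qed
  show ?thesis
  proof (intro seminormed_star_algebra.intro seminormed_star_algebra_axioms.intro)
    show "star_carrier A" by fact
    fix x assume x: "x \<in> carrier A"
    show "nrm A (diff A x (zero A)) = nrm A x"
    proof (rule eqI)
      fix X \<rho> assume X: "(X, \<rho>) \<in> \<R>"
      then interpret star_representation A X \<rho> by unfold_locales (rule rep)
      show "op_norm X (\<rho> (diff A x (zero A))) = op_norm X (\<rho> x)"
        by (rule op_norm_cong) (simp add: x diff assms(3)[OF X])
    qed (use x in auto)
    show "nrm A (diff A x x) = 0"
      by (rule antisym[OF least' nonneg]) (use x in \<open>auto simp: opdiff op_norm_null\<close>)
    fix y assume y: "y \<in> carrier A"
    show "nrm A (diff A x y) = nrm A (diff A y x)"
    proof (rule eqI)
      fix X \<rho> assume X: "(X, \<rho>) \<in> \<R>"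
      then interpret star_representation A X \<rho> by unfold_locales (rule rep)
      have "op_norm X (\<rho> (diff A y x)) = op_norm X (\<rho> ((-1) \<odot>\<^bsub>A\<^esub> diff A x y))"
        by (rule op_norm_cong) (simp add: x y diff smult)
      then show "op_norm X (\<rho> (diff A x y)) = op_norm X (\<rho> (diff A y x))"
        by (simp add: op_norm_smult x y)
    qed (use x y in auto)
    show "nrm A (diff A (c \<odot>\<^bsub>A\<^esub> x) (c \<odot>\<^bsub>A\<^esub> y)) \<le> cmod c * nrm A (diff A x y)" for c
    proof (rule least')
      fix X \<rho> assume X: "(X, \<rho>) \<in> \<R>"
      then interpret star_representation A X \<rho> by unfold_locales (rule rep)
      have "op_norm X (\<rho> (diff A (c \<odot>\<^bsub>A\<^esub> x) (c \<odot>\<^bsub>A\<^esub> y))) = op_norm X (\<rho> (c \<odot>\<^bsub>A\<^esub> diff A x y))"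
        by (rule op_norm_cong) (simp add: x y diff smult right_diff_distrib)
      then show "op_norm X (\<rho> (diff A (c \<odot>\<^bsub>A\<^esub> x) (c \<odot>\<^bsub>A\<^esub> y))) \<le> cmod c * nrm A (diff A x y)"
        using le[OF X, of "diff A x y"] x y by (simp add: op_norm_smult mult_left_mono)
    qed (use x y in auto)
    show "nrm A (diff A (star A x) (star A y)) \<le> nrm A (diff A x y)"
    proof (rule least')
      fix X \<rho> assume X: "(X, \<rho>) \<in> \<R>"
      then interpret star_representation A X \<rho> by unfold_locales (rule rep)
      \<comment> \<open>\<open>star A\<close> is not known to be additive. The two operators are
        compared through inner products, where the star moves to the other side as an honest
        adjoint.\<close>
      have "\<rho> (diff A (star A x) (star A y)) \<xi> = \<rho> (star A (diff A x y)) \<xi>" if \<xi>: "\<xi> \<in> ell2 X" for \<xi>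
      proof (rule ell2_eqI)
        fix \<zeta> assume \<zeta>: "\<zeta> \<in> ell2 X"
        have "ell2_inner (\<rho> (diff A (star A x) (star A y)) \<xi>) \<zeta> =
            ell2_inner (\<rho> (star A x) \<xi>) \<zeta> - ell2_inner (\<rho> (star A y) \<xi>) \<zeta>"
          using ell2_inner_add_left[of "\<rho> (star A x) \<xi>" X \<zeta> "\<lambda>i. -1 * \<rho> (star A y) \<xi> i"]
            ell2_inner_scale_left[of "-1" "\<rho> (star A y) \<xi>" \<zeta>] ell2_scale[OF closed, of "star A y" \<xi> "-1"]
          by (simp add: x y diff \<xi> \<zeta> closed)
        also have "\<dots> = ell2_inner \<xi> (\<rho> (diff A x y) \<zeta>)"
          using ell2_inner_add_right[of \<xi> X "\<rho> x \<zeta>" "\<lambda>i. -1 * \<rho> y \<zeta> i"]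
            ell2_inner_scale_right[of \<xi> "-1" "\<rho> y \<zeta>"] ell2_scale[OF closed, of y \<zeta> "-1"]
          by (simp add: x y diff \<xi> \<zeta> closed inner)
        also have "\<dots> = ell2_inner (\<rho> (star A (diff A x y)) \<xi>) \<zeta>"
          by (rule inner[symmetric]) (use x y \<xi> \<zeta> in auto)
        finally show "ell2_inner \<zeta> (\<rho> (diff A (star A x) (star A y)) \<xi>) = ell2_inner \<zeta> (\<rho> (star A (diff A x y)) \<xi>)"
          by (subst (1 2) ell2_inner_commute) simp
      qed (use x y \<xi> in \<open>auto intro!: closed\<close>)
      then have "op_norm X (\<rho> (diff A (star A x) (star A y))) = op_norm X (\<rho> (star A (diff A x y)))"
        by (rule op_norm_cong)
      also have "\<dots> \<le> op_norm X (\<rho> (diff A x y))"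
        by (rule op_norm_adjoints_le[OF adjoints]) (use x y in auto)
      also have "\<dots> \<le> nrm A (diff A x y)" by (rule le[OF X]) (use x y in auto)
      finally show "op_norm X (\<rho> (diff A (star A x) (star A y))) \<le> nrm A (diff A x y)" .
    qed (use x y in auto)
    fix x' assume x': "x' \<in> carrier A"
    show "nrm A (diff A x x') \<le> nrm A (diff A x y) + nrm A (diff A y x')"
    proof (rule least')
      fix X \<rho> assume X: "(X, \<rho>) \<in> \<R>"
      then interpret star_representation A X \<rho> by unfold_locales (rule rep)
      have "op_norm X (\<rho> (diff A x x')) = op_norm X (\<rho> (diff A x y \<oplus>\<^bsub>A\<^esub> diff A y x'))"
        by (rule op_norm_cong) (simp add: x y x' diff add)
      also have "\<dots> \<le> op_norm X (\<rho> (diff A x y)) + op_norm X (\<rho> (diff A y x'))"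
        by (rule op_norm_add) (use x y x' in auto)
      finally show "op_norm X (\<rho> (diff A x x')) \<le> nrm A (diff A x y) + nrm A (diff A y x')"
        using le[OF X, of "diff A x y"] le[OF X, of "diff A y x'"] x y x' by simp
    qed (use x x' in auto)
    show "nrm A (diff A x (y \<oplus>\<^bsub>A\<^esub> x')) = nrm A (diff A (diff A x y) x')"
    proof (rule eqI)
      fix X \<rho> assume X: "(X, \<rho>) \<in> \<R>"
      then interpret star_representation A X \<rho> by unfold_locales (rule rep)
      show "op_norm X (\<rho> (diff A x (y \<oplus>\<^bsub>A\<^esub> x'))) = op_norm X (\<rho> (diff A (diff A x y) x'))"
        by (rule op_norm_cong) (simp add: x y x' diff add algebra_simps)
    qed (use x y x' in auto)
    fix y' assume y': "y' \<in> carrier A"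
    show "nrm A (diff A (x \<oplus>\<^bsub>A\<^esub> y) (x' \<oplus>\<^bsub>A\<^esub> y')) \<le> nrm A (diff A x x') + nrm A (diff A y y')"
    proof (rule least')
      fix X \<rho> assume X: "(X, \<rho>) \<in> \<R>"
      then interpret star_representation A X \<rho> by unfold_locales (rule rep)
      have "op_norm X (\<rho> (diff A (x \<oplus>\<^bsub>A\<^esub> y) (x' \<oplus>\<^bsub>A\<^esub> y'))) = op_norm X (\<rho> (diff A x x' \<oplus>\<^bsub>A\<^esub> diff A y y'))"
        by (rule op_norm_cong) (simp add: x y x' y' diff add algebra_simps)
      also have "\<dots> \<le> op_norm X (\<rho> (diff A x x')) + op_norm X (\<rho> (diff A y y'))"
        by (rule op_norm_add) (use x y x' y' in auto)
      finally show "op_norm X (\<rho> (diff A (x \<oplus>\<^bsub>A\<^esub> y) (x' \<oplus>\<^bsub>A\<^esub> y'))) \<le> nrm A (diff A x x') + nrm A (diff A y y')"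
        using le[OF X, of "diff A x x'"] le[OF X, of "diff A y y'"] x y x' y' by simp
    qed (use x y x' y' in auto)
    show "nrm A (diff A (x \<otimes>\<^bsub>A\<^esub> y) (x' \<otimes>\<^bsub>A\<^esub> y')) \<le> nrm A x * nrm A (diff A y y') + nrm A (diff A x x') * nrm A y'"
    proof (rule least')
      fix X \<rho> assume X: "(X, \<rho>) \<in> \<R>"
      then interpret star_representation A X \<rho> by unfold_locales (rule rep)
      have "op_norm X (\<rho> (diff A (x \<otimes>\<^bsub>A\<^esub> y) (x' \<otimes>\<^bsub>A\<^esub> y'))) =
          op_norm X (\<rho> (x \<otimes>\<^bsub>A\<^esub> diff A y y' \<oplus>\<^bsub>A\<^esub> diff A x x' \<otimes>\<^bsub>A\<^esub> y'))"
        by (rule op_norm_cong)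
          (simp add: x y x' y' diff add mult closed bounded_op_diff[OF bounded])
      also have "\<dots> \<le> op_norm X (\<rho> (x \<otimes>\<^bsub>A\<^esub> diff A y y')) + op_norm X (\<rho> (diff A x x' \<otimes>\<^bsub>A\<^esub> y'))"
        by (rule op_norm_add) (use x y x' y' in auto)
      also have "\<dots> \<le> op_norm X (\<rho> x) * op_norm X (\<rho> (diff A y y')) + op_norm X (\<rho> (diff A x x')) * op_norm X (\<rho> y')"
        by (intro add_mono op_norm_mult) (use x y x' y' in auto)
      also have "\<dots> \<le> nrm A x * nrm A (diff A y y') + nrm A (diff A x x') * nrm A y'"
        by (intro add_mono mult_mono le[OF X] nonneg op_norm_nonneg[OF bounded]) (use x y x' y' in auto)
      finally show "op_norm X (\<rho> (diff A (x \<otimes>\<^bsub>A\<^esub> y) (x' \<otimes>\<^bsub>A\<^esub> y'))) \<le>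
          nrm A x * nrm A (diff A y y') + nrm A (diff A x x') * nrm A y'" .
    qed (use x y x' y' in auto)
  qed
qed

section \<open>Contractivity of representations of universal C*-algebras\<close>

lemma ell2_norm_diff_power2:
  assumes \<xi>: "\<xi> \<in> ell2 X" and \<eta>: "\<eta> \<in> ell2 X"
  shows "(ell2_norm (\<lambda>i. \<xi> i - \<eta> i))\<^sup>2 = (ell2_norm \<xi>)\<^sup>2 + (ell2_norm \<eta>)\<^sup>2 - 2 * Re (ell2_inner \<xi> \<eta>)"
proof -
  have m: "(\<lambda>i. -1 * \<eta> i) \<in> ell2 X" by (rule ell2_scale[OF \<eta>])
  have d: "(\<lambda>i. \<xi> i + -1 * \<eta> i) \<in> ell2 X" by (rule ell2_add[OF \<xi> m])
  have "complex_of_real ((ell2_norm (\<lambda>i. \<xi> i + -1 * \<eta> i))\<^sup>2) =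
      ell2_inner \<xi> \<xi> + ell2_inner \<eta> \<eta> - (ell2_inner \<xi> \<eta> + ell2_inner \<eta> \<xi>)"
    unfolding ell2_inner_self[OF d, symmetric] ell2_inner_add_left[OF \<xi> d m]
      ell2_inner_add_right[OF \<xi> \<xi> m] ell2_inner_add_right[OF m \<xi> m]
      ell2_inner_scale_left ell2_inner_scale_right by simp
  also have "\<dots> = of_real ((ell2_norm \<xi>)\<^sup>2 + (ell2_norm \<eta>)\<^sup>2 - 2 * Re (ell2_inner \<xi> \<eta>))"
    unfolding ell2_inner_self[OF \<xi>] ell2_inner_self[OF \<eta>] ell2_inner_commute[of \<eta> \<xi>]
    by (simp add: complex_add_cnj)
  finally show ?thesis unfolding of_real_eq_iff by simp
qed

text \<open>On a vector \<open>\<xi>\<close> where \<open>T\<close> almost attains its norm, \<open>c\<xi> - T'T\<xi>\<close> is small, so that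
  \<open>c - T'T\<close> has no left inverse.\<close>

lemma op_norm_no_inverse:
  assumes T: "adjoints X T T'" and K: "bounded_op X K" and E: "bounded_op X E"
    and E1: "\<And>\<xi>. \<xi> \<in> ell2 X \<Longrightarrow> ell2_norm (E \<xi>) \<le> ell2_norm \<xi>"
    and TE: "\<And>\<xi>. \<xi> \<in> ell2 X \<Longrightarrow> T (E \<xi>) = T \<xi>"
    and c: "c = (op_norm X T)\<^sup>2" "0 < c"
    and inv: "\<And>\<xi>. \<xi> \<in> ell2 X \<Longrightarrow> K (\<lambda>i. of_real c * E \<xi> i - T' (T \<xi>) i) = (\<lambda>i. of_real c * E \<xi> i)"
  shows False
proof -
  define q where "q = op_norm X T"
  define k where "k = op_norm X K"
  note B = adjointsD(1,2)[OF T]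
  have q: "0 \<le> q" "c = q\<^sup>2" and k: "0 \<le> k"
    using op_norm_nonneg[OF B(1)] op_norm_nonneg[OF K] c by (auto simp: q_def k_def)
  \<comment> \<open>With \<open>t\<close> the squared norm of \<open>T \<xi>\<close>, the left
    inverse \<open>K\<close> will give \<open>t * (1 + k\<^sup>2) \<le> c * k\<^sup>2\<close>. So
    \<open>b\<close> bounds \<open>t\<close> uniformly and is smaller than \<open>c\<close>, which
    was the supremum of all \<open>t\<close>.\<close>
  define b where "b = c * k\<^sup>2 / (1 + k\<^sup>2)"
  have pos: "0 < 1 + k\<^sup>2" by (metis add_pos_nonneg zero_le_power2 zero_less_one)
  have "ell2_norm (T \<xi>) \<le> sqrt b" if \<xi>: "\<xi> \<in> ell2 X" "ell2_norm \<xi> \<le> 1" for \<xi>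
  proof (rule real_le_rsqrt)
    define t where "t = (ell2_norm (T \<xi>))\<^sup>2"
    note E\<xi> = bounded_op_closed[OF E \<xi>(1)] and T\<xi> = bounded_op_closed[OF B(1) \<xi>(1)]
    note TT\<xi> = bounded_op_closed[OF B(2) T\<xi>]
    define v where "v = (\<lambda>i. of_real c * E \<xi> i - T' (T \<xi>) i)"
    have cE: "(\<lambda>i. of_real c * E \<xi> i) \<in> ell2 X" by (rule ell2_scale[OF E\<xi>])
    have v: "v \<in> ell2 X" unfolding v_def by (rule ell2_diff[OF cE TT\<xi>])
    have "ell2_inner (E \<xi>) (T' (T \<xi>)) = ell2_inner (T (E \<xi>)) (T \<xi>)"
      by (rule adjointsD(3)[OF adjoints_sym[OF T] E\<xi> T\<xi>, symmetric])
    then have in1: "ell2_inner (\<lambda>i. of_real c * E \<xi> i) (T' (T \<xi>)) = of_real (c * t)"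
      by (simp add: ell2_inner_scale_left TE[OF \<xi>(1)] ell2_inner_self[OF T\<xi>] t_def)
    have "ell2_norm (T' (T \<xi>)) \<le> q * ell2_norm (T \<xi>)"
      using op_norm_bound[OF B(2) T\<xi>] op_norm_adjoints_le[OF T] mult_right_mono[of _ q "ell2_norm (T \<xi>)"]
      unfolding q_def by (meson ell2_norm_nonneg order_trans)
    then have in2: "(ell2_norm (T' (T \<xi>)))\<^sup>2 \<le> c * t"
      unfolding q(2) t_def by (metis ell2_norm_nonneg power_mono power_mult_distrib)
    have "ell2_norm (E \<xi>) \<le> 1" using E1[OF \<xi>(1)] \<xi>(2) by simp
    then have "(ell2_norm (E \<xi>))\<^sup>2 \<le> 1" by (simp add: power_le_one)
    then have in3: "(ell2_norm (\<lambda>i. of_real c * E \<xi> i))\<^sup>2 \<le> c\<^sup>2"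
      using mult_left_mono[of "(ell2_norm (E \<xi>))\<^sup>2" 1 "c\<^sup>2"] by (simp add: ell2_norm_scale power_mult_distrib)
    \<comment> \<open>Expanding the square, the three terms contribute at most
      \<open>c\<^sup>2\<close>, \<open>- 2 * c * t\<close> and \<open>c * t\<close>.\<close>
    have nv: "(ell2_norm v)\<^sup>2 \<le> c * (c - t)"
      using ell2_norm_diff_power2[OF cE TT\<xi>] in1 in2 in3 unfolding v_def
      by (simp add: power2_eq_square algebra_simps)
    have "c * ell2_norm (E \<xi>) = ell2_norm (K v)"
      unfolding v_def inv[OF \<xi>(1)] ell2_norm_scale using c(2) by simp
    also have "\<dots> \<le> k * ell2_norm v"
      unfolding k_def by (rule op_norm_bound[OF K v])
    finally have "(c * ell2_norm (E \<xi>))\<^sup>2 \<le> (k * ell2_norm v)\<^sup>2"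
      using c(2) by (intro power_mono) auto
    also have "\<dots> \<le> k\<^sup>2 * (c * (c - t))"
      unfolding power_mult_distrib by (intro mult_left_mono nv) simp
    finally have "c * (c * (ell2_norm (E \<xi>))\<^sup>2) \<le> c * (k\<^sup>2 * (c - t))"
      by (simp add: power_mult_distrib power2_eq_square mult_ac)
    then have "c * (ell2_norm (E \<xi>))\<^sup>2 \<le> k\<^sup>2 * (c - t)"
      using c(2) by simp
    moreover have "ell2_norm (T \<xi>) \<le> q * ell2_norm (E \<xi>)"
      using op_norm_bound[OF B(1) E\<xi>] by (simp add: TE[OF \<xi>(1)] q_def)
    then have "t \<le> c * (ell2_norm (E \<xi>))\<^sup>2"
      unfolding q(2) t_def by (metis ell2_norm_nonneg power_mono power_mult_distrib)
    ultimately have "t * (1 + k\<^sup>2) \<le> c * k\<^sup>2" by (simp add: algebra_simps)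
    then show "(ell2_norm (T \<xi>))\<^sup>2 \<le> b"
      using pos by (simp add: b_def t_def pos_le_divide_eq)
  qed
  then have "q \<le> sqrt b"
    unfolding q_def op_norm_def using ell2_zero[of X] by (intro cSUP_least) fastforce+
  then have "c \<le> b" unfolding q(2) by (rule square_le_of_le_sqrt[OF q(1)])
  moreover have "b < c" using c(2) pos by (simp add: b_def field_simps)
  ultimately show False by simp
qed

lemma one_minus_mult_geometric:
  fixes y :: "'a::ring_1"
  shows "(1 - y) * (\<Sum>i<n. y ^ i) = 1 - y ^ n" "(\<Sum>i<n. y ^ i) * (1 - y) = 1 - y ^ n"
proof (induction n)
  case (Suc n)
  {
    case 1
    show ?case unfolding sum.lessThan_Suc distrib_left Suc by (simp add: algebra_simps)
  next
    case 2
    show ?case unfolding sum.lessThan_Suc distrib_right Suc by (simp add: algebra_simps power_commutes)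
  }
qed simp_all

text \<open>A diagonal Neumann series: at index \<open>n\<close> both the element and the number of
  terms change. The class of the sequence represents the inverse of 1 minus the class of
  \<open>y\<close>.\<close>

lemma cauchy_geometric_series:
  fixes y :: "nat \<Rightarrow> 'g free_star"
  assumes R: "bounding_rels R" and y: "y \<in> cauchy_seqs (free_star_algebra R)"
    and r: "r < 1" "\<And>n. universal_seminorm R (y n) \<le> r"
  shows "(\<lambda>n. \<Sum>i<n. y n ^ i) \<in> cauchy_seqs (free_star_algebra R)"
proof -
  interpret F: seminormed_star_algebra "free_star_algebra R"
    by (rule seminormed_free_star_algebra[OF R])
  let ?p = "universal_seminorm R"
  note p = cstar_seminorm_universal[OF R]
  note nn = cstar_seminorm_nonneg[OF p]
  have r0: "0 \<le> r" using r(2)[of 0] nn[of "y 0"] by linarith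
  define G where "G = 1 / (1 - r)"
  have G: "0 \<le> G" using r by (simp add: G_def)
  have pow: "?p (y m ^ n) \<le> r ^ n" for m n
    using cstar_seminorm_power'[OF p, of "y m" n] power_mono[OF r(2) nn, of m n] by linarith
  define g where "g n = (\<Sum>i<n. y n ^ i)" for n
  have sum_le: "?p (\<Sum>i<k. y m ^ i) \<le> (\<Sum>i<k. r ^ i)" for m k
  proof (induction k)
    case (Suc k)
    then show ?case
      using cstar_seminorm_add[OF p, of "\<Sum>i<k. y m ^ i" "y m ^ k"] pow[of m k] by simp
  qed (simp add: cstar_seminorm_zero[OF p])
  have g_le: "?p (g n) \<le> G" for n
  proof -
    have "(\<Sum>i<n. r ^ i) = (1 - r ^ n) / (1 - r)"
      using r(1) by (simp add: sum_gp_strict)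
    also have "\<dots> \<le> G" using r r0 by (simp add: G_def divide_right_mono)
    finally show ?thesis using sum_le[where m = n and k = n] by (simp add: g_def)
  qed
  show ?thesis unfolding g_def[symmetric]
  proof (rule F.cauchy_seqsI)
    have "(\<lambda>n. r ^ n) \<longlonglongrightarrow> 0" using r r0 by (intro LIMSEQ_power_zero) auto
    then show "((\<lambda>z. G * F.d (y (fst z)) (y (snd z)) * G + (G * r ^ snd z + r ^ fst z * G)) \<longlongrightarrow> 0)
        (sequentially \<times>\<^sub>F sequentially)"
      by (intro tendsto_add_zero tendsto_mult_right_zero tendsto_mult_left_zero F.cauchy_seqsD[OF y])
        (rule filterlim_compose[OF _ filterlim_fst] filterlim_compose[OF _ filterlim_snd], assumption)+
    fix m n
    \<comment> \<open>Resolvent identity. The partial sums invert \<open>1 - y n\<close> and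
      \<open>1 - y m\<close> up to a power, so \<open>U\<close> and \<open>V\<close> are
      \<open>g m\<close> and \<open>g n\<close> up to small remainders, while \<open>W\<close>
      contains the small factor \<open>y m - y n\<close>.\<close>
    define U V W where "U = g m * (1 - y n) * g n" and "V = g m * (1 - y m) * g n"
      and "W = g m * (y m - y n) * g n"
    have "U - V = W"
      by (simp add: U_def V_def W_def algebra_simps)
    moreover have "U = g m - g m * y n ^ n"
      unfolding U_def g_def[of n] mult.assoc one_minus_mult_geometric by (simp add: algebra_simps)
    moreover have "V = g n - y m ^ m * g n"
      unfolding V_def g_def[of m] one_minus_mult_geometric by (simp add: algebra_simps)
    ultimately have "g m - g n = g m * (y m - y n) * g n + (g m * y n ^ n - y m ^ m * g n)"
      unfolding W_def[symmetric] by (simp add: algebra_simps)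
    then have "?p (g m - g n) \<le> ?p (g m * (y m - y n) * g n) + (?p (g m * y n ^ n) + ?p (y m ^ m * g n))"
      using cstar_seminorm_add[OF p, of "g m * (y m - y n) * g n" "g m * y n ^ n - y m ^ m * g n"]
        cstar_seminorm_diff[OF p, of "g m * y n ^ n" "y m ^ m * g n"] by simp
    also have "?p (g m * (y m - y n) * g n) \<le> G * ?p (y m - y n) * G"
      by (rule order_trans[OF cstar_seminorm_mult[OF p]], rule mult_mono[OF order_trans[OF cstar_seminorm_mult[OF p]]])
         (use G nn g_le in \<open>auto intro: mult_right_mono\<close>)
    also have "?p (g m * y n ^ n) \<le> G * r ^ n"
      by (rule order_trans[OF cstar_seminorm_mult[OF p]]) (intro mult_mono g_le pow G nn)
    also have "?p (y m ^ m * g n) \<le> r ^ m * G"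
      by (rule order_trans[OF cstar_seminorm_mult[OF p]]) (intro mult_mono g_le pow zero_le_power r0 nn)
    finally show "F.d (g m) (g n) \<le> G * F.d (y (fst (m, n))) (y (snd (m, n))) * G + (G * r ^ snd (m, n) + r ^ fst (m, n) * G)"
      by simp
  qed simp
qed

text \<open>If \<open>c = \<parallel>\<rho> a\<parallel>\<^sup>2\<close> exceeds \<open>\<parallel>a\<parallel>\<^sup>2\<close>, the Neumann series inverts \<open>c - a*a\<close>,
  contradicting \<open>op_norm_no_inverse\<close>.\<close>

lemma representation_contractive:
  assumes R: "bounding_rels R" and rep: "representation (universal_cstar R) X \<rho>"
    and a: "a \<in> carrier (universal_cstar R)"
  shows "op_norm X (\<rho> a) \<le> nrm (universal_cstar R) a"
proof (rule ccontr)
  define A where "A = free_star_algebra R"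
  interpret F: seminormed_star_algebra A
    unfolding A_def by (rule seminormed_free_star_algebra[OF R])
  let ?p = "universal_seminorm R"
  note p = cstar_seminorm_universal[OF R]
  let ?C = "completion A"
  have C: "universal_cstar R = ?C" by (simp add: universal_cstar_def A_def)
  interpret \<rho>: star_representation ?C X \<rho> using rep C by unfold_locales simp
  have [simp]: "monoid.mult A = (*)" "one A = 1" "star A = free_adj" "smult A = free_scale"
    "carrier A = UNIV" "nrm A = ?p" "add A = (+)" "diff A = (-)"
    by (simp_all add: A_def fun_eq_iff)
  define N where "N = nrm ?C a"
  define c where "c = (op_norm X (\<rho> a))\<^sup>2"
  assume "\<not> op_norm X (\<rho> a) \<le> nrm (universal_cstar R) a"
  then have less: "N < op_norm X (\<rho> a)" by (simp add: N_def C)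
  obtain f where f: "f \<in> cauchy_seqs A" "a = F.cls f"
    using a unfolding C by (rule F.completionE)
  have lim: "(\<lambda>n. ?p (f n)) \<longlonglongrightarrow> N"
    using F.completion_nrm[OF f(1)] f(2) by (simp add: N_def)
  have N0: "0 \<le> N"
    by (rule LIMSEQ_le_const[OF lim]) (simp add: cstar_seminorm_nonneg[OF p])
  have "N\<^sup>2 < c" unfolding c_def using less N0 by (intro power_strict_mono) auto
  then have c: "0 < c" using order_le_less_trans[OF zero_le_power2] by blast
  \<comment> \<open>The element \<open>a* a / c\<close> has norm \<open>N\<^sup>2 / c\<close>, which
    is below 1. The room up to \<open>r\<close> absorbs the passage to a representing
    sequence.\<close>
  obtain r where r: "N\<^sup>2 / c < r" "r < 1"
    using dense[of "N\<^sup>2 / c" 1] \<open>N\<^sup>2 < c\<close> c by auto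
  have "(\<lambda>n. (?p (f n))\<^sup>2 / c) \<longlonglongrightarrow> N\<^sup>2 / c" by (intro tendsto_intros lim) (use c in auto)
  from order_tendstoD(2)[OF this r(1)] obtain M where M: "\<And>n. n \<ge> M \<Longrightarrow> (?p (f n))\<^sup>2 / c < r"
    by (auto simp: eventually_sequentially)
  \<comment> \<open>Discarding the first \<open>M\<close> terms makes the bound \<open>r\<close>
    valid at every index without changing the class.\<close>
  define h where "h = f \<circ> (\<lambda>n. n + M)"
  have h: "h \<in> cauchy_seqs A" "a = F.cls h"
    using F.cauchy_subseq[OF f(1), of "\<lambda>n. n + M"] f(2) by (auto simp: h_def strict_mono_def)
  define y where "y n = free_scale (of_real (1 / c)) (free_adj (h n) * h n)" for n
  have y: "y \<in> cauchy_seqs A"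
    unfolding y_def using F.cauchy_smult[OF F.cauchy_mult[OF F.cauchy_star[OF h(1)] h(1)]] by simp
  have yr: "?p (y n) \<le> r" for n
    using M[of "n + M"] c
    by (simp add: y_def h_def cstar_seminorm_scale[OF p] cstar_seminorm_cstar[OF p] norm_divide)
  define g where "g n = (\<Sum>i<n. y n ^ i)" for n
  have g: "g \<in> cauchy_seqs A"
    unfolding g_def A_def using y r yr by (intro cauchy_geometric_series[OF R]) (auto simp: A_def)
  have one: "\<one>\<^bsub>?C\<^esub> = F.cls (\<lambda>_. 1)" "(\<lambda>_. 1) \<in> cauchy_seqs A"
    using F.completion_one F.cauchy_const[of 1] by auto
  have aC: "a \<in> carrier ?C" and oC: "\<one>\<^bsub>?C\<^esub> \<in> carrier ?C" and gC: "F.cls g \<in> carrier ?C"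
    and sC: "star ?C a \<in> carrier ?C"
    using one h g by (auto simp: F.completion_star intro!: F.cls_closed F.cauchy_star[of h, simplified])
  have hh: "(\<lambda>n. free_adj (h n) * h n) \<in> cauchy_seqs A"
    using F.cauchy_mult[OF F.cauchy_star[OF h(1)] h(1)] by simp
  have aa: "star ?C a \<otimes>\<^bsub>?C\<^esub> a = F.cls (\<lambda>n. free_adj (h n) * h n)"
    unfolding h(2) using F.completion_mult[OF F.cauchy_star[OF h(1)] h(1)]
    by (simp add: F.completion_star[OF h(1)])
  have aaC: "star ?C a \<otimes>\<^bsub>?C\<^esub> a \<in> carrier ?C" unfolding aa by (rule F.cls_closed[OF hh])
  \<comment> \<open>This is \<open>c - a* a\<close>, represented by \<open>c * (1 - y n)\<close>.
    Since \<open>g\<close> inverts \<open>1 - y\<close>, multiplying by \<open>g\<close> gives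
    \<open>c\<close> times the unit.\<close>
  let ?u = "(of_real c \<odot>\<^bsub>?C\<^esub> \<one>\<^bsub>?C\<^esub>) \<oplus>\<^bsub>?C\<^esub> ((-1) \<odot>\<^bsub>?C\<^esub> (star ?C a \<otimes>\<^bsub>?C\<^esub> a))"
  have c1: "(\<lambda>_. free_scale (of_real c) 1) \<in> cauchy_seqs A"
    using F.cauchy_const[of "free_scale (of_real c) 1"] by simp
  have mh: "(\<lambda>n. free_scale (- 1) (free_adj (h n) * h n)) \<in> cauchy_seqs A"
    using F.cauchy_smult[OF hh, of "-1"] by simp
  have um: "(\<lambda>n. free_scale (of_real c) 1 + free_scale (- 1) (free_adj (h n) * h n)) \<in> cauchy_seqs A"
    using F.cauchy_add[OF c1 mh] by simp
  have u: "?u = F.cls (\<lambda>n. free_scale (of_real c) 1 + free_scale (-1) (free_adj (h n) * h n))"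
    unfolding aa one(1) F.completion_smult[OF one(2)] F.completion_smult[OF hh]
    using F.completion_add[OF c1 mh] by simp
  have inv: "F.cls g \<otimes>\<^bsub>?C\<^esub> ?u = of_real c \<odot>\<^bsub>?C\<^esub> \<one>\<^bsub>?C\<^esub>"
    unfolding u F.completion_mult[OF g um] unfolding one(1) F.completion_smult[OF one(2)]
  proof (rule F.cls_eqI)
    show "(\<lambda>n. g n \<otimes>\<^bsub>A\<^esub> (free_scale (of_real c) 1 + free_scale (- 1) (free_adj (h n) * h n))) \<in> cauchy_seqs A"
      by (rule F.cauchy_mult[OF g um])
    show "(\<lambda>n. of_real c \<odot>\<^bsub>A\<^esub> 1) \<in> cauchy_seqs A" using c1 by simp
    have r0: "0 \<le> r" using yr[of 0] cstar_seminorm_nonneg[OF p, of "y 0"] by linarith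
    show "(\<lambda>n. c * r ^ n) \<longlonglongrightarrow> 0"
      using r r0 by (intro tendsto_mult_right_zero LIMSEQ_power_zero) auto
    fix n
    have "free_scale (of_real c) 1 + free_scale (- 1) (free_adj (h n) * h n) = free_scale (of_real c) (1 - y n)"
      using c by (simp add: y_def free_scale_simps)
    then have "g n * (free_scale (of_real c) 1 + free_scale (- 1) (free_adj (h n) * h n)) =
        free_scale (of_real c) (1 - y n ^ n)"
      by (simp add: free_scale_mult_right g_def one_minus_mult_geometric)
    then have "?p (g n * (free_scale (of_real c) 1 + free_scale (- 1) (free_adj (h n) * h n)) - free_scale (of_real c) 1) =
        ?p (free_scale (of_real c) (- (y n ^ n)))"
      by (simp add: free_scale_simps)
    also have "\<dots> = c * ?p (y n ^ n)"
      using c by (simp add: cstar_seminorm_scale[OF p] cstar_seminorm_minus[OF p])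
    also have "\<dots> \<le> c * r ^ n"
      using cstar_seminorm_power'[OF p, of "y n" n] power_mono[OF yr cstar_seminorm_nonneg[OF p], of n n] c
      by (intro mult_left_mono) auto
    finally show "F.d (g n \<otimes>\<^bsub>A\<^esub> (free_scale (of_real c) 1 + free_scale (- 1) (free_adj (h n) * h n)))
        (of_real c \<odot>\<^bsub>A\<^esub> 1) \<le> c * r ^ n" by simp
  qed
  have oo: "star ?C \<one>\<^bsub>?C\<^esub> \<otimes>\<^bsub>?C\<^esub> \<one>\<^bsub>?C\<^esub> = \<one>\<^bsub>?C\<^esub>"
    using F.completion_mult[OF one(2) one(2)] F.completion_star[OF one(2)] by (simp add: one)
  have so: "star ?C \<one>\<^bsub>?C\<^esub> \<in> carrier ?C"
    using F.completion_star[OF one(2)] oC by (simp add: one)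
  have ao: "a \<otimes>\<^bsub>?C\<^esub> \<one>\<^bsub>?C\<^esub> = a"
    unfolding h(2) one(1) using F.completion_mult[OF h(1) one(2)] by simp
  have uC: "of_real c \<odot>\<^bsub>?C\<^esub> \<one>\<^bsub>?C\<^esub> \<in> carrier ?C" "(-1) \<odot>\<^bsub>?C\<^esub> (star ?C a \<otimes>\<^bsub>?C\<^esub> a) \<in> carrier ?C"
    "?u \<in> carrier ?C"
    unfolding u unfolding aa one(1) F.completion_smult[OF one(2)] F.completion_smult[OF hh]
    using c1 mh um by (auto intro!: F.cls_closed)
  show False
  \<comment> \<open>The unit of the algebra acts by a projection, which need not be the identity for
    a degenerate representation; it takes the place of \<open>E\<close>.\<close>
  proof (rule op_norm_no_inverse[of X "\<rho> a" "\<rho> (star ?C a)" "\<rho> (F.cls g)" "\<rho> \<one>\<^bsub>?C\<^esub>" c])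
    show "adjoints X (\<rho> a) (\<rho> (star ?C a))" by (rule \<rho>.adjoints[OF aC sC])
    show "bounded_op X (\<rho> (F.cls g))" "bounded_op X (\<rho> \<one>\<^bsub>?C\<^esub>)" by (rule \<rho>.bounded, fact)+
    fix \<xi> assume \<xi>: "\<xi> \<in> ell2 X"
    have "op_norm X (\<rho> \<one>\<^bsub>?C\<^esub>) = (op_norm X (\<rho> \<one>\<^bsub>?C\<^esub>))\<^sup>2"
      using \<rho>.op_norm_star_mult[OF oC so] oo by simp
    then have "op_norm X (\<rho> \<one>\<^bsub>?C\<^esub>) \<le> 1"
      by (metis mult_cancel_left2 order_refl power2_eq_square zero_le_one)
    then show "ell2_norm (\<rho> \<one>\<^bsub>?C\<^esub> \<xi>) \<le> ell2_norm \<xi>"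
      using op_norm_bound[OF \<rho>.bounded[OF oC] \<xi>] mult_right_mono[of _ 1 "ell2_norm \<xi>"] by fastforce
    show "\<rho> a (\<rho> \<one>\<^bsub>?C\<^esub> \<xi>) = \<rho> a \<xi>"
      using \<rho>.mult[OF aC oC \<xi>] ao by simp
    show "\<rho> (F.cls g) (\<lambda>i. of_real c * \<rho> \<one>\<^bsub>?C\<^esub> \<xi> i - \<rho> (star ?C a) (\<rho> a \<xi>) i) =
        (\<lambda>i. of_real c * \<rho> \<one>\<^bsub>?C\<^esub> \<xi> i)"
      using \<rho>.mult[OF gC uC(3) \<xi>] unfolding inv \<rho>.smult[OF oC \<xi>] \<rho>.add[OF uC(1,2) \<xi>] \<rho>.smult[OF aaC \<xi>]
        \<rho>.mult[OF sC aC \<xi>] by simp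
  qed (use c in \<open>auto simp: c_def\<close>)
qed

section \<open>Direct sums and tensor products of operators\<close>

lemma ell2_slice:
  assumes "\<zeta> \<in> ell2 (X \<times> Y)"
  shows "(\<lambda>y. \<zeta> (x, y)) \<in> ell2 Y"
proof (rule ell2I(1))
  show "\<zeta> (x, y) = 0" if "y \<notin> Y" for y using assms that by (simp add: ell2_support)
  fix F :: "'b set" assume F: "finite F"
  have "(\<Sum>y\<in>F. (cmod (\<zeta> (x, y)))\<^sup>2) = (\<Sum>z\<in>Pair x ` F. (cmod (\<zeta> z))\<^sup>2)"
    by (simp add: sum.reindex inj_on_def)
  also have "\<dots> \<le> (ell2_norm \<zeta>)\<^sup>2" using F by (intro sum_le_ell2_norm[OF assms]) auto
  finally show "(\<Sum>y\<in>F. (cmod (\<zeta> (x, y)))\<^sup>2) \<le> (ell2_norm \<zeta>)\<^sup>2" .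
qed simp

lemma ell2_slice_support: "\<zeta> \<in> ell2 (X \<times> Y) \<Longrightarrow> x \<notin> X \<Longrightarrow> (\<lambda>y. \<zeta> (x, y)) = (\<lambda>_. 0)"
  by (auto simp: ell2_support)

lemma sum_slices_le:
  assumes \<zeta>: "\<zeta> \<in> ell2 (X \<times> Y)" and F: "finite F"
  shows "(\<Sum>x\<in>F. (ell2_norm (\<lambda>y. \<zeta> (x, y)))\<^sup>2) \<le> (ell2_norm \<zeta>)\<^sup>2"
proof -
  have s: "(\<lambda>z. (cmod (\<zeta> z))\<^sup>2) summable_on (UNIV \<times> UNIV)"
    using ell2_summable[OF \<zeta>] by simp
  have s': "(\<lambda>y. (cmod (\<zeta> (x, y)))\<^sup>2) summable_on UNIV" for x
    by (rule ell2_summable[OF ell2_slice[OF \<zeta>]])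
  show ?thesis
    unfolding ell2_norm_power2
    using finite_sum_le_infsum[OF summable_on_SigmaD[OF s s'] F] infsum_Sigma_banach[OF s]
    by (simp add: infsum_nonneg)
qed

lemma ell2_inner_slices:
  assumes \<zeta>: "\<zeta> \<in> ell2 (X \<times> Y)" and \<omega>: "\<omega> \<in> ell2 (X \<times> Y)"
  shows "ell2_inner \<zeta> \<omega> = (\<Sum>\<^sub>\<infinity>x. ell2_inner (\<lambda>y. \<zeta> (x, y)) (\<lambda>y. \<omega> (x, y)))"
proof -
  have s: "(\<lambda>z. cnj (\<zeta> z) * \<omega> z) summable_on (UNIV \<times> UNIV)"
    using ell2_inner_summable'[OF \<zeta> \<omega>] by simp
  show ?thesis
    unfolding ell2_inner_def using infsum_Sigma_banach[OF s] by simp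
qed

text \<open>Block-diagonal operators. A constant family gives \<open>1 \<otimes> S\<close>; a
  varying one lets a different operator act on each level of the shift.\<close>

definition dsum :: "('i \<Rightarrow> ('j \<Rightarrow> complex) \<Rightarrow> ('j \<Rightarrow> complex)) \<Rightarrow> ('i \<times> 'j \<Rightarrow> complex) \<Rightarrow> ('i \<times> 'j \<Rightarrow> complex)" where
  "dsum S \<zeta> = (\<lambda>(x, y). S x (\<lambda>y'. \<zeta> (x, y')) y)"

lemma
  assumes S: "\<And>x. bounded_op Y (S x)" and C: "\<And>x. op_norm Y (S x) \<le> C" and \<zeta>: "\<zeta> \<in> ell2 (X \<times> Y)"
  shows dsum_closed: "dsum S \<zeta> \<in> ell2 (X \<times> Y)"
    and ell2_norm_dsum: "ell2_norm (dsum S \<zeta>) \<le> C * ell2_norm \<zeta>"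
proof -
  have C0: "0 \<le> C" using C op_norm_nonneg[OF S] by (meson order_trans)
  have supp: "dsum S \<zeta> z = 0" if "z \<notin> X \<times> Y" for z
  proof (cases "fst z \<in> X")
    case True
    then show ?thesis
      using that ell2_support[OF bounded_op_closed[OF S ell2_slice[OF \<zeta>]]]
      by (auto simp: dsum_def split: prod.splits)
  next
    case False
    then show ?thesis
      using ell2_slice_support[OF \<zeta>] bounded_op_zero[OF S] by (auto simp: dsum_def split: prod.splits)
  qed
  have le: "(\<Sum>z\<in>F. (cmod (dsum S \<zeta> z))\<^sup>2) \<le> (C * ell2_norm \<zeta>)\<^sup>2" if F: "finite F" for F
  proof -
    have "(\<Sum>z\<in>F. (cmod (dsum S \<zeta> z))\<^sup>2) \<le> (\<Sum>z\<in>fst ` F \<times> snd ` F. (cmod (dsum S \<zeta> z))\<^sup>2)"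
      using F by (intro sum_mono2 subset_fst_snd) auto
    also have "\<dots> = (\<Sum>x\<in>fst ` F. \<Sum>y\<in>snd ` F. (cmod (S x (\<lambda>y'. \<zeta> (x, y')) y))\<^sup>2)"
      by (simp add: sum.cartesian_product dsum_def case_prod_beta)
    also have "\<dots> \<le> (\<Sum>x\<in>fst ` F. C\<^sup>2 * (ell2_norm (\<lambda>y. \<zeta> (x, y)))\<^sup>2)"
    proof (rule sum_mono)
      fix x
      have "(\<Sum>y\<in>snd ` F. (cmod (S x (\<lambda>y'. \<zeta> (x, y')) y))\<^sup>2) \<le> (ell2_norm (S x (\<lambda>y'. \<zeta> (x, y'))))\<^sup>2"
        using F by (intro sum_le_ell2_norm[OF bounded_op_closed[OF S ell2_slice[OF \<zeta>]]]) auto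
      also have "\<dots> \<le> (C * ell2_norm (\<lambda>y. \<zeta> (x, y)))\<^sup>2"
        using order_trans[OF op_norm_bound[OF S ell2_slice[OF \<zeta>]] mult_right_mono[OF C ell2_norm_nonneg]]
        by (intro power_mono) auto
      finally show "(\<Sum>y\<in>snd ` F. (cmod (S x (\<lambda>y'. \<zeta> (x, y')) y))\<^sup>2) \<le> C\<^sup>2 * (ell2_norm (\<lambda>y. \<zeta> (x, y)))\<^sup>2"
        by (simp add: power_mult_distrib)
    qed
    also have "\<dots> \<le> C\<^sup>2 * (ell2_norm \<zeta>)\<^sup>2"
      unfolding sum_distrib_left[symmetric] using F by (intro mult_left_mono sum_slices_le[OF \<zeta>]) auto
    finally show ?thesis by (simp add: power_mult_distrib)
  qed
  from ell2I[OF supp le] C0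
  show "dsum S \<zeta> \<in> ell2 (X \<times> Y)" "ell2_norm (dsum S \<zeta>) \<le> C * ell2_norm \<zeta>" by auto
qed

lemma bounded_op_dsum:
  assumes S: "\<And>x. bounded_op Y (S x)" and C: "\<And>x. op_norm Y (S x) \<le> C"
  shows "bounded_op (X \<times> Y) (dsum S)"
proof (rule bounded_opI[OF dsum_closed[OF S C] _ _ ell2_norm_dsum[OF S C]])
  fix \<zeta> \<omega> and c
  assume \<zeta>: "\<zeta> \<in> ell2 (X \<times> Y)"
  show "dsum S (\<lambda>i. c * \<zeta> i) = (\<lambda>i. c * dsum S \<zeta> i)"
    by (auto simp: dsum_def bounded_op_scale[OF S ell2_slice[OF \<zeta>]])
  assume \<omega>: "\<omega> \<in> ell2 (X \<times> Y)"
  show "dsum S (\<lambda>i. \<zeta> i + \<omega> i) = (\<lambda>i. dsum S \<zeta> i + dsum S \<omega> i)"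
    by (auto simp: dsum_def bounded_op_add[OF S ell2_slice[OF \<zeta>] ell2_slice[OF \<omega>]])
qed

lemma dsum_slice: "(\<lambda>y. dsum S \<zeta> (x, y)) = S x (\<lambda>y. \<zeta> (x, y))"
  by (simp add: dsum_def)

lemma adjoints_dsum:
  assumes S: "\<And>x. adjoints Y (S x) (S' x)" and C: "\<And>x. op_norm Y (S x) \<le> C"
  shows "adjoints (X \<times> Y) (dsum S) (dsum S')"
proof (rule adjointsI)
  note B = adjointsD(1,2)[OF S]
  have C': "op_norm Y (S' x) \<le> C" for x
    using op_norm_adjoints_le[OF S, of x] C[of x] by linarith
  show "bounded_op (X \<times> Y) (dsum S)" "bounded_op (X \<times> Y) (dsum S')"
    by (rule bounded_op_dsum, rule B, rule C C')+
  fix \<zeta> \<omega> assume \<zeta>: "\<zeta> \<in> ell2 (X \<times> Y)" and \<omega>: "\<omega> \<in> ell2 (X \<times> Y)"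
  show "ell2_inner (dsum S' \<zeta>) \<omega> = ell2_inner \<zeta> (dsum S \<omega>)"
    unfolding ell2_inner_slices[OF dsum_closed[OF B(2) C' \<zeta>] \<omega>]
      ell2_inner_slices[OF \<zeta> dsum_closed[OF B(1) C \<omega>]] dsum_slice
      adjointsD(3)[OF S ell2_slice[OF \<zeta>] ell2_slice[OF \<omega>]] ..
qed

section \<open>Operators on a tensor product of Hilbert spaces\<close>

definition flip :: "('i \<times> 'j \<Rightarrow> complex) \<Rightarrow> 'j \<times> 'i \<Rightarrow> complex" where
  "flip \<zeta> = (\<lambda>(y, x). \<zeta> (x, y))"

lemma flip_reindex: "flip \<zeta> = \<zeta> \<circ> prod.swap"
  by (auto simp: flip_def)

lemma infsum_swap': "(\<Sum>\<^sub>\<infinity>z. f (prod.swap z)) = (\<Sum>\<^sub>\<infinity>z. f z)"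
  using infsum_reindex[of prod.swap UNIV f] by (simp add: o_def)

lemma ell2_norm_flip: "ell2_norm (flip \<zeta>) = ell2_norm \<zeta>"
  unfolding ell2_norm_def flip_reindex comp_def infsum_swap'[of "\<lambda>z. (cmod (\<zeta> z))\<^sup>2"] ..

lemma ell2_inner_flip: "ell2_inner (flip \<zeta>) (flip \<omega>) = ell2_inner \<zeta> \<omega>"
  unfolding ell2_inner_def flip_reindex comp_def infsum_swap'[of "\<lambda>z. cnj (\<zeta> z) * \<omega> z"] ..

lemma ell2_flip:
  assumes "\<zeta> \<in> ell2 (X \<times> Y)"
  shows "flip \<zeta> \<in> ell2 (Y \<times> X)"
proof -
  have "(\<lambda>z. (cmod (flip \<zeta> z))\<^sup>2) summable_on UNIV"
    using summable_on_reindex[of prod.swap UNIV "\<lambda>z. (cmod (\<zeta> z))\<^sup>2"] ell2_summable[OF assms]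
    by (simp add: o_def flip_reindex)
  then show ?thesis
    unfolding ell2_def using assms
    by (auto simp: flip_def ell2_support intro: summable_on_subset_banach)
qed

lemma flip_flip [simp]: "flip (flip \<zeta>) = \<zeta>"
  by (auto simp: flip_def)

lemma ell2_column: "\<zeta> \<in> ell2 (X \<times> Y) \<Longrightarrow> (\<lambda>x. \<zeta> (x, y)) \<in> ell2 X"
  using ell2_slice[OF ell2_flip] by (fastforce simp: flip_def)

text \<open>\<open>T \<otimes> 1\<close> is \<open>1 \<otimes> T\<close> with the two variables
  exchanged, so its boundedness and adjoint are inherited from \<open>dsum\<close>.\<close>

definition amp_left :: "(('i \<Rightarrow> complex) \<Rightarrow> ('i \<Rightarrow> complex)) \<Rightarrow> ('i \<times> 'j \<Rightarrow> complex) \<Rightarrow> ('i \<times> 'j \<Rightarrow> complex)" where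
  "amp_left T \<zeta> = flip (dsum (\<lambda>_. T) (flip \<zeta>))"

abbreviation amp_right :: "(('j \<Rightarrow> complex) \<Rightarrow> ('j \<Rightarrow> complex)) \<Rightarrow> ('i \<times> 'j \<Rightarrow> complex) \<Rightarrow> ('i \<times> 'j \<Rightarrow> complex)" where
  "amp_right S \<equiv> dsum (\<lambda>_. S)"

lemma amp_left_apply: "amp_left T \<zeta> (x, y) = T (\<lambda>x'. \<zeta> (x', y)) x"
  by (simp add: amp_left_def dsum_def flip_def)

lemma op_tensor_eq: "op_tensor T S \<zeta> = amp_left T (amp_right S \<zeta>)"
  by (auto simp: op_tensor_def amp_left_apply dsum_def)

lemma
  assumes T: "bounded_op X T" and \<zeta>: "\<zeta> \<in> ell2 (X \<times> Y)"
  shows amp_left_closed: "amp_left T \<zeta> \<in> ell2 (X \<times> Y)"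
    and ell2_norm_amp_left: "ell2_norm (amp_left T \<zeta>) \<le> op_norm X T * ell2_norm \<zeta>"
  using dsum_closed[OF T order_refl ell2_flip[OF \<zeta>]] ell2_norm_dsum[OF T order_refl ell2_flip[OF \<zeta>]]
  by (auto simp: amp_left_def ell2_norm_flip intro: ell2_flip)

lemma bounded_op_amp_left:
  assumes T: "bounded_op X T"
  shows "bounded_op (X \<times> Y) (amp_left T)"
proof (rule bounded_opI[OF amp_left_closed[OF T] _ _ ell2_norm_amp_left[OF T]])
  fix \<zeta> \<omega> :: "'a \<times> 'b \<Rightarrow> complex" and c
  assume \<zeta>: "\<zeta> \<in> ell2 (X \<times> Y)"
  show "amp_left T (\<lambda>i. c * \<zeta> i) = (\<lambda>i. c * amp_left T \<zeta> i)"
    by (auto simp: amp_left_apply bounded_op_scale[OF T ell2_column[OF \<zeta>]])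
  assume \<omega>: "\<omega> \<in> ell2 (X \<times> Y)"
  show "amp_left T (\<lambda>i. \<zeta> i + \<omega> i) = (\<lambda>i. amp_left T \<zeta> i + amp_left T \<omega> i)"
    by (auto simp: amp_left_apply bounded_op_add[OF T ell2_column[OF \<zeta>] ell2_column[OF \<omega>]])
qed

lemma adjoints_amp_left:
  assumes T: "adjoints X T T'"
  shows "adjoints (X \<times> Y) (amp_left T) (amp_left T')"
proof (rule adjointsI[OF bounded_op_amp_left bounded_op_amp_left])
  show "bounded_op X T" "bounded_op X T'" by (rule adjointsD[OF T])+
  fix \<zeta> \<omega> assume "\<zeta> \<in> ell2 (X \<times> Y)" "\<omega> \<in> ell2 (X \<times> Y)"
  then have "ell2_inner (amp_right T' (flip \<zeta>)) (flip \<omega>) = ell2_inner (flip \<zeta>) (amp_right T (flip \<omega>))"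
    by (intro adjointsD(3)[OF adjoints_dsum[OF T order_refl]] ell2_flip)
  then show "ell2_inner (amp_left T' \<zeta>) \<omega> = ell2_inner \<zeta> (amp_left T \<omega>)"
    unfolding amp_left_def
    using ell2_inner_flip[of "amp_right T' (flip \<zeta>)" "flip \<omega>"] ell2_inner_flip[of "flip \<zeta>" "amp_right T (flip \<omega>)"]
    by simp
qed

text \<open>Each coordinate is an inner product with a point mass. Moving both operators to the
  other side, their adjoints act on a point mass of the product, which is an elementary tensor;
  there the two orders visibly agree. No interchange of infinite sums is involved.\<close>

lemma amp_left_amp_right_commute:
  assumes T: "adjoints X T T'" and S: "adjoints Y S S'" and \<zeta>: "\<zeta> \<in> ell2 (X \<times> Y)"
  shows "amp_right S (amp_left T \<zeta>) = amp_left T (amp_right S \<zeta>)"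
proof
  note L = adjoints_amp_left[OF T, of Y] and R = adjoints_dsum[OF S order_refl, of X]
  have cl: "amp_left T \<zeta> \<in> ell2 (X \<times> Y)" "amp_right S \<zeta> \<in> ell2 (X \<times> Y)"
    "amp_right S (amp_left T \<zeta>) \<in> ell2 (X \<times> Y)" "amp_left T (amp_right S \<zeta>) \<in> ell2 (X \<times> Y)"
    by (intro bounded_op_closed[OF adjointsD(1)[OF L]] bounded_op_closed[OF adjointsD(1)[OF R]] \<zeta>)+
  fix z
  show "amp_right S (amp_left T \<zeta>) z = amp_left T (amp_right S \<zeta>) z"
  proof (cases "z \<in> X \<times> Y")
    case True
    then obtain x y where z: "z = (x, y)" "x \<in> X" "y \<in> Y" by auto
    note dx = ell2_delta[OF z(2)] and dy = ell2_delta[OF z(3)] and d = ell2_delta[OF True]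
    have eq: "(\<lambda>y'. delta z (x', y')) = (\<lambda>y'. delta x x' * delta y y')"
      "(\<lambda>x'. delta z (x', y')) = (\<lambda>x'. delta y y' * delta x x')" for x' y'
      by (auto simp: z delta_def)
    have r: "amp_right S' (delta z) = (\<lambda>(x', y'). delta x x' * S' (delta y) y')"
      by (auto simp: dsum_def eq bounded_op_scale[OF adjointsD(2)[OF S] dy])
    have l: "amp_left T' (delta z) = (\<lambda>(x', y'). T' (delta x) x' * delta y y')"
      by (auto simp: amp_left_apply eq bounded_op_scale[OF adjointsD(2)[OF T] dx])
    have rl: "amp_left T' (amp_right S' (delta z)) = amp_right S' (amp_left T' (delta z))"
    proof (rule ext, clarify)
      fix x' y'
      have 1: "T' (\<lambda>i. delta x i * c) = (\<lambda>i. c * T' (delta x) i)" for c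
        using bounded_op_scale[OF adjointsD(2)[OF T] dx, of c] by (simp add: mult.commute)
      show "amp_left T' (amp_right S' (delta z)) (x', y') = amp_right S' (amp_left T' (delta z)) (x', y')"
        unfolding r l by (simp add: amp_left_apply dsum_def 1 bounded_op_scale[OF adjointsD(2)[OF S] dy])
    qed
    have "amp_right S (amp_left T \<zeta>) z = ell2_inner (amp_right S' (delta z)) (amp_left T \<zeta>)"
      unfolding adjointsD(3)[OF R d cl(1)] ell2_inner_delta ..
    also have "\<dots> = ell2_inner (amp_left T' (amp_right S' (delta z))) \<zeta>"
      by (rule adjointsD(3)[OF L bounded_op_closed[OF adjointsD(2)[OF R] d] \<zeta>, symmetric])
    also have "\<dots> = ell2_inner (amp_left T' (delta z)) (amp_right S \<zeta>)"
      unfolding rl by (rule adjointsD(3)[OF R bounded_op_closed[OF adjointsD(2)[OF L] d] \<zeta>])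
    also have "\<dots> = amp_left T (amp_right S \<zeta>) z"
      unfolding adjointsD(3)[OF L d cl(2)] ell2_inner_delta ..
    finally show ?thesis .
  qed (use ell2_support[OF cl(3)] ell2_support[OF cl(4)] in auto)
qed

text \<open>Taking adjoints reverses the product of \<open>T \<otimes> 1\<close> and
  \<open>1 \<otimes> S\<close>; since the two amplifications commute, the order can be
  restored.\<close>

lemma adjoints_op_tensor:
  assumes T: "adjoints X T T'" and S: "adjoints Y S S'"
  shows "adjoints (X \<times> Y) (op_tensor T S) (op_tensor T' S')"
proof -
  note L = adjoints_amp_left[OF T, of Y] and R = adjoints_dsum[OF S order_refl, of X]
  note LR = adjoints_comp[OF L R]
  have eq: "amp_right S' (amp_left T' \<zeta>) = op_tensor T' S' \<zeta>" if "\<zeta> \<in> ell2 (X \<times> Y)" for \<zeta>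
    unfolding op_tensor_eq by (rule amp_left_amp_right_commute[OF adjoints_sym[OF T] adjoints_sym[OF S] that])
  have b: "bounded_op (X \<times> Y) (op_tensor T' S')"
    unfolding op_tensor_eq[abs_def]
    by (rule bounded_op_comp[OF adjointsD(2)[OF L] adjointsD(2)[OF R]])
  show ?thesis
    using LR eq b unfolding adjoints_def op_tensor_eq[of T S, abs_def] by simp
qed

lemma op_tensor_op_tensor:
  assumes T: "adjoints X T T'" and S: "adjoints Y S S'" and T1: "adjoints X T1 T1'" and S1: "adjoints Y S1 S1'"
    and \<zeta>: "\<zeta> \<in> ell2 (X \<times> Y)"
  shows "op_tensor T S (op_tensor T1 S1 \<zeta>) = op_tensor (\<lambda>\<xi>. T (T1 \<xi>)) (\<lambda>\<eta>. S (S1 \<eta>)) \<zeta>"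
proof -
  have R: "amp_right S1 \<zeta> \<in> ell2 (X \<times> Y)"
    by (rule dsum_closed[OF adjointsD(1)[OF S1] order_refl \<zeta>])
  have "op_tensor T S (op_tensor T1 S1 \<zeta>) = amp_left T (amp_left T1 (amp_right S (amp_right S1 \<zeta>)))"
    unfolding op_tensor_eq amp_left_amp_right_commute[OF T1 S R] ..
  also have "\<dots> = op_tensor (\<lambda>\<xi>. T (T1 \<xi>)) (\<lambda>\<eta>. S (S1 \<eta>)) \<zeta>"
    by (auto simp: op_tensor_eq amp_left_apply dsum_def)
  finally show ?thesis .
qed

lemma op_norm_op_tensor:
  assumes T: "bounded_op X T" and S: "bounded_op Y S"
  shows "op_norm (X \<times> Y) (op_tensor T S) \<le> op_norm X T * op_norm Y S"
proof (rule op_norm_leI)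
  fix \<zeta> assume \<zeta>: "\<zeta> \<in> ell2 (X \<times> Y)"
  have "ell2_norm (op_tensor T S \<zeta>) \<le> op_norm X T * ell2_norm (amp_right S \<zeta>)"
    unfolding op_tensor_eq by (rule ell2_norm_amp_left[OF T dsum_closed[OF S order_refl \<zeta>]])
  also have "\<dots> \<le> op_norm X T * (op_norm Y S * ell2_norm \<zeta>)"
    by (intro mult_left_mono ell2_norm_dsum[OF S order_refl \<zeta>] op_norm_nonneg[OF T])
  finally show "ell2_norm (op_tensor T S \<zeta>) \<le> op_norm X T * op_norm Y S * ell2_norm \<zeta>" by simp
qed (simp add: op_norm_nonneg[OF T] op_norm_nonneg[OF S])

text \<open>Representations satisfy their laws only on square-summable vectors, so the operators in
  question are not equal as functions and plain rewriting does not apply.\<close>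

lemma op_tensor_cong:
  assumes T: "\<And>\<xi>. \<xi> \<in> ell2 X \<Longrightarrow> T \<xi> = T1 \<xi>" "bounded_op X T" and S: "\<And>\<eta>. \<eta> \<in> ell2 Y \<Longrightarrow> S \<eta> = S1 \<eta>" "bounded_op Y S"
    and \<zeta>: "\<zeta> \<in> ell2 (X \<times> Y)"
  shows "op_tensor T S \<zeta> = op_tensor T1 S1 \<zeta>"
proof -
  have 1: "amp_right S \<zeta> = amp_right S1 \<zeta>"
    unfolding dsum_def S(1)[OF ell2_slice[OF \<zeta>]] ..
  show ?thesis
    unfolding op_tensor_eq 1[symmetric] amp_left_def
    using T(1)[OF ell2_slice[OF ell2_flip[OF dsum_closed[OF S(2) order_refl \<zeta>]]]] by (simp add: dsum_def)
qed

section \<open>The minimal tensor product\<close>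

definition tensor_rep ::
  "('a \<Rightarrow> ('i \<Rightarrow> complex) \<Rightarrow> ('i \<Rightarrow> complex)) \<Rightarrow> ('b \<Rightarrow> ('j \<Rightarrow> complex) \<Rightarrow> ('j \<Rightarrow> complex)) \<Rightarrow>
   ('a \<times> 'b) list \<Rightarrow> ('i \<times> 'j \<Rightarrow> complex) \<Rightarrow> ('i \<times> 'j \<Rightarrow> complex)" where
  "tensor_rep \<rho> \<sigma> t = (\<lambda>\<zeta> z. \<Sum>(a, b)\<leftarrow>t. op_tensor (\<rho> a) (\<sigma> b) \<zeta> z)"

lemma tensor_rep_Nil: "tensor_rep \<rho> \<sigma> [] \<zeta> = (\<lambda>_. 0)"
  by (simp add: tensor_rep_def)

lemma tensor_rep_Cons:
  "tensor_rep \<rho> \<sigma> ((a, b) # t) \<zeta> = (\<lambda>z. op_tensor (\<rho> a) (\<sigma> b) \<zeta> z + tensor_rep \<rho> \<sigma> t \<zeta> z)"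
  by (simp add: tensor_rep_def)

lemma tensor_rep_append:
  "tensor_rep \<rho> \<sigma> (s @ t) \<zeta> = (\<lambda>z. tensor_rep \<rho> \<sigma> s \<zeta> z + tensor_rep \<rho> \<sigma> t \<zeta> z)"
  by (simp add: tensor_rep_def)

lemma tensor_rep_single: "tensor_rep \<rho> \<sigma> [(a, b)] = op_tensor (\<rho> a) (\<sigma> b)"
  by (simp add: tensor_rep_def)

lemma alg_tensor_simps [simp]:
  "carrier (alg_tensor A B) = lists (carrier A \<times> carrier B)"
  "one (alg_tensor A B) = [(\<one>\<^bsub>A\<^esub>, \<one>\<^bsub>B\<^esub>)]" "zero (alg_tensor A B) = []" "add (alg_tensor A B) = (@)"
  "c \<odot>\<^bsub>alg_tensor A B\<^esub> t = map (\<lambda>(a, b). (c \<odot>\<^bsub>A\<^esub> a, b)) t"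
  "star (alg_tensor A B) = map (\<lambda>(a, b). (star A a, star B b))"
  "nrm (alg_tensor A B) = min_tensor_norm A B"
  by (simp_all add: alg_tensor_def)

lemma alg_tensor_mult_simps [simp]:
  "[] \<otimes>\<^bsub>alg_tensor A B\<^esub> t = []"
  "((a, b) # s) \<otimes>\<^bsub>alg_tensor A B\<^esub> t =
     map (\<lambda>(a', b'). (a \<otimes>\<^bsub>A\<^esub> a', b \<otimes>\<^bsub>B\<^esub> b')) t @ s \<otimes>\<^bsub>alg_tensor A B\<^esub> t"
  by (simp_all add: alg_tensor_def)

lemma star_carrier_alg_tensor:
  assumes "star_carrier A" "star_carrier B"
  shows "star_carrier (alg_tensor A B)"
proof -
  interpret A: star_carrier A by fact
  interpret B: star_carrier B by fact
  show ?thesis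
  proof
    fix s t assume st: "s \<in> carrier (alg_tensor A B)" "t \<in> carrier (alg_tensor A B)"
    then have t: "set t \<subseteq> carrier A \<times> carrier B" and s: "set s \<subseteq> carrier A \<times> carrier B"
      by auto
    have "set (s \<otimes>\<^bsub>alg_tensor A B\<^esub> t) \<subseteq> carrier A \<times> carrier B"
      using s
    proof (induction s)
      case (Cons z s)
      obtain a b where z: "z = (a, b)" "a \<in> carrier A" "b \<in> carrier B" using Cons.prems by auto
      have "(a \<otimes>\<^bsub>A\<^esub> fst p, b \<otimes>\<^bsub>B\<^esub> snd p) \<in> carrier A \<times> carrier B" if "p \<in> set t" for p
        using subsetD[OF t that] z by (cases p) simp
      then show ?case using Cons by (simp add: z image_subset_iff case_prod_beta)
    qed simp
    then show "s \<otimes>\<^bsub>alg_tensor A B\<^esub> t \<in> carrier (alg_tensor A B)"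
      by auto
    have "a \<in> carrier A \<and> b \<in> carrier B" if "(a, b) \<in> set s" for a b
      using s that by blast
    then show "star (alg_tensor A B) s \<in> carrier (alg_tensor A B)"
      "c \<odot>\<^bsub>alg_tensor A B\<^esub> s \<in> carrier (alg_tensor A B)" for c
      by (auto simp: case_prod_beta)
  qed auto
qed

locale tensor_representation =
  A: star_carrier A + B: star_carrier B + \<rho>: star_representation A X \<rho> + \<sigma>: star_representation B Y \<sigma>
  for A :: "('a, 'm) star_algebra_scheme" and B :: "('b, 'k) star_algebra_scheme"
    and X :: "'i set" and Y :: "'j set" and \<rho> \<sigma>
begin

abbreviation "AB \<equiv> alg_tensor A B"
abbreviation "\<Phi> \<equiv> tensor_rep \<rho> \<sigma>"

sublocale AB: star_carrier AB
  by (intro star_carrier_alg_tensor A.star_carrier_axioms B.star_carrier_axioms)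

lemma adjoints_elem:
  "a \<in> carrier A \<Longrightarrow> b \<in> carrier B \<Longrightarrow>
     adjoints (X \<times> Y) (op_tensor (\<rho> a) (\<sigma> b)) (op_tensor (\<rho> (star A a)) (\<sigma> (star B b)))"
  by (intro adjoints_op_tensor \<rho>.adjoints \<sigma>.adjoints A.star_closed B.star_closed)

lemma bounded_elem:
  "a \<in> carrier A \<Longrightarrow> b \<in> carrier B \<Longrightarrow> bounded_op (X \<times> Y) (op_tensor (\<rho> a) (\<sigma> b))"
  by (rule adjointsD(1)[OF adjoints_elem])

lemma mult_elem:
  assumes "a \<in> carrier A" "b \<in> carrier B" "a' \<in> carrier A" "b' \<in> carrier B" and \<zeta>: "\<zeta> \<in> ell2 (X \<times> Y)"
  shows "op_tensor (\<rho> (a \<otimes>\<^bsub>A\<^esub> a')) (\<sigma> (b \<otimes>\<^bsub>B\<^esub> b')) \<zeta> =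
    op_tensor (\<rho> a) (\<sigma> b) (op_tensor (\<rho> a') (\<sigma> b') \<zeta>)"
proof -
  have "op_tensor (\<rho> (a \<otimes>\<^bsub>A\<^esub> a')) (\<sigma> (b \<otimes>\<^bsub>B\<^esub> b')) \<zeta> =
      op_tensor (\<lambda>\<xi>. \<rho> a (\<rho> a' \<xi>)) (\<lambda>\<eta>. \<sigma> b (\<sigma> b' \<eta>)) \<zeta>"
    by (rule op_tensor_cong[of X _ _ Y])
       (use assms in \<open>auto intro!: \<rho>.mult \<sigma>.mult \<rho>.bounded \<sigma>.bounded\<close>)
  also have "\<dots> = op_tensor (\<rho> a) (\<sigma> b) (op_tensor (\<rho> a') (\<sigma> b') \<zeta>)"
    by (rule op_tensor_op_tensor[symmetric, OF \<rho>.adjoints \<sigma>.adjoints \<rho>.adjoints \<sigma>.adjoints])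
       (use assms in auto)
  finally show ?thesis .
qed

lemma smult_elem:
  assumes a: "a \<in> carrier A" and b: "b \<in> carrier B" and \<zeta>: "\<zeta> \<in> ell2 (X \<times> Y)"
  shows "op_tensor (\<rho> (c \<odot>\<^bsub>A\<^esub> a)) (\<sigma> b) \<zeta> = (\<lambda>z. c * op_tensor (\<rho> a) (\<sigma> b) \<zeta> z)"
  using \<rho>.smult[OF a ell2_column[OF dsum_closed[OF \<sigma>.bounded[OF b] order_refl \<zeta>]], of c]
  by (auto simp: op_tensor_eq amp_left_apply)

lemma smult_elem_right:
  assumes a: "a \<in> carrier A" and b: "b \<in> carrier B" and \<zeta>: "\<zeta> \<in> ell2 (X \<times> Y)"
  shows "op_tensor (\<rho> a) (\<sigma> (c \<odot>\<^bsub>B\<^esub> b)) \<zeta> = (\<lambda>z. c * op_tensor (\<rho> a) (\<sigma> b) \<zeta> z)"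
proof -
  have "amp_right (\<sigma> (c \<odot>\<^bsub>B\<^esub> b)) \<zeta> = (\<lambda>z. c * amp_right (\<sigma> b) \<zeta> z)"
    using \<sigma>.smult[OF b ell2_slice[OF \<zeta>]] by (auto simp: dsum_def)
  then show ?thesis
    unfolding op_tensor_eq
    using bounded_op_scale[OF bounded_op_amp_left[OF \<rho>.bounded[OF a]] dsum_closed[OF \<sigma>.bounded[OF b] order_refl \<zeta>]]
    by simp
qed

lemma add_elem_left:
  assumes a: "a \<in> carrier A" "a' \<in> carrier A" and b: "b \<in> carrier B" and \<zeta>: "\<zeta> \<in> ell2 (X \<times> Y)"
  shows "op_tensor (\<rho> (a \<oplus>\<^bsub>A\<^esub> a')) (\<sigma> b) \<zeta> = (\<lambda>z. op_tensor (\<rho> a) (\<sigma> b) \<zeta> z + op_tensor (\<rho> a') (\<sigma> b) \<zeta> z)"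
  using \<rho>.add[OF a ell2_column[OF dsum_closed[OF \<sigma>.bounded[OF b] order_refl \<zeta>]]]
  by (auto simp: op_tensor_eq amp_left_apply)

lemma add_elem_right:
  assumes a: "a \<in> carrier A" and b: "b \<in> carrier B" "b' \<in> carrier B" and \<zeta>: "\<zeta> \<in> ell2 (X \<times> Y)"
  shows "op_tensor (\<rho> a) (\<sigma> (b \<oplus>\<^bsub>B\<^esub> b')) \<zeta> = (\<lambda>z. op_tensor (\<rho> a) (\<sigma> b) \<zeta> z + op_tensor (\<rho> a) (\<sigma> b') \<zeta> z)"
proof -
  have "amp_right (\<sigma> (b \<oplus>\<^bsub>B\<^esub> b')) \<zeta> = (\<lambda>z. amp_right (\<sigma> b) \<zeta> z + amp_right (\<sigma> b') \<zeta> z)"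
    using \<sigma>.add[OF b ell2_slice[OF \<zeta>]] by (auto simp: dsum_def)
  then show ?thesis
    unfolding op_tensor_eq
    using bounded_op_add[OF bounded_op_amp_left[OF \<rho>.bounded[OF a]] dsum_closed[OF \<sigma>.bounded[OF b(1)] order_refl \<zeta>]
        dsum_closed[OF \<sigma>.bounded[OF b(2)] order_refl \<zeta>]] by simp
qed

lemma bounded_tensor_rep: "t \<in> carrier AB \<Longrightarrow> bounded_op (X \<times> Y) (\<Phi> t)"
proof (induction t)
  case (Cons z t)
  then show ?case
    by (cases z) (auto simp: tensor_rep_Cons[abs_def] intro!: bounded_op_plus bounded_elem)
qed (simp add: tensor_rep_Nil[abs_def] bounded_op_null)

lemma tensor_rep_closed: "t \<in> carrier AB \<Longrightarrow> \<zeta> \<in> ell2 (X \<times> Y) \<Longrightarrow> \<Phi> t \<zeta> \<in> ell2 (X \<times> Y)"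
  by (rule bounded_op_closed[OF bounded_tensor_rep])

lemma tensor_rep_mult_elem:
  assumes a: "a \<in> carrier A" and b: "b \<in> carrier B" and t: "t \<in> carrier AB" and \<zeta>: "\<zeta> \<in> ell2 (X \<times> Y)"
  shows "\<Phi> (map (\<lambda>(a', b'). (a \<otimes>\<^bsub>A\<^esub> a', b \<otimes>\<^bsub>B\<^esub> b')) t) \<zeta> = op_tensor (\<rho> a) (\<sigma> b) (\<Phi> t \<zeta>)"
  using t
proof (induction t)
  case Nil
  show ?case by (simp add: tensor_rep_Nil bounded_op_zero[OF bounded_elem[OF a b]])
next
  case (Cons z t)
  obtain a' b' where z: "z = (a', b')" "a' \<in> carrier A" "b' \<in> carrier B" and t: "t \<in> carrier AB"
    using Cons.prems by auto
  show ?case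
    using Cons.IH[OF t] bounded_op_add[OF bounded_elem[OF a b] bounded_op_closed[OF bounded_elem[OF z(2,3)] \<zeta>]
        tensor_rep_closed[OF t \<zeta>]]
    by (simp add: z tensor_rep_Cons mult_elem[OF a b z(2,3) \<zeta>])
qed

lemma representation_tensor_rep: "representation AB (X \<times> Y) \<Phi>"
  unfolding representation_def
proof (intro conjI ballI allI)
  fix s t \<zeta> c assume s: "s \<in> carrier AB" and t: "t \<in> carrier AB" and \<zeta>: "\<zeta> \<in> ell2 (X \<times> Y)"
  show "\<Phi> (s \<otimes>\<^bsub>AB\<^esub> t) \<zeta> = \<Phi> s (\<Phi> t \<zeta>)"
    using s
  proof (induction s)
    case (Cons z s)
    then show ?case using t \<zeta>
      by (cases z) (auto simp: tensor_rep_append tensor_rep_Cons tensor_rep_mult_elem)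
  qed (simp add: tensor_rep_Nil)
next
  fix t c \<zeta> assume t: "t \<in> carrier AB" and \<zeta>: "\<zeta> \<in> ell2 (X \<times> Y)"
  show "\<Phi> (c \<odot>\<^bsub>AB\<^esub> t) \<zeta> = (\<lambda>z. c * \<Phi> t \<zeta> z)"
    using t
  proof (induction t)
    case (Cons z t)
    then show ?case using \<zeta>
      by (cases z) (auto simp: tensor_rep_Cons smult_elem algebra_simps)
  qed (simp add: tensor_rep_Nil)
next
  fix t \<zeta> \<omega> assume t: "t \<in> carrier AB" and \<zeta>: "\<zeta> \<in> ell2 (X \<times> Y)" and \<omega>: "\<omega> \<in> ell2 (X \<times> Y)"
  show "ell2_inner (\<Phi> (star AB t) \<zeta>) \<omega> = ell2_inner \<zeta> (\<Phi> t \<omega>)"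
    using t
  proof (induction t)
    case (Cons z t)
    obtain a b where z: "z = (a, b)" "a \<in> carrier A" "b \<in> carrier B" and t: "t \<in> carrier AB"
      using Cons.prems by auto
    note adj = adjoints_elem[OF z(2,3)]
    have st: "star AB t \<in> carrier AB" using t by (rule AB.star_closed)
    have "ell2_inner (\<Phi> (star AB (z # t)) \<zeta>) \<omega> =
        ell2_inner (op_tensor (\<rho> (star A a)) (\<sigma> (star B b)) \<zeta>) \<omega> + ell2_inner (\<Phi> (star AB t) \<zeta>) \<omega>"
      using ell2_inner_add_left[OF bounded_op_closed[OF adjointsD(2)[OF adj] \<zeta>] \<omega> tensor_rep_closed[OF st \<zeta>]]
      by (simp add: z tensor_rep_Cons)
    also have "\<dots> = ell2_inner \<zeta> (op_tensor (\<rho> a) (\<sigma> b) \<omega>) + ell2_inner \<zeta> (\<Phi> t \<omega>)"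
      using adjointsD(3)[OF adj \<zeta> \<omega>] Cons.IH[OF t] by simp
    also have "\<dots> = ell2_inner \<zeta> (\<Phi> (z # t) \<omega>)"
      using ell2_inner_add_right[OF \<zeta> bounded_op_closed[OF adjointsD(1)[OF adj] \<omega>] tensor_rep_closed[OF t \<omega>]]
      by (simp add: z tensor_rep_Cons)
    finally show ?case .
  qed (simp add: tensor_rep_Nil)
qed (auto simp: bounded_tensor_rep tensor_rep_append simp del: alg_tensor_simps(1))

lemma op_norm_tensor_rep_le:
  assumes "\<And>a. a \<in> carrier A \<Longrightarrow> op_norm X (\<rho> a) \<le> nrm A a" "\<And>b. b \<in> carrier B \<Longrightarrow> op_norm Y (\<sigma> b) \<le> nrm B b"
    and "t \<in> carrier AB"
  shows "op_norm (X \<times> Y) (\<Phi> t) \<le> (\<Sum>(a, b)\<leftarrow>t. nrm A a * nrm B b)"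
  using assms(3)
proof (induction t)
  case (Cons z t)
  obtain a b where z: "z = (a, b)" "a \<in> carrier A" "b \<in> carrier B" and t: "t \<in> carrier AB"
    using Cons.prems by auto
  have "op_norm (X \<times> Y) (\<Phi> (z # t)) \<le> op_norm (X \<times> Y) (op_tensor (\<rho> a) (\<sigma> b)) + op_norm (X \<times> Y) (\<Phi> t)"
    unfolding z tensor_rep_Cons[abs_def] by (rule op_norm_plus_le[OF bounded_elem[OF z(2,3)] bounded_tensor_rep[OF t]])
  also have "op_norm (X \<times> Y) (op_tensor (\<rho> a) (\<sigma> b)) \<le> op_norm X (\<rho> a) * op_norm Y (\<sigma> b)"
    by (rule op_norm_op_tensor[OF \<rho>.bounded[OF z(2)] \<sigma>.bounded[OF z(3)]])
  also have "\<dots> \<le> nrm A a * nrm B b"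
    using assms(1)[OF z(2)] assms(2)[OF z(3)] op_norm_nonneg[OF \<rho>.bounded[OF z(2)]] op_norm_nonneg[OF \<sigma>.bounded[OF z(3)]]
    by (intro mult_mono) auto
  finally show ?case using Cons.IH[OF t] by (simp add: z)
qed (simp add: tensor_rep_Nil[abs_def] op_norm_null)

end

text \<open>The zero space carries a representation of every algebra. This keeps the families over
  which suprema are taken nonempty.\<close>

lemma representation_null: "representation A {} (\<lambda>_ _ _. 0)"
  unfolding representation_def by (simp add: bounded_op_null)

section \<open>The minimal tensor norm of two universal C*-algebras\<close>

locale tensor_of_universal =
  fixes R :: "'g free_star set" and R' :: "'h free_star set"
  assumes R: "bounding_rels R" and R': "bounding_rels R'"
begin

abbreviation "A \<equiv> universal_cstar R"
abbreviation "B \<equiv> universal_cstar R'"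
abbreviation "AB \<equiv> alg_tensor A B"

lemma star_carriers: "star_carrier A" "star_carrier B"
  unfolding universal_cstar_def
  using seminormed_star_algebra.star_carrier_completion[OF seminormed_free_star_algebra] R R' by auto

lemma tensor_representation:
  "representation A X \<rho> \<Longrightarrow> representation B Y \<sigma> \<Longrightarrow> tensor_representation A B X Y \<rho> \<sigma>"
  by (intro tensor_representation.intro star_representation.intro star_carriers)

text \<open>Contractivity of all representations makes the bound independent of
  \<open>\<rho>\<close> and \<open>\<sigma>\<close>; hence the supremum defining the minimal tensor
  norm is finite.\<close>

lemma op_norm_tensor_rep_le_sum:
  assumes "representation A X \<rho>" "representation B Y \<sigma>" "t \<in> carrier AB"
  shows "op_norm (X \<times> Y) (tensor_rep \<rho> \<sigma> t) \<le> (\<Sum>(a, b)\<leftarrow>t. nrm A a * nrm B b)"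
  by (rule tensor_representation.op_norm_tensor_rep_le[OF tensor_representation[OF assms(1,2)]])
     (use assms in \<open>auto intro: representation_contractive[OF R] representation_contractive[OF R']\<close>)

definition norms :: "('g universal_elem \<times> 'h universal_elem) list \<Rightarrow> real set" where
  "norms t = {op_norm (X \<times> Y) (tensor_rep \<rho> \<sigma> t) | X Y \<rho> \<sigma>.
     representation A (X :: 'g universal_elem set) \<rho> \<and> representation B (Y :: 'h universal_elem set) \<sigma>}"

lemma min_tensor_norm_eq: "min_tensor_norm A B t = Sup (norms t)"
  unfolding min_tensor_norm_def norms_def tensor_rep_def ..

lemma normsI:
  "representation A (X :: 'g universal_elem set) \<rho> \<Longrightarrow> representation B (Y :: 'h universal_elem set) \<sigma> \<Longrightarrow>
     op_norm (X \<times> Y) (tensor_rep \<rho> \<sigma> t) \<in> norms t"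
  unfolding norms_def by (rule CollectI, intro exI conjI, rule refl)

lemma normsE:
  assumes "r \<in> norms t"
  obtains X Y \<rho> \<sigma> where "representation A (X :: 'g universal_elem set) \<rho>"
    "representation B (Y :: 'h universal_elem set) \<sigma>" "r = op_norm (X \<times> Y) (tensor_rep \<rho> \<sigma> t)"
  using assms unfolding norms_def by (elim CollectE exE conjE)

lemma op_norm_le_min_tensor_norm:
  assumes "representation A (X :: 'g universal_elem set) \<rho>" "representation B (Y :: 'h universal_elem set) \<sigma>" "t \<in> carrier AB"
  shows "op_norm (X \<times> Y) (tensor_rep \<rho> \<sigma> t) \<le> min_tensor_norm A B t"
  unfolding min_tensor_norm_eq
proof (rule cSup_upper[OF normsI[OF assms(1,2)]], rule bdd_aboveI)
  fix r assume "r \<in> norms t"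
  then show "r \<le> (\<Sum>(a, b)\<leftarrow>t. nrm A a * nrm B b)"
    by (rule normsE) (simp only: op_norm_tensor_rep_le_sum[OF _ _ assms(3)])
qed

lemma min_tensor_norm_least:
  fixes c :: real
  assumes "\<And>X Y \<rho> \<sigma>. representation A (X :: 'g universal_elem set) \<rho> \<Longrightarrow>
    representation B (Y :: 'h universal_elem set) \<sigma> \<Longrightarrow> op_norm (X \<times> Y) (tensor_rep \<rho> \<sigma> t) \<le> c"
  shows "min_tensor_norm A B t \<le> c"
  unfolding min_tensor_norm_eq
proof (rule cSup_least)
  show "norms t \<noteq> {}" using normsI[OF representation_null representation_null] by (metis empty_iff)
  fix r assume "r \<in> norms t"
  then show "r \<le> c" by (rule normsE) (simp only: assms)
qed

lemma min_tensor_norm_le_sum: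
  "t \<in> carrier AB \<Longrightarrow> min_tensor_norm A B t \<le> (\<Sum>(a, b)\<leftarrow>t. nrm A a * nrm B b)"
  by (rule min_tensor_norm_least) (rule op_norm_tensor_rep_le_sum)

sublocale AB: seminormed_star_algebra AB
proof (rule seminormed_star_algebra_reps)
  let ?\<R> = "{(X \<times> Y, tensor_rep \<rho> \<sigma>) | X Y \<rho> \<sigma>.
    representation A (X :: 'g universal_elem set) \<rho> \<and> representation B (Y :: 'h universal_elem set) \<sigma>}"
  have mem: "(X \<times> Y, tensor_rep \<rho> \<sigma>) \<in> ?\<R>"
    if "representation A (X :: 'g universal_elem set) \<rho>" "representation B (Y :: 'h universal_elem set) \<sigma>" for X Y \<rho> \<sigma>
    by (rule CollectI, intro exI conjI, rule refl) (rule that)+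
  show "star_carrier AB" by (rule star_carrier_alg_tensor[OF star_carriers])
  show "?\<R> \<noteq> {}" using mem[OF representation_null representation_null] by (metis empty_iff)
  fix Z \<Phi> assume "(Z, \<Phi>) \<in> ?\<R>"
  then obtain X Y \<rho> \<sigma> where *: "Z = X \<times> Y" "\<Phi> = tensor_rep \<rho> \<sigma>"
    "representation A (X :: 'g universal_elem set) \<rho>" "representation B (Y :: 'h universal_elem set) \<sigma>"
    by (elim CollectE exE conjE Pair_inject)
  show "representation AB Z \<Phi>"
    unfolding * by (rule tensor_representation.representation_tensor_rep[OF tensor_representation[OF *(3,4)]])
  show "\<Phi> \<zero>\<^bsub>AB\<^esub> \<zeta> = (\<lambda>_. 0)" for \<zeta> unfolding * by (simp add: tensor_rep_Nil)
  show "op_norm Z (\<Phi> t) \<le> nrm AB t" if "t \<in> carrier AB" for t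
    unfolding * using op_norm_le_min_tensor_norm[OF *(3,4) that] by simp
next
  fix t and c :: real
  assume le: "\<And>Z \<Phi>. (Z, \<Phi>) \<in> {(X \<times> Y, tensor_rep \<rho> \<sigma>) | X Y \<rho> \<sigma>.
    representation A (X :: 'g universal_elem set) \<rho> \<and> representation B (Y :: 'h universal_elem set) \<sigma>} \<Longrightarrow>
    op_norm Z (\<Phi> t) \<le> c"
  have "min_tensor_norm A B t \<le> c"
    by (rule min_tensor_norm_least, rule le, rule CollectI, intro exI conjI, rule refl)
  then show "nrm AB t \<le> c" by simp
qed

end

section \<open>Representations of the free *-algebra\<close>

definition linear_ext :: "('g word \<Rightarrow> complex) \<Rightarrow> 'g free_star \<Rightarrow> complex" where
  "linear_ext f x = (\<Sum>w\<in>Poly_Mapping.keys x. Poly_Mapping.lookup x w * f w)"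

lemma linear_ext_superset:
  "finite K \<Longrightarrow> Poly_Mapping.keys x \<subseteq> K \<Longrightarrow> linear_ext f x = (\<Sum>w\<in>K. Poly_Mapping.lookup x w * f w)"
  unfolding linear_ext_def by (rule sum.mono_neutral_left) (auto simp: in_keys_iff)

lemma linear_ext_add: "linear_ext f (x + y) = linear_ext f x + linear_ext f y"
proof -
  let ?K = "Poly_Mapping.keys x \<union> Poly_Mapping.keys y"
  have "Poly_Mapping.keys (x + y) \<subseteq> ?K" by (rule keys_add)
  then show ?thesis
    by (simp add: linear_ext_superset[of ?K] lookup_add distrib_right sum.distrib)
qed

lemma linear_ext_single: "linear_ext f (Poly_Mapping.single w c) = c * f w"
  by (simp add: linear_ext_def)

lemma linear_ext_scale: "linear_ext f (free_scale c x) = c * linear_ext f x"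
  by (induction x rule: free_star_induct)
     (simp_all add: free_scale_simps free_scale_single linear_ext_single linear_ext_add algebra_simps,
      simp add: linear_ext_def)

fun letters :: "'g word \<Rightarrow> ('g \<times> bool) list" where
  "letters (Word ls) = ls"

lemma letters_plus: "letters (v + w) = letters v @ letters w"
  by (cases v; cases w) simp

lemma letters_star: "letters (word_star w) = rev (map (\<lambda>(g, b). (g, \<not> b)) (letters w))"
  by (cases w) simp

text \<open>The universal property of the free *-algebra in concrete form: an assignment of adjoint
  pairs of operators to the letters extends to a representation, with \<open>E\<close> as the image
  of 1.\<close>

locale letter_operators =
  fixes X :: "'i set" and L :: "'g \<times> bool \<Rightarrow> ('i \<Rightarrow> complex) \<Rightarrow> ('i \<Rightarrow> complex)"
    and E :: "('i \<Rightarrow> complex) \<Rightarrow> ('i \<Rightarrow> complex)"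
  assumes L: "\<And>g b. adjoints X (L (g, b)) (L (g, \<not> b))"
    and E: "adjoints X E E"
    and EE: "\<And>\<xi>. \<xi> \<in> ell2 X \<Longrightarrow> E (E \<xi>) = E \<xi>"
    and LE: "\<And>l \<xi>. \<xi> \<in> ell2 X \<Longrightarrow> L l (E \<xi>) = L l \<xi>"
    and EL: "\<And>l \<xi>. \<xi> \<in> ell2 X \<Longrightarrow> E (L l \<xi>) = L l \<xi>"
begin

text \<open>The empty word acts by the projection \<open>E\<close>, since the representation may be degenerate.\<close>

fun word_op :: "('g \<times> bool) list \<Rightarrow> ('i \<Rightarrow> complex) \<Rightarrow> ('i \<Rightarrow> complex)" where
  "word_op [] \<xi> = E \<xi>"
| "word_op (l # ls) \<xi> = L l (word_op ls \<xi>)"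

definition free_rep :: "'g free_star \<Rightarrow> ('i \<Rightarrow> complex) \<Rightarrow> ('i \<Rightarrow> complex)" where
  "free_rep x \<xi> = (\<lambda>i. linear_ext (\<lambda>w. word_op (letters w) \<xi> i) x)"

lemma L_bounded: "bounded_op X (L l)"
  using adjointsD(1)[OF L[of "fst l" "snd l"]] by simp

lemma word_op_bounded: "bounded_op X (word_op ls)"
proof (induction ls)
  case Nil
  have "word_op [] = E" by (simp add: fun_eq_iff)
  then show ?case using adjointsD(1)[OF E] by metis
next
  case (Cons l ls)
  have "word_op (l # ls) = (\<lambda>\<xi>. L l (word_op ls \<xi>))" by (simp add: fun_eq_iff)
  then show ?case using bounded_op_comp[OF L_bounded Cons] by metis
qed

lemma word_op_closed: "\<xi> \<in> ell2 X \<Longrightarrow> word_op ls \<xi> \<in> ell2 X"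
  by (rule bounded_op_closed[OF word_op_bounded])

lemma E_word_op: "\<xi> \<in> ell2 X \<Longrightarrow> E (word_op ls \<xi>) = word_op ls \<xi>"
  by (cases ls) (simp_all add: EE EL word_op_closed)

lemma word_op_append: "\<xi> \<in> ell2 X \<Longrightarrow> word_op (ls @ ls') \<xi> = word_op ls (word_op ls' \<xi>)"
  by (induction ls) (simp_all add: E_word_op)

lemma word_op_adjoint:
  assumes "\<xi> \<in> ell2 X" "\<eta> \<in> ell2 X"
  shows "ell2_inner (word_op (rev (map (\<lambda>(g, b). (g, \<not> b)) ls)) \<xi>) \<eta> = ell2_inner \<xi> (word_op ls \<eta>)"
  using assms
proof (induction ls arbitrary: \<xi>)
  case Nil
  then show ?case by (simp add: adjointsD(3)[OF E])
next
  case (Cons l ls)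
  obtain g b where l: "l = (g, b)" by (cases l)
  note wl = word_op_closed[OF Cons.prems(2), of ls]
  have Lc: "L (g, \<not> b) \<xi> \<in> ell2 X" by (rule bounded_op_closed[OF L_bounded Cons.prems(1)])
  have "ell2_inner (word_op (rev (map (\<lambda>(g, b). (g, \<not> b)) (l # ls))) \<xi>) \<eta> =
      ell2_inner (word_op (rev (map (\<lambda>(g, b). (g, \<not> b)) ls)) (L (g, \<not> b) \<xi>)) \<eta>"
    using Cons.prems by (simp add: l word_op_append LE)
  also have "\<dots> = ell2_inner (L (g, \<not> b) \<xi>) (word_op ls \<eta>)"
    by (rule Cons.IH[OF Lc Cons.prems(2)])
  also have "\<dots> = ell2_inner \<xi> (word_op (l # ls) \<eta>)"
    using adjointsD(3)[OF L Cons.prems(1) wl, of g b] by (simp add: l)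
  finally show ?case .
qed

lemma free_rep_zero: "free_rep 0 \<xi> = (\<lambda>_. 0)"
  by (simp add: free_rep_def linear_ext_def)

lemma free_rep_add: "free_rep (x + y) \<xi> = (\<lambda>i. free_rep x \<xi> i + free_rep y \<xi> i)"
  by (simp add: free_rep_def linear_ext_add)

lemma free_rep_scale: "free_rep (free_scale c x) \<xi> = (\<lambda>i. c * free_rep x \<xi> i)"
  by (simp add: free_rep_def linear_ext_scale)

lemma free_rep_single: "free_rep (Poly_Mapping.single w c) \<xi> = (\<lambda>i. c * word_op (letters w) \<xi> i)"
  by (simp add: free_rep_def linear_ext_single)

lemma free_rep_diff: "free_rep (x - y) \<xi> = (\<lambda>i. free_rep x \<xi> i - free_rep y \<xi> i)"
  using free_rep_add[of x "free_scale (-1) y" \<xi>] by (simp add: free_rep_scale) (simp add: free_scale_simps)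

lemma free_rep_sum: "free_rep (\<Sum>k\<in>K. x k) \<xi> = (\<lambda>i. \<Sum>k\<in>K. free_rep (x k) \<xi> i)"
  by (induction K rule: infinite_finite_induct) (simp_all add: free_rep_zero free_rep_add)

lemma free_rep_bounded: "bounded_op X (free_rep x)"
proof (induction x rule: free_star_induct)
  case zero
  show ?case by (simp add: free_rep_zero[abs_def] bounded_op_null)
next
  case (single w c)
  show ?case unfolding free_rep_single[abs_def] by (rule bounded_op_times[OF word_op_bounded])
next
  case (add x y)
  then show ?case unfolding free_rep_add[abs_def] by (rule bounded_op_plus)
qed

lemma free_rep_closed: "\<xi> \<in> ell2 X \<Longrightarrow> free_rep x \<xi> \<in> ell2 X"
  by (rule bounded_op_closed[OF free_rep_bounded])

lemma free_rep_mult: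
  assumes \<xi>: "\<xi> \<in> ell2 X"
  shows "free_rep (x * y) \<xi> = free_rep x (free_rep y \<xi>)"
proof (induction x rule: free_star_induct)
  case (single v c)
  show ?case
  proof (induction y rule: free_star_induct)
    case zero
    then show ?case by (simp add: free_rep_zero bounded_op_zero[OF free_rep_bounded])
  next
    case (single w d)
    then show ?case
      by (simp add: mult_single free_rep_single letters_plus word_op_append \<xi>
          bounded_op_scale[OF word_op_bounded word_op_closed[OF \<xi>]] mult.assoc)
  next
    case (add x y)
    then show ?case
      by (simp add: distrib_left free_rep_add
          bounded_op_add[OF free_rep_bounded free_rep_closed[OF \<xi>] free_rep_closed[OF \<xi>]])
  qed
qed (simp_all add: free_rep_zero free_rep_add distrib_right)

lemma representation_free_rep: "representation (free_star_algebra R) X free_rep"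
  unfolding representation_def
proof (simp add: free_rep_bounded free_rep_add free_rep_scale free_rep_mult, intro allI ballI)
  fix x \<xi> \<eta> assume \<xi>: "\<xi> \<in> ell2 X" and \<eta>: "\<eta> \<in> ell2 X"
  show "ell2_inner (free_rep (free_adj x) \<xi>) \<eta> = ell2_inner \<xi> (free_rep x \<eta>)"
  proof (induction x rule: free_star_induct)
    case zero
    show ?case by (simp add: free_adj_simps free_rep_zero)
  next
    case (single w c)
    show ?case
      by (simp add: free_adj_single free_rep_single ell2_inner_scale_left ell2_inner_scale_right
          letters_star word_op_adjoint[OF \<xi> \<eta>])
  next
    case (add x y)
    then show ?case
      using ell2_inner_add_left[OF free_rep_closed[OF \<xi>] \<eta> free_rep_closed[OF \<xi>], of "free_adj x" "free_adj y"]
        ell2_inner_add_right[OF \<xi> free_rep_closed[OF \<eta>] free_rep_closed[OF \<eta>], of x y]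
      by (simp add: free_adj_simps free_rep_add)
  qed
qed

lemma free_rep_one: "free_rep 1 \<xi> = E \<xi>"
  using free_rep_single[of "Word []" 1 \<xi>] by (simp add: single_Word_eq)

lemma free_rep_gen: "\<xi> \<in> ell2 X \<Longrightarrow> free_rep (gen g) \<xi> = L (g, False) \<xi>"
  by (simp add: gen_def free_rep_single LE)

lemma free_rep_adj_gen: "\<xi> \<in> ell2 X \<Longrightarrow> free_rep (free_adj (gen g)) \<xi> = L (g, True) \<xi>"
  by (simp add: gen_def free_adj_single free_rep_single LE)

end

section \<open>Shifted diagonal projections\<close>

definition shift :: "int \<Rightarrow> (int \<times> 'i \<Rightarrow> complex) \<Rightarrow> (int \<times> 'i \<Rightarrow> complex)" where
  "shift k \<zeta> = (\<lambda>(n, l). \<zeta> (n - k, l))"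

lemma shift_reindex: "shift k \<zeta> = \<zeta> \<circ> (\<lambda>(n, l). (n - k, l))"
  by (auto simp: shift_def)

lemma bij_shift: "bij (\<lambda>(n, l). (n - k :: int, l))"
  by (rule o_bij[where g = "\<lambda>(n, l). (n + k, l)"]) auto

lemma ell2_norm_shift: "ell2_norm (shift k \<zeta>) = ell2_norm \<zeta>"
  unfolding ell2_norm_def shift_reindex comp_def
  by (subst infsum_reindex_bij_betw[OF bij_shift, of "\<lambda>z. (cmod (\<zeta> z))\<^sup>2"]) simp

lemma ell2_inner_shift: "ell2_inner (shift k \<zeta>) (shift k \<omega>) = ell2_inner \<zeta> \<omega>"
  unfolding ell2_inner_def shift_reindex comp_def
  by (subst infsum_reindex_bij_betw[OF bij_shift, of "\<lambda>z. cnj (\<zeta> z) * \<omega> z"]) simp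

lemma ell2_shift:
  assumes "\<zeta> \<in> ell2 (UNIV \<times> Y)"
  shows "shift k \<zeta> \<in> ell2 (UNIV \<times> Y)"
proof -
  have "(\<lambda>z. (cmod (shift k \<zeta> z))\<^sup>2) summable_on UNIV"
    using summable_on_reindex_bij_betw[OF bij_shift, of "\<lambda>z. (cmod (\<zeta> z))\<^sup>2" k] ell2_summable[OF assms]
    by (simp add: shift_reindex o_def)
  then show ?thesis
    unfolding ell2_def using assms
    by (auto simp: shift_def ell2_support intro: summable_on_subset_banach)
qed

lemma adjoints_shift: "adjoints (UNIV \<times> Y) (shift k) (shift (- k))"
proof (rule adjointsI)
  have b: "bounded_op (UNIV \<times> Y) (shift k)" for k
    by (rule bounded_opI[where C = 1]) (auto simp: ell2_shift ell2_norm_shift, auto simp: shift_def)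
  show "bounded_op (UNIV \<times> Y) (shift k)" "bounded_op (UNIV \<times> Y) (shift (- k))" by (rule b)+
  fix \<zeta> \<omega> :: "int \<times> 'a \<Rightarrow> complex"
  have "shift k (shift (- k) \<zeta>) = \<zeta>" by (auto simp: shift_def)
  then show "ell2_inner (shift (- k) \<zeta>) \<omega> = ell2_inner \<zeta> (shift k \<omega>)"
    using ell2_inner_shift[of k "shift (- k) \<zeta>" \<omega>] by simp
qed

text \<open>The C*-identity makes the norm equal to its own square, so it is 0 or 1.\<close>

lemma op_norm_projection:
  assumes "adjoints X T T" "\<And>\<xi>. \<xi> \<in> ell2 X \<Longrightarrow> T (T \<xi>) = T \<xi>"
  shows "op_norm X T \<le> 1"
proof -
  have "(op_norm X T)\<^sup>2 = op_norm X T"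
    using op_norm_cstar[OF assms(1)] op_norm_cong[of X "\<lambda>\<xi>. T (T \<xi>)" T] assms(2) by simp
  then show ?thesis by (metis mult_cancel_left2 order_refl power2_eq_square zero_le_one)
qed

definition slice :: "int \<Rightarrow> (int \<times> 'i \<Rightarrow> complex) \<Rightarrow> 'i \<Rightarrow> complex" where
  "slice n \<zeta> = (\<lambda>l. \<zeta> (n, l))"

lemma slice_eqI: "(\<And>n. slice n \<zeta> = slice n \<omega>) \<Longrightarrow> \<zeta> = \<omega>"
  by (auto simp: slice_def fun_eq_iff)

lemma slice_closed: "\<zeta> \<in> ell2 (UNIV \<times> Y) \<Longrightarrow> slice n \<zeta> \<in> ell2 Y"
  unfolding slice_def by (rule ell2_slice)

text \<open>Magic unitaries \<open>\<kappa> n\<close> (\<open>n \<in> \<int>\<close>), with entries of \<open>\<kappa> m\<close> and \<open>\<kappa> n\<close> commuting for \<open>m \<noteq> n\<close>. On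
  \<open>\<ell>\<^sup>2(\<int>) \<otimes> \<ell>\<^sup>2(Y)\<close> let \<open>v b = (\<Oplus>n. \<kappa> n b) \<circ> shift\<close>. Then \<open>v b (v b)*\<close> acts on the \<open>n\<close>-th summand by
  \<open>\<kappa> n b\<close> and \<open>(v b)* v b\<close> by \<open>\<kappa> (n + 1) b\<close>, and a word of length \<open>k\<close> in the \<open>v b\<close> is the \<open>k\<close>-fold
  shift times a product of projections \<open>\<kappa> m b\<close> with different \<open>m\<close>.\<close>

locale shifted_projections =
  fixes Y :: "'i set" and \<kappa> :: "int \<Rightarrow> 'n::finite \<times> 'n \<Rightarrow> ('i \<Rightarrow> complex) \<Rightarrow> ('i \<Rightarrow> complex)"
    and e :: "('i \<Rightarrow> complex) \<Rightarrow> ('i \<Rightarrow> complex)"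
  assumes adj: "\<And>n b. adjoints Y (\<kappa> n b) (\<kappa> n b)" "adjoints Y e e"
    and idem: "\<And>n b \<xi>. \<xi> \<in> ell2 Y \<Longrightarrow> \<kappa> n b (\<kappa> n b \<xi>) = \<kappa> n b \<xi>" "\<And>\<xi>. \<xi> \<in> ell2 Y \<Longrightarrow> e (e \<xi>) = e \<xi>"
    and unit: "\<And>n b \<xi>. \<xi> \<in> ell2 Y \<Longrightarrow> \<kappa> n b (e \<xi>) = \<kappa> n b \<xi>" "\<And>n b \<xi>. \<xi> \<in> ell2 Y \<Longrightarrow> e (\<kappa> n b \<xi>) = \<kappa> n b \<xi>"
    and commute: "\<And>m n b c \<xi>. m \<noteq> n \<Longrightarrow> \<xi> \<in> ell2 Y \<Longrightarrow> \<kappa> m b (\<kappa> n c \<xi>) = \<kappa> n c (\<kappa> m b \<xi>)"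
    and row: "\<And>n i \<xi> l. \<xi> \<in> ell2 Y \<Longrightarrow> (\<Sum>j\<in>UNIV. \<kappa> n (i, j) \<xi> l) = e \<xi> l"
    and col: "\<And>n j \<xi> l. \<xi> \<in> ell2 Y \<Longrightarrow> (\<Sum>i\<in>UNIV. \<kappa> n (i, j) \<xi> l) = e \<xi> l"
begin

abbreviation "Z \<equiv> (UNIV :: int set) \<times> Y"

definition letter :: "('n \<times> 'n) \<times> bool \<Rightarrow> (int \<times> 'i \<Rightarrow> complex) \<Rightarrow> (int \<times> 'i \<Rightarrow> complex)" where
  "letter l = (if snd l then (\<lambda>\<zeta>. shift (-1) (dsum (\<lambda>n. \<kappa> n (fst l)) \<zeta>))
     else (\<lambda>\<zeta>. dsum (\<lambda>n. \<kappa> n (fst l)) (shift 1 \<zeta>)))"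

text \<open>A generator raises the level by one and then applies \<open>\<kappa>\<close> of the
  level of arrival. Its adjoint applies \<open>\<kappa>\<close> of the level of departure and then
  lowers the level. This off-by-one separates range and source projections.\<close>

lemma slice_letter:
  "slice n (letter (b, False) \<zeta>) = \<kappa> n b (slice (n - 1) \<zeta>)"
  "slice n (letter (b, True) \<zeta>) = \<kappa> (n + 1) b (slice (n + 1) \<zeta>)"
  by (simp_all add: letter_def slice_def shift_def dsum_def)

lemma slice_e: "slice n (dsum (\<lambda>_. e) \<zeta>) = e (slice n \<zeta>)"
  by (simp add: slice_def dsum_def)

lemma \<kappa>_closed: "\<xi> \<in> ell2 Y \<Longrightarrow> \<kappa> n b \<xi> \<in> ell2 Y"
  by (rule bounded_op_closed[OF adjointsD(1)[OF adj(1)]])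

lemma adjoints_\<kappa>: "adjoints Z (dsum (\<lambda>n. \<kappa> n b)) (dsum (\<lambda>n. \<kappa> n b))"
  by (rule adjoints_dsum[OF adj(1) op_norm_projection[OF adj(1) idem(1)]])

lemma adjoints_letter: "adjoints Z (letter (b, False)) (letter (b, True))"
  unfolding letter_def using adjoints_comp[OF adjoints_\<kappa> adjoints_shift] by simp

sublocale letter_operators Z letter "dsum (\<lambda>_. e)"
proof
  show "adjoints Z (letter (b, c)) (letter (b, \<not> c))" for b c
    using adjoints_letter[of b] adjoints_sym[OF adjoints_letter[of b]] by (cases c) auto
  show "adjoints Z (dsum (\<lambda>_. e)) (dsum (\<lambda>_. e))"
    by (rule adjoints_dsum[OF adj(2) op_norm_projection[OF adj(2) idem(2)]])
  fix \<zeta> assume \<zeta>: "\<zeta> \<in> ell2 Z"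
  note s = slice_closed[OF \<zeta>]
  show "dsum (\<lambda>_. e) (dsum (\<lambda>_. e) \<zeta>) = dsum (\<lambda>_. e) \<zeta>"
    by (rule slice_eqI) (simp add: slice_e idem s)
  fix l :: "('n \<times> 'n) \<times> bool"
  obtain b c where l: "l = (b, c)" by (cases l)
  show "letter l (dsum (\<lambda>_. e) \<zeta>) = letter l \<zeta>"
    by (rule slice_eqI, cases c) (simp_all add: l slice_letter slice_e unit s)
  show "dsum (\<lambda>_. e) (letter l \<zeta>) = letter l \<zeta>"
    by (rule slice_eqI, cases c) (simp_all add: l slice_letter slice_e unit s)
qed

abbreviation "p b \<equiv> gen b * free_adj (gen b)"
abbreviation "q b \<equiv> free_adj (gen b) * gen b"

lemma slice_p: "\<zeta> \<in> ell2 Z \<Longrightarrow> slice n (free_rep (p b) \<zeta>) = \<kappa> n b (slice n \<zeta>)"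
  by (simp add: free_rep_mult free_rep_gen free_rep_adj_gen slice_letter slice_closed idem
      bounded_op_closed[OF L_bounded])

lemma slice_q: "\<zeta> \<in> ell2 Z \<Longrightarrow> slice n (free_rep (q b) \<zeta>) = \<kappa> (n + 1) b (slice n \<zeta>)"
  by (simp add: free_rep_mult free_rep_gen free_rep_adj_gen slice_letter slice_closed idem
      bounded_op_closed[OF L_bounded])

text \<open>The induction carries more than the partial isometry property: at level \<open>n\<close>
  the operator of \<open>x x*\<close> involves only \<open>\<kappa> n\<close>,
  \<open>\<kappa> (n - 1)\<close> and so on, hence commutes with every \<open>\<kappa> m\<close> for
  \<open>n < m\<close>. The source projection \<open>q b\<close> of a new letter acts at level
  \<open>n\<close> by \<open>\<kappa> (n + 1) b\<close>, so it commutes with \<open>x x*\<close>.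
  Therefore \<open>b x x* q x = b q x x* x = b q x = b x\<close>, writing \<open>b\<close> for the
  generator and \<open>q\<close> for \<open>q b\<close>.\<close>

lemma word_partial_isometry:
  fixes w :: "('n \<times> 'n) list"
  defines "x \<equiv> prod_list (map gen w)"
  shows "(\<exists>R. (\<forall>n \<zeta>. \<zeta> \<in> ell2 Z \<longrightarrow> slice n (free_rep (x * free_adj x) \<zeta>) = R n (slice n \<zeta>)) \<and>
        (\<forall>n \<xi>. \<xi> \<in> ell2 Y \<longrightarrow> R n \<xi> \<in> ell2 Y) \<and>
        (\<forall>m n c \<xi>. n < m \<longrightarrow> \<xi> \<in> ell2 Y \<longrightarrow> R n (\<kappa> m c \<xi>) = \<kappa> m c (R n \<xi>))) \<and>
      (\<forall>\<zeta>\<in>ell2 Z. free_rep (x * free_adj x * x) \<zeta> = free_rep x \<zeta>)"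
  unfolding x_def
proof (induction w)
  case Nil
  have "e \<xi> \<in> ell2 Y" if "\<xi> \<in> ell2 Y" for \<xi> by (rule bounded_op_closed[OF adjointsD(1)[OF adj(2)] that])
  then show ?case by (auto simp: free_rep_one slice_e unit intro!: exI[of _ "\<lambda>_. e"])
next
  case (Cons b w)
  define x where "x = prod_list (map gen w)"
  obtain R where R: "\<And>n \<zeta>. \<zeta> \<in> ell2 Z \<Longrightarrow> slice n (free_rep (x * free_adj x) \<zeta>) = R n (slice n \<zeta>)"
    "\<And>n \<xi>. \<xi> \<in> ell2 Y \<Longrightarrow> R n \<xi> \<in> ell2 Y"
    "\<And>m n c \<xi>. n < m \<Longrightarrow> \<xi> \<in> ell2 Y \<Longrightarrow> R n (\<kappa> m c \<xi>) = \<kappa> m c (R n \<xi>)"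
    and pi: "\<And>\<zeta>. \<zeta> \<in> ell2 Z \<Longrightarrow> free_rep (x * free_adj x * x) \<zeta> = free_rep x \<zeta>"
    using Cons unfolding x_def by blast
  \<comment> \<open>Conjugating by the new letter lowers the level by one, applies the old operator
    there and returns, with \<open>\<kappa> n b\<close> on both sides.\<close>
  define R' where "R' n \<xi> = \<kappa> n b (R (n - 1) (\<kappa> n b \<xi>))" for n \<xi>
  have y: "gen b * x * free_adj (gen b * x) = gen b * (x * free_adj x) * free_adj (gen b)"
    by (simp add: free_adj_mult mult.assoc)
  note cl = free_rep_closed bounded_op_closed[OF L_bounded] slice_closed \<kappa>_closed R(2)
  have "slice n (free_rep (gen b * x * free_adj (gen b * x)) \<zeta>) = R' n (slice n \<zeta>)" if \<zeta>: "\<zeta> \<in> ell2 Z" for n \<zeta>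
  proof -
    have l: "letter (b, True) \<zeta> \<in> ell2 Z" by (rule bounded_op_closed[OF L_bounded \<zeta>])
    have "free_rep (gen b * x * free_adj (gen b * x)) \<zeta> =
        letter (b, False) (free_rep (x * free_adj x) (letter (b, True) \<zeta>))"
      unfolding y free_rep_mult[OF \<zeta>] free_rep_adj_gen[OF \<zeta>]
        free_rep_mult[OF l, of "gen b"] free_rep_gen[OF free_rep_closed[OF l]] ..
    then show ?thesis by (simp add: slice_letter R(1)[OF l] R'_def)
  qed
  moreover have "R' n \<xi> \<in> ell2 Y" if "\<xi> \<in> ell2 Y" for n \<xi>
    unfolding R'_def by (intro \<kappa>_closed R(2) that)
  \<comment> \<open>As \<open>n - 1 < n < m\<close>, \<open>\<kappa> m c\<close> passes
    \<open>\<kappa> n b\<close> because the levels differ and \<open>R (n - 1)\<close> by the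
    induction hypothesis.\<close>
  moreover have "R' n (\<kappa> m c \<xi>) = \<kappa> m c (R' n \<xi>)" if "n < m" and \<xi>: "\<xi> \<in> ell2 Y" for m n c \<xi>
  proof -
    have "R' n (\<kappa> m c \<xi>) = \<kappa> n b (R (n - 1) (\<kappa> m c (\<kappa> n b \<xi>)))"
      using that by (simp add: R'_def commute[of n m])
    also have "\<dots> = \<kappa> n b (\<kappa> m c (R (n - 1) (\<kappa> n b \<xi>)))"
      using that by (simp add: R(3) \<kappa>_closed)
    also have "\<dots> = \<kappa> m c (R' n \<xi>)"
      unfolding R'_def using that by (intro commute \<kappa>_closed R(2)) auto
    finally show ?thesis .
  qed
  moreover have "free_rep (gen b * x * free_adj (gen b * x) * (gen b * x)) \<zeta> = free_rep (gen b * x) \<zeta>"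
    if \<zeta>: "\<zeta> \<in> ell2 Z" for \<zeta>
  proof -
    define \<eta> where "\<eta> = free_rep x \<zeta>"
    have \<eta>: "\<eta> \<in> ell2 Z" unfolding \<eta>_def by (rule free_rep_closed[OF \<zeta>])
    have x\<eta>: "free_rep (x * free_adj x) \<eta> = \<eta>"
      unfolding \<eta>_def using pi[OF \<zeta>] free_rep_mult[OF \<zeta>] by simp
    have q\<eta>: "free_rep (q b) \<eta> \<in> ell2 Z" by (rule free_rep_closed[OF \<eta>])
    \<comment> \<open>The vector \<open>\<eta>\<close> lies in the range of \<open>x\<close>, where
      \<open>x x*\<close> acts as the identity. Commutation then shows that \<open>q b\<close> does
      not leave the vectors fixed by \<open>x x*\<close>.\<close>
    have "R n (slice n \<eta>) = slice n \<eta>" for n using R(1)[OF \<eta>] x\<eta> by simp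
    then have qx: "free_rep (x * free_adj x) (free_rep (q b) \<eta>) = free_rep (q b) \<eta>"
      by (intro slice_eqI) (simp add: R(1)[OF q\<eta>] slice_q[OF \<eta>] R(3)[OF _ slice_closed[OF \<eta>]])
    have "gen b * x * free_adj (gen b * x) * (gen b * x) = gen b * ((x * free_adj x) * (q b * x))"
      by (simp add: free_adj_mult mult.assoc)
    then have "free_rep (gen b * x * free_adj (gen b * x) * (gen b * x)) \<zeta> =
        free_rep (gen b) (free_rep (x * free_adj x) (free_rep (q b) \<eta>))"
      using \<zeta> by (simp only: free_rep_mult[OF \<zeta>, of "gen b"] free_rep_mult[OF \<zeta>, of "x * free_adj x"]
          free_rep_mult[OF \<zeta>, of "q b"] \<eta>_def)
    also have "\<dots> = free_rep (gen b) \<eta>"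
      unfolding qx by (rule slice_eqI)
        (simp add: free_rep_gen[OF q\<eta>] free_rep_gen[OF \<eta>] slice_letter slice_q[OF \<eta>] idem slice_closed[OF \<eta>])
    also have "\<dots> = free_rep (gen b * x) \<zeta>"
      unfolding \<eta>_def free_rep_mult[OF \<zeta>] ..
    finally show ?thesis .
  qed
  ultimately show ?case unfolding x_def[symmetric] list.map prod_list.Cons by blast
qed

lemma free_rep_G_rels:
  assumes r: "r \<in> G_rels" and \<zeta>: "\<zeta> \<in> ell2 Z"
  shows "free_rep r \<zeta> = (\<lambda>_. 0)"
proof -
  have w: "free_rep (partial_isometry_rel (prod_list (map gen w))) \<zeta> = (\<lambda>_. 0)" for w
    using word_partial_isometry[of w] \<zeta> by (simp add: partial_isometry_rel_def free_rep_diff)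
  have proj: "free_rep (p b * p b) \<zeta> = free_rep (p b) \<zeta>" "free_rep (q b * q b) \<zeta> = free_rep (q b) \<zeta>" for b
    unfolding free_rep_mult[OF \<zeta>, of "p b"] free_rep_mult[OF \<zeta>, of "q b"]
    by (rule slice_eqI, simp add: slice_p slice_q free_rep_closed \<zeta> idem slice_closed[OF \<zeta>])+
  have slice_sum: "slice n (\<lambda>z. \<Sum>k\<in>UNIV. f k z) = (\<lambda>l. \<Sum>k\<in>UNIV. slice n (f k) l)" for n and f :: "'n \<Rightarrow> _"
    by (simp add: slice_def)
  have sums: "free_rep (\<Sum>j\<in>UNIV. p (i, j)) \<zeta> = dsum (\<lambda>_. e) \<zeta>" "free_rep (\<Sum>i\<in>UNIV. p (i, j)) \<zeta> = dsum (\<lambda>_. e) \<zeta>"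
    "free_rep (\<Sum>j\<in>UNIV. q (i, j)) \<zeta> = dsum (\<lambda>_. e) \<zeta>" "free_rep (\<Sum>i\<in>UNIV. q (i, j)) \<zeta> = dsum (\<lambda>_. e) \<zeta>" for i j
    by (rule slice_eqI, unfold free_rep_sum slice_sum slice_e slice_p[OF \<zeta>] slice_q[OF \<zeta>],
        simp add: row col slice_closed[OF \<zeta>])+
  have rels: "free_rep (a - c) \<zeta> = (\<lambda>_. 0)" if "free_rep a \<zeta> = free_rep c \<zeta>" for a c
    using that by (simp add: free_rep_diff)
  have sadj: "free_adj (p b) = p b" "free_adj (q b) = q b" for b
    by (simp_all add: free_adj_mult free_adj_simps)
  have magic: "free_rep r \<zeta> = (\<lambda>_. 0)"
    if "r \<in> magic_unitary_rels (\<lambda>i j. p (i, j)) \<or> r \<in> magic_unitary_rels (\<lambda>i j. q (i, j))"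
    using that unfolding magic_unitary_rels_def projection_rels_def
    by (auto simp: sadj free_rep_zero intro!: rels) (simp_all add: proj sums free_rep_one)
  have case_prod_gen: "(\<lambda>(i, j). gen (i, j)) = (gen :: 'n \<times> 'n \<Rightarrow> _)" by auto
  consider (gen) i j where "r = partial_isometry_rel (gen (i, j))"
    | (magic) "r \<in> magic_unitary_rels (\<lambda>i j. p (i, j)) \<or> r \<in> magic_unitary_rels (\<lambda>i j. q (i, j))"
    | (pres) "r \<in> preserves_rels (\<lambda>i j. p (i, j)) pf_vector \<or> r \<in> preserves_rels (\<lambda>i j. q (i, j)) pf_vector"
    | (inter) "r \<in> intertwines_rels ones_matrix (\<lambda>i j. p (i, j)) (\<lambda>i j. q (i, j))"
    | (word) w where "r = partial_isometry_rel (prod_list (map gen w))"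
    using r unfolding G_rels_def Let_def case_prod_gen by blast
  then show ?thesis
  proof cases
    case gen
    then show ?thesis using w[of "[(i, j)]"] by simp
  next
    \<comment> \<open>The Perron-Frobenius vector is constant, so these relations are row sums once
      more.\<close>
    case pres
    then show ?thesis
      by (auto simp: preserves_rels_def pf_vector_def free_scale_simps sums free_rep_one intro!: rels)
  next
    \<comment> \<open>Every entry of \<open>1 p\<close> is a column sum of \<open>p\<close> and
      every entry of \<open>q 1\<close> is a row sum of \<open>q\<close>; both act as the
      unit.\<close>
    case inter
    then show ?thesis
      by (auto simp: intertwines_rels_def ones_matrix_def free_scale_simps sums intro!: rels)
  qed (use w magic in auto)
qed

lemma op_norm_free_rep_le: "op_norm Z (free_rep x) \<le> universal_seminorm G_rels x"
proof (rule le_universal_seminorm[OF bounding_G_rels])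
  show "cstar_seminorm (\<lambda>x. op_norm Z (free_rep x))"
    by (rule cstar_seminorm_representation[OF representation_free_rep])
  show "op_norm Z (free_rep r) = 0" if "r \<in> G_rels" for r
    using op_norm_cong[of Z "free_rep r" "\<lambda>_ _. 0"] free_rep_G_rels[OF that] op_norm_null by metis
qed

text \<open>A vector placed at level \<open>n\<close> and extended by 0 keeps its norm, and
  restricting the result to level \<open>n\<close> does not increase the norm.\<close>

lemma op_norm_slice_le:
  assumes T: "\<And>\<zeta>. \<zeta> \<in> ell2 Z \<Longrightarrow> slice n (free_rep x \<zeta>) = T (slice n \<zeta>)"
  shows "op_norm Y T \<le> op_norm Z (free_rep x)"
proof (rule op_norm_leI[OF op_norm_nonneg[OF free_rep_bounded]])
  fix \<xi> assume \<xi>: "\<xi> \<in> ell2 Y"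
  define \<zeta> where "\<zeta> = (\<lambda>(m, l). if m = n then \<xi> l else 0)"
  have le: "(\<Sum>z\<in>F. (cmod (\<zeta> z))\<^sup>2) \<le> (ell2_norm \<xi>)\<^sup>2" if F: "finite F" for F
  proof -
    have "(\<Sum>z\<in>F. (cmod (\<zeta> z))\<^sup>2) \<le> (\<Sum>z\<in>F \<union> Pair n ` snd ` F. (cmod (\<zeta> z))\<^sup>2)"
      using F by (intro sum_mono2) auto
    also have "\<dots> = (\<Sum>z\<in>Pair n ` snd ` F. (cmod (\<zeta> z))\<^sup>2)"
      using F by (intro sum.mono_neutral_right) (auto simp: \<zeta>_def image_iff split: if_splits, metis snd_conv)
    also have "\<dots> = (\<Sum>l\<in>snd ` F. (cmod (\<xi> l))\<^sup>2)"
      by (simp add: sum.reindex inj_on_def \<zeta>_def)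
    also have "\<dots> \<le> (ell2_norm \<xi>)\<^sup>2" using F by (intro sum_le_ell2_norm[OF \<xi>]) auto
    finally show ?thesis .
  qed
  have \<zeta>: "\<zeta> \<in> ell2 Z" "ell2_norm \<zeta> \<le> ell2_norm \<xi>"
    using ell2I[of Z \<zeta>, OF _ le] by (auto simp: \<zeta>_def ell2_support[OF \<xi>])
  have "slice n \<zeta> = \<xi>" by (simp add: slice_def \<zeta>_def)
  then have "ell2_norm (T \<xi>) = ell2_norm (slice n (free_rep x \<zeta>))" using T[OF \<zeta>(1)] by simp
  also have "\<dots> \<le> ell2_norm (free_rep x \<zeta>)"
    using sum_slices_le[OF free_rep_closed[OF \<zeta>(1)], of "{n}"] by (simp add: slice_def power2_le_iff_abs_le)
  also have "\<dots> \<le> op_norm Z (free_rep x) * ell2_norm \<zeta>"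
    by (rule op_norm_bound[OF free_rep_bounded \<zeta>(1)])
  also have "\<dots> \<le> op_norm Z (free_rep x) * ell2_norm \<xi>"
    by (intro mult_left_mono \<zeta>(2) op_norm_nonneg[OF free_rep_bounded])
  finally show "ell2_norm (T \<xi>) \<le> op_norm Z (free_rep x) * ell2_norm \<xi>" .
qed

end

section \<open>Lifting with norm control\<close>

text \<open>\<open>D\<close> will be the polynomials in the range and source projections,
  \<open>p\<close> their norm in C(G), and \<open>s\<close> the norm of their image in the tensor
  product. The C*-identity is used for \<open>p\<close> only; for \<open>s\<close> it is enough to
  be submultiplicative and compatible with the adjoint.\<close>

locale dominated_seminorm =
  fixes p s :: "'g free_star \<Rightarrow> real" and D :: "'g free_star set"
  assumes p: "cstar_seminorm p"
    and D_one: "1 \<in> D" and D_add: "x \<in> D \<Longrightarrow> y \<in> D \<Longrightarrow> x + y \<in> D"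
    and D_mult: "x \<in> D \<Longrightarrow> y \<in> D \<Longrightarrow> x * y \<in> D" and D_scale: "x \<in> D \<Longrightarrow> free_scale c x \<in> D"
    and D_adj: "x \<in> D \<Longrightarrow> free_adj x \<in> D"
    and s_one: "s 1 \<le> 1" and s_nonneg: "x \<in> D \<Longrightarrow> 0 \<le> s x"
    and s_add: "x \<in> D \<Longrightarrow> y \<in> D \<Longrightarrow> s (x + y) \<le> s x + s y"
    and s_mult: "x \<in> D \<Longrightarrow> y \<in> D \<Longrightarrow> s (x * y) \<le> s x * s y"
    and s_scale: "x \<in> D \<Longrightarrow> s (free_scale c x) \<le> cmod c * s x"
    and s_adj: "x \<in> D \<Longrightarrow> s (free_adj x) \<le> s x"
begin

lemma D_uminus: "x \<in> D \<Longrightarrow> - x \<in> D"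
  using D_scale[of x "-1"] by (simp add: free_scale_simps)

lemma D_diff: "x \<in> D \<Longrightarrow> y \<in> D \<Longrightarrow> x - y \<in> D"
  using D_add[OF _ D_uminus, of x y] by simp

lemma D_zero: "0 \<in> D"
  using D_scale[OF D_one, of 0] by (simp add: free_scale_simps)

lemma s_diff: "x \<in> D \<Longrightarrow> y \<in> D \<Longrightarrow> s (x - y) \<le> s x + s y"
  using s_add[OF _ D_uminus, of x y] s_scale[of y "-1"] by (simp add: free_scale_simps)

lemma D_power: "x \<in> D \<Longrightarrow> x ^ n \<in> D"
  by (induction n) (auto intro: D_one D_mult)

lemma free_scale_of_nat: "free_scale (of_nat n) x = of_nat n * x"
  by (induction n) (simp_all add: free_scale_simps algebra_simps)

lemma s_zero: "s 0 = 0"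
  using s_scale[OF D_zero, of 0] s_nonneg[OF D_zero] by (simp add: free_scale_simps)

text \<open>The remainder of the binomial expansion after the linear term has nonnegative
  coefficients, so it is dominated by the same expression in the number \<open>\<sigma>\<close>. The
  recursion used is \<open>r' = (1 + z) * r + n * z\<^sup>2\<close>.\<close>

lemma s_power_remainder:
  assumes z: "z \<in> D" and \<sigma>: "s z \<le> \<sigma>"
  shows "s ((1 + z) ^ n - 1 - free_scale (of_nat n) z) \<le> (1 + \<sigma>) ^ n - 1 - n * \<sigma>"
proof (induction n)
  case 0
  show ?case by (simp add: free_scale_simps s_zero)
next
  case (Suc n)
  define r where "r = (1 + z) ^ n - 1 - free_scale (of_nat n) z"
  have D: "1 + z \<in> D" "r \<in> D" "z * z \<in> D" unfolding r_def
    by (intro D_diff D_power D_add D_one D_scale D_mult z)+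
  have "(1 + z) ^ Suc n - 1 - free_scale (of_nat (Suc n)) z = (1 + z) * r + free_scale (of_nat n) (z * z)"
    unfolding r_def free_scale_of_nat
    by (simp add: algebra_simps) (simp add: mult_of_nat_commute mult.assoc)
  also have "s \<dots> \<le> s ((1 + z) * r) + s (free_scale (of_nat n) (z * z))"
    by (intro s_add D_mult D D_scale)
  also have "s ((1 + z) * r) \<le> (1 + \<sigma>) * ((1 + \<sigma>) ^ n - 1 - n * \<sigma>)"
  proof (rule order_trans[OF s_mult[OF D(1,2)]], rule mult_mono)
    show "s (1 + z) \<le> 1 + \<sigma>" using s_add[OF D_one z] s_one \<sigma> by linarith
    show "s r \<le> (1 + \<sigma>) ^ n - 1 - n * \<sigma>" using Suc by (simp add: r_def)
    show "0 \<le> 1 + \<sigma>" using s_nonneg[OF z] \<sigma> by linarith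
  qed (rule s_nonneg[OF D(2)])
  also have "s (free_scale (of_nat n) (z * z)) \<le> n * (\<sigma> * \<sigma>)"
  proof -
    have "s (z * z) \<le> \<sigma> * \<sigma>"
      using order_trans[OF s_mult[OF z z] mult_mono[OF \<sigma> \<sigma>]] s_nonneg[OF z] \<sigma> by linarith
    then show ?thesis
      using s_scale[OF D(3), of "of_nat n"] mult_left_mono[of "s (z * z)" "\<sigma> * \<sigma>" "real n"]
      by simp
  qed
  finally show ?case by (simp add: algebra_simps)
qed

text \<open>For self-adjoint \<open>h\<close> the element \<open>(1 + i h / n)^n\<close> has norm close to 1 when \<open>n\<close> is large; this
  is a polynomial replacement for the unitary \<open>exp (i h)\<close>, and \<open>sine\<close> is the corresponding \<open>sin h\<close>:
  of norm at most 2 however large \<open>h\<close> is, and close to \<open>h\<close> where \<open>h\<close> is small.\<close>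

definition sine :: "nat \<Rightarrow> 'g free_star \<Rightarrow> 'g free_star" where
  "sine n h = free_scale (1 / (2 * \<i>))
     ((1 + free_scale (\<i> / of_nat n) h) ^ n - (1 + free_scale (- \<i> / of_nat n) h) ^ n)"

lemma sine_in_D: "h \<in> D \<Longrightarrow> sine n h \<in> D"
  unfolding sine_def by (intro D_scale D_diff D_power D_add D_one)

text \<open>The scalar \<open>c\<close> is imaginary and \<open>h\<close> self-adjoint, so the
  element times its adjoint is \<open>1 + h\<^sup>2 / n\<^sup>2\<close>, of seminorm at most
  \<open>1 + 1 / n\<close>. Its \<open>n\<close>-th power stays below \<open>e\<close>, hence below
  4, which bounds the square of the quantity in question.\<close>

lemma p_power_le:
  assumes h: "free_adj h = h" and n: "0 < n" "(p h)\<^sup>2 \<le> n" and c: "c = \<i> / of_nat n \<or> c = - \<i> / of_nat n"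
  shows "p ((1 + free_scale c h) ^ n) \<le> 2"
proof -
  let ?z = "1 + free_scale c h"
  have cc: "cnj c = - c" "cmod (c * c) = 1 / (real n)\<^sup>2" using c n
    by (auto simp: norm_mult norm_divide power2_eq_square)
  have "(p ?z)\<^sup>2 = p (free_adj ?z * ?z)"
    by (rule cstar_seminorm_cstar[OF p, symmetric])
  also have "free_adj ?z * ?z = 1 - free_scale (c * c) (h * h)"
  proof -
    have "free_scale (- c) h = - free_scale c h" by (rule poly_mapping_eqI) simp
    then have "free_adj ?z * ?z = (1 - free_scale c h) * (1 + free_scale c h)"
      by (simp add: free_adj_simps h cc)
    then show ?thesis
      by (simp add: free_scale_mult_left free_scale_mult_right free_scale_simps algebra_simps)
  qed
  also have "p \<dots> \<le> 1 + (p h)\<^sup>2 / (real n)\<^sup>2"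
  proof -
    have "p (free_scale (c * c) (h * h)) \<le> (p h)\<^sup>2 / (real n)\<^sup>2"
      using cstar_seminorm_mult[OF p, of h h]
      by (simp add: cstar_seminorm_scale[OF p] cc power2_eq_square divide_right_mono)
    then show ?thesis
      using cstar_seminorm_diff[OF p, of 1 "free_scale (c * c) (h * h)"] cstar_seminorm_one_le[OF p] by linarith
  qed
  also have "\<dots> \<le> 1 + 1 / n"
    using n divide_right_mono[OF n(2), of "(real n)\<^sup>2"] by (simp add: power2_eq_square)
  also have "\<dots> \<le> exp (1 / n)" by (rule exp_ge_add_one_self)
  finally have "((p ?z)\<^sup>2) ^ n \<le> exp (1 / n) ^ n"
    by (intro power_mono) auto
  also have "\<dots> = exp 1" using n exp_of_nat_mult[of n "1 / real n"] by simp
  also have "\<dots> \<le> 3" by (rule exp_le)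
  finally have "(p ?z ^ n)\<^sup>2 \<le> 2\<^sup>2" by (simp add: power_mult[symmetric] mult.commute)
  then have "p ?z ^ n \<le> 2" by (rule power2_le_imp_le) simp
  then show ?thesis using cstar_seminorm_power'[OF p, of ?z n] by linarith
qed

lemma p_sine_le:
  assumes "free_adj h = h" "0 < n" "(p h)\<^sup>2 \<le> n"
  shows "p (sine n h) \<le> 2"
proof -
  have "p (sine n h) \<le> (1 / 2) * (p ((1 + free_scale (\<i> / of_nat n) h) ^ n) + p ((1 + free_scale (- \<i> / of_nat n) h) ^ n))"
    unfolding sine_def cstar_seminorm_scale[OF p]
    by (rule mult_mono) (auto simp: norm_divide norm_mult cstar_seminorm_diff[OF p] cstar_seminorm_nonneg[OF p])
  also have "\<dots> \<le> (1 / 2) * (2 + 2)"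
    by (intro mult_left_mono add_mono p_power_le[OF assms]) auto
  finally show ?thesis by simp
qed

text \<open>In the difference of the two powers the constants cancel and the linear terms add up to
  \<open>h\<close>. Each remainder is at most \<open>exp \<delta> - 1 - \<delta>\<close>, hence at
  most \<open>\<delta>\<^sup>2\<close>. The bound holds for every positive \<open>n\<close>, which
  leaves \<open>n\<close> free to be adapted to \<open>p h\<close>.\<close>

lemma s_sine_le:
  assumes h: "h \<in> D" and n: "0 < n" and \<delta>: "s h \<le> \<delta>" "0 \<le> \<delta>" "\<delta> \<le> 1"
  shows "s (sine n h - h) \<le> \<delta>\<^sup>2"
proof -
  define z where "z = free_scale (\<i> / of_nat n) h"
  define R where "R z = (1 + z) ^ n - 1 - free_scale (of_nat n) z" for z :: "'g free_star"
  have z: "z \<in> D" "- z \<in> D" unfolding z_def by (intro D_uminus D_scale h)+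
  have RD: "R y \<in> D" if "y \<in> D" for y unfolding R_def by (intro D_diff D_power D_add D_one D_scale that)
  have mz: "free_scale (- \<i> / of_nat n) h = - z"
    by (rule poly_mapping_eqI) (simp add: z_def)
  have sR: "s (R y) \<le> \<delta>\<^sup>2" if y: "y \<in> D" "s y \<le> \<delta> / n" for y
  proof -
    have "s (R y) \<le> (1 + \<delta> / n) ^ n - 1 - n * (\<delta> / n)"
      unfolding R_def by (rule s_power_remainder[OF y])
    also have "(1 + \<delta> / n) ^ n \<le> exp (\<delta> / n) ^ n"
      using \<delta> by (intro power_mono exp_ge_add_one_self) auto
    also have "\<dots> = exp \<delta>" using n exp_of_nat_mult[of n "\<delta> / real n"] by simp
    also have "exp \<delta> \<le> 1 + \<delta> + \<delta>\<^sup>2" using \<delta> by (intro exp_bound) auto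
    finally show ?thesis using n by simp
  qed
  have sz: "s z \<le> \<delta> / n"
  proof -
    have "s z \<le> cmod (\<i> / of_nat n) * s h" unfolding z_def by (rule s_scale[OF h])
    also have "\<dots> \<le> \<delta> / n" using \<delta>(1) by (simp add: norm_divide divide_right_mono)
    finally show ?thesis .
  qed
  have smz: "s (- z) \<le> \<delta> / n"
    using s_scale[OF z(1), of "-1"] sz by (simp add: free_scale_simps)
  have "free_scale (1 / (2 * \<i>)) (free_scale (of_nat n) z + free_scale (of_nat n) z) = h"
    using n by (simp add: z_def free_scale_simps(1,3,4) free_scale_simps(2)[symmetric])
  then have "sine n h - h = free_scale (1 / (2 * \<i>)) (R z - R (- z))"
    unfolding sine_def mz z_def[symmetric] R_def
    by (simp add: free_scale_simps(1,7,8) algebra_simps)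
  also have "s \<dots> \<le> cmod (1 / (2 * \<i>)) * s (R z - R (- z))"
    by (intro s_scale D_diff RD z)
  also have "\<dots> \<le> (1 / 2) * (\<delta>\<^sup>2 + \<delta>\<^sup>2)"
    using order_trans[OF s_diff[OF RD[OF z(1)] RD[OF z(2)]] add_mono[OF sR[OF z(1) sz] sR[OF z(2) smz]]]
    by (simp add: norm_divide norm_mult)
  finally show ?thesis by simp
qed

text \<open>Rescaling \<open>h\<close> by \<open>1 / (4 * \<beta>)\<close> brings its
  \<open>s\<close>-norm down to 1/4. Scaling back, the bound 2 for \<open>sine\<close> becomes
  \<open>8 * \<beta>\<close>, and its error \<open>(1/4)\<^sup>2\<close> becomes
  \<open>\<beta> / 4\<close>.\<close>

lemma lift_self_adjoint:
  assumes h: "h \<in> D" "free_adj h = h" "s h \<le> \<beta>" and \<beta>: "0 < \<beta>"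
  shows "\<exists>h'\<in>D. p h' \<le> 8 * \<beta> \<and> s (h - h') \<le> \<beta> / 4"
proof -
  define k where "k = free_scale (of_real (1 / (4 * \<beta>))) h"
  have k: "k \<in> D" "free_adj k = k" unfolding k_def by (auto simp: free_adj_simps h intro: D_scale)
  have "s k \<le> 1 / (4 * \<beta>) * s h"
    unfolding k_def using s_scale[OF h(1), of "of_real (1 / (4 * \<beta>))"] \<beta> by (simp add: norm_divide norm_mult)
  also have "\<dots> \<le> 1 / 4" using h(3) \<beta> by (simp add: field_simps)
  finally have sk: "s k \<le> 1 / 4" .
  \<comment> \<open>The size of \<open>p k\<close> is uncontrolled; it influences the choice of
    \<open>n\<close> but none of the final bounds.\<close>
  obtain n :: nat where n: "max 1 ((p k)\<^sup>2) \<le> n" using real_arch_simple by blast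
  then have n': "0 < n" "(p k)\<^sup>2 \<le> n" by auto
  define h' where "h' = free_scale (of_real (4 * \<beta>)) (sine n k)"
  have "p h' = 4 * \<beta> * p (sine n k)"
    using \<beta> by (simp add: h'_def cstar_seminorm_scale[OF p] norm_mult)
  then have "p h' \<le> 8 * \<beta>"
    using mult_left_mono[OF p_sine_le[OF k(2) n'], of "4 * \<beta>"] \<beta> by simp
  moreover have "h - h' = free_scale (of_real (- 4 * \<beta>)) (sine n k - k)"
    using \<beta> by (intro poly_mapping_eqI) (simp add: h'_def k_def lookup_minus algebra_simps)
  then have "s (h - h') \<le> 4 * \<beta> * s (sine n k - k)"
    using s_scale[OF D_diff[OF sine_in_D[OF k(1)] k(1)], of "of_real (- 4 * \<beta>)" n] \<beta> by (simp add: norm_mult)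
  moreover have "s (sine n k - k) \<le> 1 / 16"
    using s_sine_le[OF k(1) n'(1) sk] by (simp add: power2_eq_square)
  then have "4 * \<beta> * s (sine n k - k) \<le> 4 * \<beta> * (1 / 16)"
    using \<beta> by (intro mult_left_mono) auto
  ultimately have "p h' \<le> 8 * \<beta>" "s (h - h') \<le> \<beta> / 4" by auto
  moreover have "h' \<in> D" unfolding h'_def by (intro D_scale sine_in_D k)
  ultimately show ?thesis by blast
qed

text \<open>Real and imaginary parts are lifted separately. Their bounds add up: 8 + 8 = 16 for the
  norm and 1/4 + 1/4 = 1/2 for the error.\<close>

lemma lift:
  assumes x: "x \<in> D"
  shows "\<exists>x'\<in>D. p x' \<le> 16 * s x \<and> s (x - x') \<le> s x / 2"
proof (cases "s x = 0")
  case True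
  then show ?thesis using D_zero cstar_seminorm_zero[OF p] by (intro bexI[of _ 0]) auto
next
  case False
  then have pos: "0 < s x" using s_nonneg[OF x] by simp
  define a where "a = free_scale (1 / 2) (x + free_adj x)"
  define b where "b = free_scale (1 / (2 * \<i>)) (x - free_adj x)"
  have D: "a \<in> D" "b \<in> D" unfolding a_def b_def by (intro D_scale D_add D_diff D_adj x)+
  have sa: "free_adj a = a" "free_adj b = b"
    by (rule poly_mapping_eqI; simp add: a_def b_def lookup_add lookup_minus field_simps)+
  have xab: "x = a + free_scale \<i> b"
    by (rule poly_mapping_eqI) (simp add: a_def b_def lookup_add lookup_minus field_simps)
  have sx: "s (x + free_adj x) \<le> 2 * s x" "s (x - free_adj x) \<le> 2 * s x"
    using s_add[OF x D_adj[OF x]] s_diff[OF x D_adj[OF x]] s_adj[OF x] by auto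
  have "s a \<le> s x" "s b \<le> s x"
    using s_scale[OF D_add[OF x D_adj[OF x]], of "1 / 2"] s_scale[OF D_diff[OF x D_adj[OF x]], of "1 / (2 * \<i>)"] sx
    by (auto simp: a_def b_def norm_divide norm_mult)
  then obtain a' b' where a': "a' \<in> D" "p a' \<le> 8 * s x" "s (a - a') \<le> s x / 4"
    and b': "b' \<in> D" "p b' \<le> 8 * s x" "s (b - b') \<le> s x / 4"
    using lift_self_adjoint[OF D(1) sa(1) _ pos] lift_self_adjoint[OF D(2) sa(2) _ pos] by blast
  define x' where "x' = a' + free_scale \<i> b'"
  have "x' \<in> D" unfolding x'_def by (intro D_add D_scale a' b')
  moreover have "p x' \<le> 16 * s x"
    using cstar_seminorm_add[OF p, of a' "free_scale \<i> b'"] a'(2) b'(2)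
    by (simp add: x'_def cstar_seminorm_scale[OF p])
  moreover have "s (x - x') \<le> s x / 2"
  proof -
    have "x - x' = (a - a') + free_scale \<i> (b - b')"
      unfolding x'_def by (subst xab) (simp add: free_scale_simps)
    then show ?thesis
      using s_add[OF D_diff[OF D(1) a'(1)] D_scale[OF D_diff[OF D(2) b'(1)]], of \<i>]
        s_scale[OF D_diff[OF D(2) b'(1)], of \<i>] a'(3) b'(3) by simp
  qed
  ultimately show ?thesis by blast
qed

end

text \<open>The source of all bilinearity: lists that act alike in every pair of representations are
  identified by the completion.\<close>

lemma (in tensor_of_universal) dist_eq_0I:
  assumes s: "s \<in> carrier AB" and t: "t \<in> carrier AB"
    and eq: "\<And>X Y \<rho> \<sigma> \<zeta>. tensor_representation A B (X :: 'g universal_elem set) (Y :: 'h universal_elem set) \<rho> \<sigma> \<Longrightarrow>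
      \<zeta> \<in> ell2 (X \<times> Y) \<Longrightarrow> tensor_rep \<rho> \<sigma> s \<zeta> = tensor_rep \<rho> \<sigma> t \<zeta>"
  shows "AB.d s t = 0" "min_tensor_norm A B s = min_tensor_norm A B t"
proof -
  have "min_tensor_norm A B (diff AB s t) \<le> 0"
  proof (rule min_tensor_norm_least)
    fix X Y \<rho> \<sigma>
    assume rep: "representation A (X :: 'g universal_elem set) \<rho>" "representation B (Y :: 'h universal_elem set) \<sigma>"
    note tr = tensor_representation[OF rep]
    interpret star_representation AB "X \<times> Y" "tensor_rep \<rho> \<sigma>"
      by unfold_locales (rule tensor_representation.representation_tensor_rep[OF tr])
    have "op_norm (X \<times> Y) (tensor_rep \<rho> \<sigma> (diff AB s t)) = op_norm (X \<times> Y) (\<lambda>_ _. 0)"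
      by (rule op_norm_cong) (simp only: diff[OF s t AB.smult_closed[OF t]] eq[OF tr] diff_self)
    then show "op_norm (X \<times> Y) (tensor_rep \<rho> \<sigma> (diff AB s t)) \<le> 0"
      by (simp add: op_norm_null)
  qed
  then show "AB.d s t = 0" using AB.dist_nonneg[OF s t] by simp
  then show "min_tensor_norm A B s = min_tensor_norm A B t"
    using AB.nrm_lipschitz[OF s t] by simp
qed

text \<open>Identities such as the reversal of products under \<open>star\<close> are not laws of
  the carrier algebra. They are recovered here for the operators, since an operator is determined by
  its inner products.\<close>

lemma (in star_representation) star_eqI:
  assumes "a \<in> carrier A" "star A a \<in> carrier A" "\<xi> \<in> ell2 X" "\<eta> \<in> ell2 X"
    and "\<And>\<omega>. \<omega> \<in> ell2 X \<Longrightarrow> ell2_inner \<eta> \<omega> = ell2_inner \<xi> (\<rho> a \<omega>)"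
  shows "\<rho> (star A a) \<xi> = \<eta>"
proof (rule ell2_eqI[OF closed assms(4)])
  fix \<omega> assume "\<omega> \<in> ell2 X"
  then have "ell2_inner (\<rho> (star A a) \<xi>) \<omega> = ell2_inner \<eta> \<omega>"
    using inner assms by simp
  then show "ell2_inner \<omega> (\<rho> (star A a) \<xi>) = ell2_inner \<omega> \<eta>"
    by (subst (1 2) ell2_inner_commute) simp
qed (use assms in auto)

section \<open>The quantum permutation group\<close>

interpretation FS: seminormed_star_algebra "free_star_algebra (S_rels :: ('n::finite \<times> 'n) free_star set)"
  by (rule seminormed_free_star_algebra[OF bounding_S_rels])

interpretation FG: seminormed_star_algebra "free_star_algebra (G_rels :: ('n::finite \<times> 'n) free_star set)"
  by (rule seminormed_free_star_algebra[OF bounding_G_rels])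

interpretation SS: tensor_of_universal "S_rels :: ('n::finite \<times> 'n) free_star set"
    "S_rels :: ('n::finite \<times> 'n) free_star set"
  by unfold_locales (rule bounding_S_rels)+

definition U :: "('n::finite \<times> 'n) free_star \<Rightarrow> ('n \<times> 'n) universal_elem" where
  "U x = embed (free_star_algebra S_rels) x"

lemma U_closed: "U x \<in> carrier C_S"
  using FS.embed_closed by (simp add: U_def C_S_def universal_cstar_def)

lemma U_hom:
  "U x \<oplus>\<^bsub>C_S\<^esub> U y = U (x + y)" "U x \<otimes>\<^bsub>C_S\<^esub> U y = U (x * y)" "c \<odot>\<^bsub>C_S\<^esub> U x = U (free_scale c x)"
  "star C_S (U x) = U (free_adj x)" "\<one>\<^bsub>C_S\<^esub> = U 1"
  by (simp_all add: U_def C_S_def universal_cstar_def FS.embed_hom)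
     (simp add: FS.completion_one embed_def)

lemma nrm_U: "nrm C_S (U x) = universal_seminorm S_rels x"
  using FS.completion_nrm_embed[of x] by (simp add: U_def C_S_def universal_cstar_def)

lemma U_rel: "x - y \<in> S_rels \<Longrightarrow> U x = U y"
  unfolding U_def by (subst FS.embed_eq_iff) (auto intro: universal_seminorm_rel[OF bounding_S_rels])

lemma U_gen:
  "U (gen b * gen b) = U (gen b)" "U (free_adj (gen b)) = U (gen b)"
  "U (\<Sum>j\<in>UNIV. gen (i, j)) = U 1" "U (\<Sum>i\<in>UNIV. gen (i, j)) = U 1"
  by (cases b, rule U_rel, force simp: S_rels_def magic_unitary_rels_def projection_rels_def)+

lemma star_carrier_C_S: "star_carrier (C_S :: ('n::finite \<times> 'n) universal_elem star_algebra)"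
  unfolding C_S_def by (rule SS.star_carriers)

locale S_representations =
  \<rho>: star_representation "C_S :: ('n::finite \<times> 'n) universal_elem star_algebra" X \<rho> +
  \<sigma>: star_representation "C_S :: ('n \<times> 'n) universal_elem star_algebra" Y \<sigma>
  for X :: "'i set" and Y :: "'j set" and \<rho> \<sigma>
begin

sublocale tensor_representation C_S C_S X Y \<rho> \<sigma>
  by (intro tensor_representation.intro star_carrier_C_S \<rho>.star_representation_axioms \<sigma>.star_representation_axioms)

text \<open>Indexed by polynomials instead of elements of \<open>C_S\<close>: products and adjoints
  are computed in the free algebra, and the magic unitary relations enter through
  \<open>U_gen\<close>.\<close>

definition \<theta> :: "('n \<times> 'n) free_star \<Rightarrow> ('n \<times> 'n) free_star \<Rightarrow> ('i \<times> 'j \<Rightarrow> complex) \<Rightarrow> ('i \<times> 'j \<Rightarrow> complex)" where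
  "\<theta> x y = op_tensor (\<rho> (U x)) (\<sigma> (U y))"

lemma tensor_rep_U: "\<Phi> [(U x, U y)] = \<theta> x y"
  by (simp add: tensor_rep_single \<theta>_def)

lemma \<theta>_mult: "\<zeta> \<in> ell2 (X \<times> Y) \<Longrightarrow> \<theta> x y (\<theta> x' y' \<zeta>) = \<theta> (x * x') (y * y') \<zeta>"
  unfolding \<theta>_def U_hom(2)[symmetric] by (rule mult_elem[symmetric]) (simp_all add: U_closed)

lemma \<theta>_adjoints: "adjoints (X \<times> Y) (\<theta> x y) (\<theta> (free_adj x) (free_adj y))"
  unfolding \<theta>_def U_hom(4)[symmetric] by (rule adjoints_elem) (simp_all add: U_closed)

lemma \<theta>_gen:
  "\<theta> (gen b * gen b) y = \<theta> (gen b) y" "\<theta> (free_adj (gen b)) y = \<theta> (gen b) y"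
  "\<theta> y (gen b * gen b) = \<theta> y (gen b)" "\<theta> y (free_adj (gen b)) = \<theta> y (gen b)"
  by (simp_all add: \<theta>_def U_gen)

lemma \<theta>_sum_left:
  assumes \<zeta>: "\<zeta> \<in> ell2 (X \<times> Y)"
  shows "\<theta> (\<Sum>k\<in>K. x k) y \<zeta> z = (\<Sum>k\<in>K. \<theta> (x k) y \<zeta> z)"
proof -
  have add: "\<theta> (x + x') y \<zeta> z = \<theta> x y \<zeta> z + \<theta> x' y \<zeta> z" for x x'
    unfolding \<theta>_def U_hom(1)[symmetric] by (simp add: add_elem_left U_closed \<zeta>)
  have "\<theta> 0 y \<zeta> z = 0" using add[of 0 0] by simp
  then show ?thesis by (induction K rule: infinite_finite_induct) (simp_all add: add)
qed

lemma \<theta>_sum_right: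
  assumes \<zeta>: "\<zeta> \<in> ell2 (X \<times> Y)"
  shows "\<theta> x (\<Sum>k\<in>K. y k) \<zeta> z = (\<Sum>k\<in>K. \<theta> x (y k) \<zeta> z)"
proof -
  have add: "\<theta> x (y + y') \<zeta> z = \<theta> x y \<zeta> z + \<theta> x y' \<zeta> z" for y y'
    unfolding \<theta>_def U_hom(1)[symmetric] by (simp add: add_elem_right U_closed \<zeta>)
  have "\<theta> x 0 \<zeta> z = 0" using add[of 0 0] by simp
  then show ?thesis by (induction K rule: infinite_finite_induct) (simp_all add: add)
qed

definition \<kappa> :: "int \<Rightarrow> 'n \<times> 'n \<Rightarrow> ('i \<times> 'j \<Rightarrow> complex) \<Rightarrow> ('i \<times> 'j \<Rightarrow> complex)" where
  "\<kappa> n b = (if n = 0 then \<theta> (gen b) 1 else if n = 1 then \<theta> 1 (gen b)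
     else if fst b = snd b then \<theta> 1 1 else (\<lambda>_ _. 0))"

lemma \<kappa>_simps: "\<kappa> 0 b = \<theta> (gen b) 1" "\<kappa> 1 b = \<theta> 1 (gen b)"
  by (simp_all add: \<kappa>_def)

sublocale shifted_projections "X \<times> Y" \<kappa> "\<theta> 1 1"
proof
  have bz: "adjoints (X \<times> Y) (\<lambda>_ _. 0) (\<lambda>_ _. 0)"
    by (rule adjointsI[OF bounded_op_null bounded_op_null]) simp
  show "adjoints (X \<times> Y) (\<kappa> n b) (\<kappa> n b)" for n b
    using \<theta>_adjoints[of "gen b" 1] \<theta>_adjoints[of 1 "gen b"] \<theta>_adjoints[of 1 1] bz
    by (simp add: \<kappa>_def \<theta>_gen)
  show "adjoints (X \<times> Y) (\<theta> 1 1) (\<theta> 1 1)" using \<theta>_adjoints[of 1 1] by simp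
  fix \<zeta> assume \<zeta>: "\<zeta> \<in> ell2 (X \<times> Y)"
  have z: "\<theta> x y (\<lambda>_. 0) = (\<lambda>_. 0)" for x y
    by (rule bounded_op_zero[OF adjointsD(1)[OF \<theta>_adjoints]])
  show "\<kappa> n b (\<kappa> n b \<zeta>) = \<kappa> n b \<zeta>" for n b
    by (simp add: \<kappa>_def \<theta>_mult \<theta>_gen \<zeta>)
  show "\<theta> 1 1 (\<theta> 1 1 \<zeta>) = \<theta> 1 1 \<zeta>" by (simp add: \<theta>_mult \<zeta>)
  show "\<kappa> n b (\<theta> 1 1 \<zeta>) = \<kappa> n b \<zeta>" "\<theta> 1 1 (\<kappa> n b \<zeta>) = \<kappa> n b \<zeta>" for n b
    by (simp_all add: \<kappa>_def \<theta>_mult \<zeta> z)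
  \<comment> \<open>Levels 0 and 1 act on different tensor factors; at every other level an entry is
    the unit \<open>\<theta> 1 1\<close> or 0.\<close>
  show "\<kappa> m b (\<kappa> n c \<zeta>) = \<kappa> n c (\<kappa> m b \<zeta>)" if "m \<noteq> n" for m n b c
    using that by (auto simp: \<kappa>_def \<theta>_mult \<zeta> z)
  show "(\<Sum>j\<in>UNIV. \<kappa> n (i, j) \<zeta> l) = \<theta> 1 1 \<zeta> l" for n i l
  proof -
    have "(\<Sum>j\<in>UNIV. \<theta> (gen (i, j)) 1 \<zeta> l) = \<theta> 1 1 \<zeta> l"
      using \<theta>_sum_left[OF \<zeta>, of "\<lambda>j. gen (i, j)" UNIV 1 l] by (simp add: \<theta>_def U_gen)
    moreover have "(\<Sum>j\<in>UNIV. \<theta> 1 (gen (i, j)) \<zeta> l) = \<theta> 1 1 \<zeta> l"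
      using \<theta>_sum_right[OF \<zeta>, of 1 "\<lambda>j. gen (i, j)" UNIV l] by (simp add: \<theta>_def U_gen)
    moreover have "(\<Sum>j\<in>UNIV. (if i = j then \<theta> 1 1 else (\<lambda>_ _. 0)) \<zeta> l) = \<theta> 1 1 \<zeta> l"
      by (simp add: if_distrib[of "\<lambda>f. f \<zeta> l"] cong: if_cong)
    ultimately show ?thesis by (cases "n = 0"; cases "n = 1") (simp_all add: \<kappa>_def)
  qed
  show "(\<Sum>i\<in>UNIV. \<kappa> n (i, j) \<zeta> l) = \<theta> 1 1 \<zeta> l" for n j l
  proof -
    have "(\<Sum>i\<in>UNIV. \<theta> (gen (i, j)) 1 \<zeta> l) = \<theta> 1 1 \<zeta> l"
      using \<theta>_sum_left[OF \<zeta>, of "\<lambda>i. gen (i, j)" UNIV 1 l] by (simp add: \<theta>_def U_gen)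
    moreover have "(\<Sum>i\<in>UNIV. \<theta> 1 (gen (i, j)) \<zeta> l) = \<theta> 1 1 \<zeta> l"
      using \<theta>_sum_right[OF \<zeta>, of 1 "\<lambda>i. gen (i, j)" UNIV l] by (simp add: \<theta>_def U_gen)
    moreover have "(\<Sum>i\<in>UNIV. (if i = j then \<theta> 1 1 else (\<lambda>_ _. 0)) \<zeta> l) = \<theta> 1 1 \<zeta> l"
      by (simp add: if_distrib[of "\<lambda>f. f \<zeta> l"] cong: if_cong)
    ultimately show ?thesis by (cases "n = 0"; cases "n = 1") (simp_all add: \<kappa>_def)
  qed
qed

end

section \<open>The homomorphism\<close>

abbreviation CC :: "(('n::finite \<times> 'n) universal_elem \<times> ('n \<times> 'n) universal_elem) list star_algebra" where
  "CC \<equiv> alg_tensor C_S C_S"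

text \<open>The *-homomorphism on polynomials in the projections, before it is known to be one: a
  polynomial may have many partners, one for each way of building it. The unit is included although
  it is not among the generators of \<open>C_H\<close>; row sums produce it there.\<close>

inductive_set graph :: "(('n::finite \<times> 'n) free_star \<times> (('n \<times> 'n) universal_elem \<times> ('n \<times> 'n) universal_elem) list) set" where
  range: "(gen b * free_adj (gen b), [(U (gen b), U 1)]) \<in> graph"
| source: "(free_adj (gen b) * gen b, [(U 1, U (gen b))]) \<in> graph"
| one: "(1, [(U 1, U 1)]) \<in> graph"
| zero: "(0, []) \<in> graph"
| add: "(x, s) \<in> graph \<Longrightarrow> (y, t) \<in> graph \<Longrightarrow> (x + y, s \<oplus>\<^bsub>CC\<^esub> t) \<in> graph"
| mult: "(x, s) \<in> graph \<Longrightarrow> (y, t) \<in> graph \<Longrightarrow> (x * y, s \<otimes>\<^bsub>CC\<^esub> t) \<in> graph"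
| smult: "(x, s) \<in> graph \<Longrightarrow> (free_scale c x, c \<odot>\<^bsub>CC\<^esub> s) \<in> graph"
| star: "(x, s) \<in> graph \<Longrightarrow> (free_adj x, star CC s) \<in> graph"

interpretation CC: seminormed_star_algebra "CC :: (('n::finite \<times> 'n) universal_elem \<times> ('n \<times> 'n) universal_elem) list star_algebra"
  unfolding C_S_def by (rule SS.AB.seminormed_star_algebra_axioms)

lemma graph_carrier: "(x, t) \<in> graph \<Longrightarrow> t \<in> carrier CC"
proof (induction rule: graph.induct)
  case (add x s y t)
  show ?case by (rule CC.add_closed[OF add.IH])
next
  case (mult x s y t)
  show ?case by (rule CC.mult_closed[OF mult.IH])
next
  case (smult x s c)
  show ?case by (rule CC.smult_closed[OF smult.IH])
next
  case (star x s)
  show ?case by (rule CC.star_closed[OF star.IH])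
qed (simp_all add: U_closed)

context S_representations
begin

interpretation \<Phi>: star_representation CC "X \<times> Y" \<Phi>
  by unfold_locales (rule representation_tensor_rep)

text \<open>At level 0 the range projection of a generator reads \<open>\<kappa> 0\<close> and the
  source projection reads \<open>\<kappa> 1\<close>, as prescribed by \<open>graph\<close>. The
  claim about the adjoint is proved simultaneously because the case \<open>star\<close> of the
  induction needs it.\<close>

lemma graph_slice:
  assumes "(x, t) \<in> graph"
  shows "\<zeta> \<in> ell2 Z \<Longrightarrow> slice 0 (free_rep x \<zeta>) = \<Phi> t (slice 0 \<zeta>)"
    and "\<zeta> \<in> ell2 Z \<Longrightarrow> slice 0 (free_rep (free_adj x) \<zeta>) = \<Phi> (star CC t) (slice 0 \<zeta>)"
  using assms
proof (induction arbitrary: \<zeta> rule: graph.induct)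
  case (range b)
  {
    case 1
    then show ?case by (simp add: slice_p \<kappa>_simps tensor_rep_U)
  next
    case 2
    then show ?case by (simp add: slice_p \<kappa>_simps tensor_rep_U free_adj_mult free_adj_simps U_hom \<theta>_gen)
  }
next
  case (source b)
  {
    case 1
    then show ?case by (simp add: slice_q \<kappa>_simps tensor_rep_U)
  next
    case 2
    then show ?case by (simp add: slice_q \<kappa>_simps tensor_rep_U free_adj_mult free_adj_simps U_hom \<theta>_gen)
  }
next
  case one
  {
    case 1
    show ?case by (simp add: free_rep_one slice_e tensor_rep_U)
  next
    case 2
    show ?case by (simp add: free_rep_one slice_e tensor_rep_U U_hom)
  }
next
  case zero
  {
    case 1
    show ?case by (simp add: free_rep_zero tensor_rep_Nil slice_def)
  next
    case 2
    show ?case by (simp add: free_rep_zero tensor_rep_Nil slice_def free_adj_simps)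
  }
next
  case (add x s y t)
  have slice_add: "slice 0 (\<lambda>i. f i + g i) = (\<lambda>l. slice 0 f l + slice 0 g l)" for f g
    by (simp add: slice_def)
  {
    case 1
    then show ?case using add by (simp add: free_rep_add slice_add tensor_rep_append)
  next
    case 2
    then show ?case using add by (simp add: free_rep_add slice_add tensor_rep_append free_adj_simps)
  }
next
  case (mult x s y t)
  note s = graph_carrier[OF mult.hyps(1)] and t = graph_carrier[OF mult.hyps(2)]
  {
    case 1
    note sl = slice_closed[OF 1]
    show ?case
      by (simp only: free_rep_mult[OF 1] mult.IH(1)[OF free_rep_closed[OF 1]] mult.IH(3)[OF 1] \<Phi>.mult[OF s t sl])
  next
    case 2
    note sl = slice_closed[OF 2]
    have "\<Phi> (star CC (s \<otimes>\<^bsub>CC\<^esub> t)) (slice 0 \<zeta>) = \<Phi> (star CC t) (\<Phi> (star CC s) (slice 0 \<zeta>))"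
    proof (rule \<Phi>.star_eqI)
      fix \<omega> assume \<omega>: "\<omega> \<in> ell2 (X \<times> Y)"
      show "ell2_inner (\<Phi> (star CC t) (\<Phi> (star CC s) (slice 0 \<zeta>))) \<omega> = ell2_inner (slice 0 \<zeta>) (\<Phi> (s \<otimes>\<^bsub>CC\<^esub> t) \<omega>)"
        by (simp only: \<Phi>.inner[OF t \<Phi>.closed[OF CC.star_closed[OF s] sl] \<omega>]
            \<Phi>.inner[OF s sl \<Phi>.closed[OF t \<omega>]] \<Phi>.mult[OF s t \<omega>])
    qed (intro CC.star_closed CC.mult_closed s t sl \<Phi>.closed)+
    then show ?case
      by (simp only: free_adj_mult free_rep_mult[OF 2] mult.IH(2)[OF 2] mult.IH(4)[OF free_rep_closed[OF 2]])
  }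
next
  case (smult x s c)
  note s = graph_carrier[OF smult.hyps(1)]
  have slice_scale: "slice 0 (\<lambda>i. c * f i) = (\<lambda>l. c * slice 0 f l)" for c f
    by (simp add: slice_def)
  {
    case 1
    note sl = slice_closed[OF 1]
    show ?case by (simp only: free_rep_scale slice_scale smult.IH(1)[OF 1] \<Phi>.smult[OF s sl])
  next
    case 2
    note sl = slice_closed[OF 2]
    have "\<Phi> (star CC (c \<odot>\<^bsub>CC\<^esub> s)) (slice 0 \<zeta>) = (\<lambda>l. cnj c * \<Phi> (star CC s) (slice 0 \<zeta>) l)"
    proof (rule \<Phi>.star_eqI)
      fix \<omega> assume \<omega>: "\<omega> \<in> ell2 (X \<times> Y)"
      show "ell2_inner (\<lambda>l. cnj c * \<Phi> (star CC s) (slice 0 \<zeta>) l) \<omega> = ell2_inner (slice 0 \<zeta>) (\<Phi> (c \<odot>\<^bsub>CC\<^esub> s) \<omega>)"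
        by (simp only: ell2_inner_scale_left ell2_inner_scale_right \<Phi>.inner[OF s sl \<omega>] \<Phi>.smult[OF s \<omega>] complex_cnj_cnj)
    qed (intro CC.star_closed CC.smult_closed s sl ell2_scale \<Phi>.closed)+
    then show ?case
      by (simp only: free_adj_simps free_rep_scale slice_scale smult.IH(2)[OF 2])
  }
next
  case (star x s)
  note s = graph_carrier[OF star.hyps(1)]
  {
    case 1
    show ?case by (rule star.IH(2)[OF 1])
  next
    case 2
    note sl = slice_closed[OF 2]
    have "\<Phi> (star CC (star CC s)) (slice 0 \<zeta>) = \<Phi> s (slice 0 \<zeta>)"
    proof (rule \<Phi>.star_eqI)
      fix \<omega> assume \<omega>: "\<omega> \<in> ell2 (X \<times> Y)"
      show "ell2_inner (\<Phi> s (slice 0 \<zeta>)) \<omega> = ell2_inner (slice 0 \<zeta>) (\<Phi> (star CC s) \<omega>)"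
        by (subst (1 2) ell2_inner_commute) (simp only: \<Phi>.inner[OF s \<omega> sl])
    qed (intro CC.star_closed s sl \<Phi>.closed)+
    then show ?case by (simp only: free_adj_simps star.IH(1)[OF 2])
  }
qed

lemma op_norm_graph_le:
  assumes "(x, t) \<in> graph"
  shows "op_norm (X \<times> Y) (\<Phi> t) \<le> universal_seminorm G_rels x"
  using op_norm_slice_le[where n = 0, OF graph_slice(1)[OF assms]] op_norm_free_rep_le[of x] by linarith

end

lemma graph_contraction:
  fixes x :: "('n::finite \<times> 'n) free_star"
  assumes "(x, t) \<in> graph"
  shows "nrm CC t \<le> universal_seminorm G_rels x"
proof -
  have "min_tensor_norm C_S C_S t \<le> universal_seminorm G_rels x"
    unfolding C_S_def
  proof (rule SS.min_tensor_norm_least)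
    fix X Y \<rho> \<sigma>
    assume "representation (universal_cstar (S_rels :: ('n \<times> 'n) free_star set)) (X :: ('n \<times> 'n) universal_elem set) \<rho>"
      "representation (universal_cstar (S_rels :: ('n \<times> 'n) free_star set)) (Y :: ('n \<times> 'n) universal_elem set) \<sigma>"
    then interpret S_representations X Y \<rho> \<sigma>
      by unfold_locales (simp_all add: C_S_def)
    show "op_norm (X \<times> Y) (tensor_rep \<rho> \<sigma> t) \<le> universal_seminorm G_rels x"
      by (rule op_norm_graph_le[OF assms])
  qed
  then show ?thesis by simp
qed

interpretation \<Gamma>: star_relation "free_star_algebra (G_rels :: ('n::finite \<times> 'n) free_star set)"
    "CC :: (('n \<times> 'n) universal_elem \<times> ('n \<times> 'n) universal_elem) list star_algebra" graph
proof
  fix x y and s t :: "(('n \<times> 'n) universal_elem \<times> ('n \<times> 'n) universal_elem) list" and c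
  show "x \<in> carrier (free_star_algebra G_rels) \<and> s \<in> carrier CC" if "(x, s) \<in> graph"
    using graph_carrier[OF that] by simp
  show "(\<zero>\<^bsub>free_star_algebra G_rels\<^esub>, \<zero>\<^bsub>CC\<^esub>) \<in> graph" using graph.zero by simp
  show "nrm CC s \<le> nrm (free_star_algebra G_rels) x" if "(x, s) \<in> graph"
    using graph_contraction[OF that] by simp
  show "(c \<odot>\<^bsub>free_star_algebra G_rels\<^esub> x, c \<odot>\<^bsub>CC\<^esub> s) \<in> graph" if "(x, s) \<in> graph"
    using graph.smult[OF that] by simp
  show "(star (free_star_algebra G_rels) x, star CC s) \<in> graph" if "(x, s) \<in> graph"
    using graph.star[OF that] by simp
  assume xy: "(x, s) \<in> graph" "(y, t) \<in> graph"
  show "(x \<oplus>\<^bsub>free_star_algebra G_rels\<^esub> y, s \<oplus>\<^bsub>CC\<^esub> t) \<in> graph" using graph.add[OF xy] by simp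
  show "(x \<otimes>\<^bsub>free_star_algebra G_rels\<^esub> y, s \<otimes>\<^bsub>CC\<^esub> t) \<in> graph" using graph.mult[OF xy] by simp
qed

section \<open>Norm-controlled lifting along the relation\<close>

lemma nrm_CC_Nil: "nrm CC [] = 0"
  using trans[OF CC.dist_zero[OF CC.zero_closed, symmetric] CC.dist_refl[OF CC.zero_closed]] by simp

text \<open>Each estimate is the corresponding distance axiom taken relative to the empty list, on
  which all operations are trivial.\<close>

lemma
  assumes s: "s \<in> carrier CC"
  shows nrm_CC_add: "t \<in> carrier CC \<Longrightarrow> nrm CC (s \<oplus>\<^bsub>CC\<^esub> t) \<le> nrm CC s + nrm CC t"
    and nrm_CC_mult: "t \<in> carrier CC \<Longrightarrow> nrm CC (s \<otimes>\<^bsub>CC\<^esub> t) \<le> nrm CC s * nrm CC t"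
    and nrm_CC_smult: "nrm CC (c \<odot>\<^bsub>CC\<^esub> s) \<le> cmod c * nrm CC s"
    and nrm_CC_star: "nrm CC (star CC s) \<le> nrm CC s"
proof -
  note z = CC.zero_closed and d0 = CC.dist_zero
  have zz: "\<zero>\<^bsub>CC\<^esub> \<oplus>\<^bsub>CC\<^esub> \<zero>\<^bsub>CC\<^esub> = \<zero>\<^bsub>CC\<^esub>" "\<zero>\<^bsub>CC\<^esub> \<otimes>\<^bsub>CC\<^esub> \<zero>\<^bsub>CC\<^esub> = \<zero>\<^bsub>CC\<^esub>"
    "c \<odot>\<^bsub>CC\<^esub> \<zero>\<^bsub>CC\<^esub> = \<zero>\<^bsub>CC\<^esub>" "star CC \<zero>\<^bsub>CC\<^esub> = \<zero>\<^bsub>CC\<^esub>" "nrm CC \<zero>\<^bsub>CC\<^esub> = 0" for c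
    using nrm_CC_Nil by simp_all
  show "nrm CC (c \<odot>\<^bsub>CC\<^esub> s) \<le> cmod c * nrm CC s"
    using CC.dist_smult[OF s z, of c] unfolding zz d0[OF CC.smult_closed[OF s]] d0[OF s] .
  show "nrm CC (star CC s) \<le> nrm CC s"
    using CC.dist_star[OF s z] unfolding zz d0[OF CC.star_closed[OF s]] d0[OF s] .
  assume t: "t \<in> carrier CC"
  show "nrm CC (s \<oplus>\<^bsub>CC\<^esub> t) \<le> nrm CC s + nrm CC t"
    using CC.dist_add[OF s t z z] unfolding zz d0[OF CC.add_closed[OF s t]] d0[OF s] d0[OF t] .
  show "nrm CC (s \<otimes>\<^bsub>CC\<^esub> t) \<le> nrm CC s * nrm CC t"
    using CC.dist_mult[OF s t z z] unfolding zz d0[OF CC.mult_closed[OF s t]] d0[OF s] d0[OF t] by simp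
qed

lemma nrm_CC_single:
  assumes "a \<in> carrier C_S" "b \<in> carrier C_S"
  shows "nrm CC [(a, b)] \<le> nrm C_S a * nrm C_S b"
  using SS.min_tensor_norm_le_sum[of "[(a, b)]"] assms by (simp add: C_S_def)

definition graph_norm :: "('n::finite \<times> 'n) free_star \<Rightarrow> real" where
  "graph_norm x = nrm CC (SOME t. (x, t) \<in> graph)"

text \<open>Two partners of the same polynomial differ by a partner of \<open>x - x\<close>, whose
  seminorm is 0; so the choice in \<open>graph_norm\<close> does not matter.\<close>

lemma graph_norm_eq:
  assumes "(x, t) \<in> graph"
  shows "graph_norm x = nrm CC t"
proof -
  define t' where "t' = (SOME t. (x, t) \<in> graph)"
  have t': "(x, t') \<in> graph" unfolding t'_def by (rule someI_ex) (use assms in blast)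
  have "CC.d t' t \<le> universal_seminorm G_rels (x - x)"
    using \<Gamma>.dist_contraction[OF t' assms] by simp
  also have "\<dots> = 0" by (simp add: cstar_seminorm_zero[OF cstar_seminorm_universal[OF bounding_G_rels]])
  finally show ?thesis
    using CC.nrm_lipschitz[OF graph_carrier[OF t'] graph_carrier[OF assms]] by (simp add: graph_norm_def t'_def)
qed

interpretation dominated: dominated_seminorm "universal_seminorm (G_rels :: ('n::finite \<times> 'n) free_star set)"
  graph_norm "Domain graph"
proof
  show "cstar_seminorm (universal_seminorm (G_rels :: ('n::finite \<times> 'n) free_star set))"
    by (rule cstar_seminorm_universal[OF bounding_G_rels])
  show "1 \<in> Domain graph" using graph.one by blast
  let ?u = "1 :: ('n \<times> 'n) free_star"
  have "(?u, [(U ?u, U ?u)]) \<in> graph" by (rule graph.one)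
  from graph_norm_eq[OF this] have "graph_norm ?u \<le> nrm C_S (U ?u) * nrm C_S (U ?u)"
    using nrm_CC_single[OF U_closed[of ?u] U_closed[of ?u]] by simp
  also have "\<dots> \<le> 1"
    unfolding nrm_U
    by (intro mult_le_one cstar_seminorm_one_le cstar_seminorm_nonneg cstar_seminorm_universal bounding_S_rels)
  finally show "graph_norm ?u \<le> 1" .
  fix x :: "('n \<times> 'n) free_star" and c
  assume "x \<in> Domain graph"
  then obtain s where s: "(x, s) \<in> graph" by blast
  note sC = graph_carrier[OF s]
  show "free_scale c x \<in> Domain graph" using graph.smult[OF s] by blast
  show "free_adj x \<in> Domain graph" using graph.star[OF s] by blast
  show "0 \<le> graph_norm x" unfolding graph_norm_eq[OF s] by (rule CC.nrm_nonneg[OF sC])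
  show "graph_norm (free_scale c x) \<le> cmod c * graph_norm x"
    unfolding graph_norm_eq[OF s] graph_norm_eq[OF graph.smult[OF s]] by (rule nrm_CC_smult[OF sC])
  show "graph_norm (free_adj x) \<le> graph_norm x"
    unfolding graph_norm_eq[OF s] graph_norm_eq[OF graph.star[OF s]] by (rule nrm_CC_star[OF sC])
  fix y :: "('n \<times> 'n) free_star"
  assume "y \<in> Domain graph"
  then obtain t where t: "(y, t) \<in> graph" by blast
  note tC = graph_carrier[OF t]
  show "x + y \<in> Domain graph" using graph.add[OF s t] by blast
  show "x * y \<in> Domain graph" using graph.mult[OF s t] by blast
  show "graph_norm (x + y) \<le> graph_norm x + graph_norm y"
    unfolding graph_norm_eq[OF s] graph_norm_eq[OF t] graph_norm_eq[OF graph.add[OF s t]] by (rule nrm_CC_add[OF sC tC])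
  show "graph_norm (x * y) \<le> graph_norm x * graph_norm y"
    unfolding graph_norm_eq[OF s] graph_norm_eq[OF t] graph_norm_eq[OF graph.mult[OF s t]] by (rule nrm_CC_mult[OF sC tC])
qed

text \<open>The difference of the lists is a partner of \<open>x - x'\<close>, so the error estimate
  of the abstract lift is an estimate of their distance.\<close>

lemma graph_lift:
  assumes "(x, t) \<in> graph"
  shows "\<exists>x' t'. (x', t') \<in> graph \<and> universal_seminorm G_rels x' \<le> 16 * nrm CC t \<and> CC.d t t' \<le> nrm CC t / 2"
proof -
  obtain x' t' where x': "(x', t') \<in> graph" "universal_seminorm G_rels x' \<le> 16 * graph_norm x"
    "graph_norm (x - x') \<le> graph_norm x / 2"
    using dominated.lift[of x] assms by blast
  moreover have "(x - x', diff CC t t') \<in> graph" using \<Gamma>.diff[OF assms x'(1)] by simp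
  ultimately show ?thesis
    using graph_norm_eq[OF assms] graph_norm_eq by metis
qed

section \<open>Density of the range\<close>

definition graph_closure :: "(('n::finite \<times> 'n) universal_elem \<times> ('n \<times> 'n) universal_elem) list set" where
  "graph_closure = {t \<in> carrier CC. \<forall>e>0. \<exists>(x, s)\<in>graph. CC.d t s < e}"

lemma graph_closureI:
  assumes "t \<in> carrier CC" "\<And>e. 0 < e \<Longrightarrow> \<exists>x s. (x, s) \<in> graph \<and> CC.d t s < e"
  shows "t \<in> graph_closure"
  using assms unfolding graph_closure_def by blast

lemma graph_closureE:
  assumes "t \<in> graph_closure" "0 < e"
  obtains x s where "(x, s) \<in> graph" "CC.d t s < e"
  using assms unfolding graph_closure_def by blast

lemma graph_closure_carrier: "t \<in> graph_closure \<Longrightarrow> t \<in> carrier CC"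
  by (simp only: graph_closure_def mem_Collect_eq)

lemma graph_closure_range:
  assumes "(x, t) \<in> graph"
  shows "t \<in> graph_closure"
  using CC.dist_refl[OF graph_carrier[OF assms]] assms
  by (intro graph_closureI graph_carrier[OF assms] exI[of _ x] exI[of _ t]) simp

lemma graph_closure_limit:
  assumes t: "t \<in> carrier CC" and lim: "\<And>e. 0 < e \<Longrightarrow> \<exists>s\<in>graph_closure. CC.d t s < e"
  shows "t \<in> graph_closure"
proof (rule graph_closureI[OF t])
  fix e :: real assume "0 < e"
  then have e: "0 < e / 2" by simp
  obtain s where s: "s \<in> graph_closure" "CC.d t s < e / 2" using lim[OF e] by blast
  obtain x r where r: "(x, r) \<in> graph" "CC.d s r < e / 2" using graph_closureE[OF s(1) e] .
  have "CC.d t r < e"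
    using CC.dist_triangle[OF t graph_closure_carrier[OF s(1)] graph_carrier[OF r(1)]] s(2) r(2) by linarith
  then show "\<exists>x s. (x, s) \<in> graph \<and> CC.d t s < e" using r(1) by blast
qed

lemma graph_closure_null:
  assumes "s \<in> graph_closure" "t \<in> carrier CC" "CC.d t s = 0"
  shows "t \<in> graph_closure"
  by (rule graph_closure_limit[OF assms(2)], rule bexI[OF _ assms(1)]) (simp only: assms(3))

lemma graph_closure_add:
  assumes s: "s \<in> graph_closure" and t: "t \<in> graph_closure"
  shows "s \<oplus>\<^bsub>CC\<^esub> t \<in> graph_closure"
proof (rule graph_closureI)
  note sC = graph_closure_carrier[OF s] and tC = graph_closure_carrier[OF t]
  show "s \<oplus>\<^bsub>CC\<^esub> t \<in> carrier CC" by (rule CC.add_closed[OF sC tC])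
  fix e :: real assume "0 < e"
  then have e: "0 < e / 2" by simp
  obtain x s' where s': "(x, s') \<in> graph" "CC.d s s' < e / 2" using graph_closureE[OF s e] .
  obtain y t' where t': "(y, t') \<in> graph" "CC.d t t' < e / 2" using graph_closureE[OF t e] .
  have "CC.d (s \<oplus>\<^bsub>CC\<^esub> t) (s' \<oplus>\<^bsub>CC\<^esub> t') < e"
    using CC.dist_add[OF sC tC graph_carrier[OF s'(1)] graph_carrier[OF t'(1)]] s'(2) t'(2) by linarith
  then show "\<exists>x r. (x, r) \<in> graph \<and> CC.d (s \<oplus>\<^bsub>CC\<^esub> t) r < e" using graph.add[OF s'(1) t'(1)] by blast
qed

lemma graph_closure_mult:
  assumes s: "s \<in> graph_closure" and t: "t \<in> graph_closure"
  shows "s \<otimes>\<^bsub>CC\<^esub> t \<in> graph_closure"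
proof (rule graph_closureI)
  note sC = graph_closure_carrier[OF s] and tC = graph_closure_carrier[OF t]
  show "s \<otimes>\<^bsub>CC\<^esub> t \<in> carrier CC" by (rule CC.mult_closed[OF sC tC])
  fix e :: real assume e: "0 < e"
  \<comment> \<open>The error is at most \<open>\<delta>\<close> times
    \<open>nrm CC s + nrm CC t + 1\<close>; one more unit makes the estimate strict.\<close>
  define K where "K = nrm CC s + nrm CC t + 2"
  have K: "0 < K" using CC.nrm_nonneg[OF sC] CC.nrm_nonneg[OF tC] by (simp add: K_def)
  define \<delta> where "\<delta> = min 1 (e / K)"
  have \<delta>: "0 < \<delta>" "\<delta> \<le> 1" "\<delta> * K \<le> e" using e K by (auto simp: \<delta>_def min_def field_simps)
  obtain x s' where s': "(x, s') \<in> graph" "CC.d s s' < \<delta>" using graph_closureE[OF s \<delta>(1)] .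
  obtain y t' where t': "(y, t') \<in> graph" "CC.d t t' < \<delta>" using graph_closureE[OF t \<delta>(1)] .
  note s'C = graph_carrier[OF s'(1)] and t'C = graph_carrier[OF t'(1)]
  have "nrm CC t' \<le> nrm CC t + 1"
    using CC.nrm_lipschitz[OF tC t'C] t'(2) \<delta>(2) by linarith
  then have "nrm CC s * CC.d t t' + CC.d s s' * nrm CC t' \<le> nrm CC s * \<delta> + \<delta> * (nrm CC t + 1)"
    using s'(2) t'(2) \<delta>(1) CC.nrm_nonneg[OF sC] CC.nrm_nonneg[OF t'C] CC.dist_nonneg[OF tC t'C] CC.dist_nonneg[OF sC s'C]
    by (intro add_mono mult_mono) auto
  also have "\<dots> < \<delta> * K" using \<delta>(1) by (simp add: K_def algebra_simps)
  finally have "CC.d (s \<otimes>\<^bsub>CC\<^esub> t) (s' \<otimes>\<^bsub>CC\<^esub> t') < e"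
    using CC.dist_mult[OF sC tC s'C t'C] \<delta>(3) by linarith
  then show "\<exists>x r. (x, r) \<in> graph \<and> CC.d (s \<otimes>\<^bsub>CC\<^esub> t) r < e" using graph.mult[OF s'(1) t'(1)] by blast
qed

lemma graph_closure_smult:
  assumes t: "t \<in> graph_closure"
  shows "c \<odot>\<^bsub>CC\<^esub> t \<in> graph_closure"
proof (rule graph_closureI)
  note tC = graph_closure_carrier[OF t]
  show "c \<odot>\<^bsub>CC\<^esub> t \<in> carrier CC" by (rule CC.smult_closed[OF tC])
  fix e :: real assume e: "0 < e"
  define K where "K = cmod c + 1"
  have K: "0 < K" "cmod c \<le> K" unfolding K_def using norm_ge_zero[of c] by linarith+
  have eK: "0 < e / K" using e K by simp
  obtain y t' where t': "(y, t') \<in> graph" "CC.d t t' < e / K" using graph_closureE[OF t eK] .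
  have "cmod c * CC.d t t' \<le> K * CC.d t t'"
    by (intro mult_right_mono K CC.dist_nonneg tC graph_carrier[OF t'(1)])
  also have "\<dots> < K * (e / K)" using t'(2) K(1) by (rule mult_strict_left_mono)
  finally have "CC.d (c \<odot>\<^bsub>CC\<^esub> t) (c \<odot>\<^bsub>CC\<^esub> t') < e"
    using CC.dist_smult[OF tC graph_carrier[OF t'(1)], of c] K(1) by simp
  then show "\<exists>x r. (x, r) \<in> graph \<and> CC.d (c \<odot>\<^bsub>CC\<^esub> t) r < e" using graph.smult[OF t'(1)] by blast
qed

text \<open>Additivity in the first variable is an identity between operators in every
  representation, hence an equality up to seminorm 0.\<close>

lemma CC_dist_add_left:
  assumes "a \<in> carrier C_S" "a' \<in> carrier C_S" "b \<in> carrier C_S"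
  shows "CC.d [(a \<oplus>\<^bsub>C_S\<^esub> a', b)] [(a, b), (a', b)] = 0" "nrm CC [(a \<oplus>\<^bsub>C_S\<^esub> a', b)] = nrm CC [(a, b), (a', b)]"
proof -
  interpret star_carrier C_S by (rule star_carrier_C_S)
  have "[(a \<oplus>\<^bsub>C_S\<^esub> a', b)] \<in> carrier CC" "[(a, b), (a', b)] \<in> carrier CC" using assms by auto
  moreover have "tensor_rep \<rho> \<sigma> [(a \<oplus>\<^bsub>C_S\<^esub> a', b)] \<zeta> = tensor_rep \<rho> \<sigma> [(a, b), (a', b)] \<zeta>"
    if "tensor_representation C_S C_S X Y \<rho> \<sigma>" "\<zeta> \<in> ell2 (X \<times> Y)" for X Y \<rho> \<sigma> \<zeta>
    using tensor_representation.add_elem_left[OF that(1) assms that(2)]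
    by (simp add: tensor_rep_Cons tensor_rep_Nil)
  ultimately show "CC.d [(a \<oplus>\<^bsub>C_S\<^esub> a', b)] [(a, b), (a', b)] = 0"
    "nrm CC [(a \<oplus>\<^bsub>C_S\<^esub> a', b)] = nrm CC [(a, b), (a', b)]"
    using SS.dist_eq_0I[of "[(a \<oplus>\<^bsub>C_S\<^esub> a', b)]" "[(a, b), (a', b)]"] unfolding C_S_def by auto
qed

lemma CC_dist_add_right:
  assumes "a \<in> carrier C_S" "b \<in> carrier C_S" "b' \<in> carrier C_S"
  shows "CC.d [(a, b \<oplus>\<^bsub>C_S\<^esub> b')] [(a, b), (a, b')] = 0" "nrm CC [(a, b \<oplus>\<^bsub>C_S\<^esub> b')] = nrm CC [(a, b), (a, b')]"
proof -
  interpret star_carrier C_S by (rule star_carrier_C_S)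
  have "[(a, b \<oplus>\<^bsub>C_S\<^esub> b')] \<in> carrier CC" "[(a, b), (a, b')] \<in> carrier CC" using assms by auto
  moreover have "tensor_rep \<rho> \<sigma> [(a, b \<oplus>\<^bsub>C_S\<^esub> b')] \<zeta> = tensor_rep \<rho> \<sigma> [(a, b), (a, b')] \<zeta>"
    if "tensor_representation C_S C_S X Y \<rho> \<sigma>" "\<zeta> \<in> ell2 (X \<times> Y)" for X Y \<rho> \<sigma> \<zeta>
    using tensor_representation.add_elem_right[OF that(1) assms that(2)]
    by (simp add: tensor_rep_Cons tensor_rep_Nil)
  ultimately show "CC.d [(a, b \<oplus>\<^bsub>C_S\<^esub> b')] [(a, b), (a, b')] = 0"
    "nrm CC [(a, b \<oplus>\<^bsub>C_S\<^esub> b')] = nrm CC [(a, b), (a, b')]"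
    using SS.dist_eq_0I[of "[(a, b \<oplus>\<^bsub>C_S\<^esub> b')]" "[(a, b), (a, b')]"] unfolding C_S_def by auto
qed

lemma CC_dist_smult:
  assumes "a \<in> carrier C_S" "b \<in> carrier C_S"
  shows "CC.d [(a, c \<odot>\<^bsub>C_S\<^esub> b)] [(c \<odot>\<^bsub>C_S\<^esub> a, b)] = 0"
proof -
  interpret star_carrier C_S by (rule star_carrier_C_S)
  have "[(a, c \<odot>\<^bsub>C_S\<^esub> b)] \<in> carrier CC" "[(c \<odot>\<^bsub>C_S\<^esub> a, b)] \<in> carrier CC" using assms by auto
  moreover have "tensor_rep \<rho> \<sigma> [(a, c \<odot>\<^bsub>C_S\<^esub> b)] \<zeta> = tensor_rep \<rho> \<sigma> [(c \<odot>\<^bsub>C_S\<^esub> a, b)] \<zeta>"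
    if "tensor_representation C_S C_S X Y \<rho> \<sigma>" "\<zeta> \<in> ell2 (X \<times> Y)" for X Y \<rho> \<sigma> \<zeta>
    using tensor_representation.smult_elem[OF that(1) assms that(2)]
      tensor_representation.smult_elem_right[OF that(1) assms that(2)]
    by (simp add: tensor_rep_single)
  ultimately show ?thesis
    using SS.dist_eq_0I[of "[(a, c \<odot>\<^bsub>C_S\<^esub> b)]" "[(c \<odot>\<^bsub>C_S\<^esub> a, b)]"] unfolding C_S_def by auto
qed

lemma C_S_eq: "C_S = completion (free_star_algebra S_rels)"
  by (simp add: C_S_def universal_cstar_def)

lemma C_S_mult_one:
  assumes "a \<in> carrier C_S"
  shows "a \<otimes>\<^bsub>C_S\<^esub> U 1 = a" "U 1 \<otimes>\<^bsub>C_S\<^esub> a = a"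
proof -
  obtain f where f: "f \<in> cauchy_seqs (free_star_algebra S_rels)" "a = FS.cls f"
    using assms unfolding C_S_eq by (rule FS.completionE)
  have o: "(\<lambda>_. 1) \<in> cauchy_seqs (free_star_algebra S_rels)" by (rule FS.cauchy_const) simp
  show "a \<otimes>\<^bsub>C_S\<^esub> U 1 = a" "U 1 \<otimes>\<^bsub>C_S\<^esub> a = a"
    unfolding C_S_eq f(2) U_def embed_def FS.completion_mult[OF f(1) o] FS.completion_mult[OF o f(1)] by simp_all
qed

lemma C_S_approx:
  assumes a: "a \<in> carrier C_S" and e: "0 < e"
  shows "\<exists>x. nrm C_S (diff C_S a (U x)) < e"
proof -
  obtain f where f: "f \<in> cauchy_seqs (free_star_algebra S_rels)" "a = FS.cls f"
    using a unfolding C_S_eq by (rule FS.completionE)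
  have "\<forall>\<^sub>F n in sequentially. FS.D (embed (free_star_algebra S_rels) (f n)) (FS.cls f) < e"
    using FS.embed_tendsto[OF f(1)] e by (rule order_tendstoD)
  then obtain n where n: "FS.D (embed (free_star_algebra S_rels) (f n)) (FS.cls f) < e"
    by (auto simp: eventually_sequentially)
  moreover have "FS.D (FS.cls f) (embed (free_star_algebra S_rels) (f n)) =
      FS.D (embed (free_star_algebra S_rels) (f n)) (FS.cls f)"
    by (intro FS.completion_dist_sym FS.cls_closed f FS.embed_closed) simp
  ultimately show ?thesis unfolding C_S_eq f(2) U_def by (intro exI[of _ "f n"]) simp
qed

lemma graph_closure_U_left: "[(U x, U 1)] \<in> graph_closure"
proof (induction x rule: free_star_gen_induct)
  case one
  show ?case by (rule graph_closure_range[OF graph.one])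
next
  case (gen g)
  show ?case by (rule graph_closure_range[OF graph.range])
next
  case (adj g)
  show ?case unfolding U_gen by (rule graph_closure_range[OF graph.range])
next
  case (add x y)
  \<comment> \<open>As lists, the single pair for the sum and the concatenation of the two pairs
    differ; their distance is 0, which the closure does not see.\<close>
  show ?case
    unfolding U_hom(1)[symmetric]
    by (rule graph_closure_null[OF _ _ CC_dist_add_left(1)])
       (use graph_closure_add[OF add] in \<open>simp_all add: U_closed U_hom\<close>)
next
  case (mult x y)
  then show ?case using graph_closure_mult[OF mult] by (simp add: U_hom)
next
  case (scale c x)
  then show ?case using graph_closure_smult[OF scale, of c] by (simp add: U_hom)
qed

lemma graph_closure_U_right: "[(U 1, U x)] \<in> graph_closure"
proof (induction x rule: free_star_gen_induct)
  case one
  show ?case by (rule graph_closure_range[OF graph.one])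
next
  case (gen g)
  show ?case by (rule graph_closure_range[OF graph.source])
next
  case (adj g)
  show ?case unfolding U_gen by (rule graph_closure_range[OF graph.source])
next
  case (add x y)
  show ?case
    unfolding U_hom(1)[symmetric]
    by (rule graph_closure_null[OF _ _ CC_dist_add_right(1)])
       (use graph_closure_add[OF add] in \<open>simp_all add: U_closed U_hom\<close>)
next
  case (mult x y)
  then show ?case using graph_closure_mult[OF mult] by (simp add: U_hom)
next
  case (scale c x)
  \<comment> \<open>In \<open>CC\<close> a scalar multiplies the first factor; at distance 0 it can
    be moved to the second.\<close>
  show ?case
    unfolding U_hom(3)[symmetric]
    by (rule graph_closure_null[OF _ _ CC_dist_smult])
       (use graph_closure_smult[OF scale, of c] in \<open>simp_all add: U_closed U_hom\<close>)
qed

lemma C_S_dist_nonneg: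
  assumes "a \<in> carrier C_S"
  shows "0 \<le> nrm C_S (diff C_S a (U x))"
  using FS.completion_dist_nonneg[OF _ FS.embed_closed, of a x] assms by (simp add: C_S_eq U_def)

lemma nrm_U_one_le: "nrm C_S (U 1) \<le> 1"
  unfolding nrm_U by (rule cstar_seminorm_one_le[OF cstar_seminorm_universal[OF bounding_S_rels]])

text \<open>Elements of \<open>C_S\<close> are limits of polynomials, and tensoring with the unit
  does not increase the norm.\<close>

lemma graph_closure_left:
  fixes a :: "('n::finite \<times> 'n) universal_elem"
  assumes a: "a \<in> carrier C_S"
  shows "[(a, U 1)] \<in> graph_closure"
proof (rule graph_closure_limit)
  interpret star_carrier C_S by (rule star_carrier_C_S)
  show "[(a, U 1)] \<in> carrier CC" using a by (simp add: U_closed)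
  fix e :: real assume e: "0 < e"
  let ?u = "U 1 :: ('n \<times> 'n) universal_elem"
  obtain x where x: "nrm C_S (diff C_S a (U x)) < e" using C_S_approx[OF a e] by blast
  have dC: "diff C_S a (U x) \<in> carrier C_S" using a by (simp add: diff_def U_closed)
  have "CC.d [(a, ?u)] [(U x, ?u)] = nrm CC [(a, ?u), ((-1) \<odot>\<^bsub>C_S\<^esub> U x, ?u)]"
    by (simp add: diff_def)
  also have "\<dots> = nrm CC [(diff C_S a (U x), ?u)]"
    unfolding diff_def by (rule CC_dist_add_left(2)[symmetric]) (simp_all add: a U_closed)
  also have "\<dots> \<le> nrm C_S (diff C_S a (U x)) * nrm C_S ?u"
    by (rule nrm_CC_single[OF dC U_closed])
  also have "\<dots> \<le> nrm C_S (diff C_S a (U x)) * 1"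
    by (rule mult_left_mono[OF nrm_U_one_le C_S_dist_nonneg[OF a]])
  finally have "CC.d [(a, ?u)] [(U x, ?u)] < e" using x by simp
  then show "\<exists>s\<in>graph_closure. CC.d [(a, ?u)] s < e" using graph_closure_U_left by blast
qed

lemma graph_closure_right:
  fixes b :: "('n::finite \<times> 'n) universal_elem"
  assumes b: "b \<in> carrier C_S"
  shows "[(U 1, b)] \<in> graph_closure"
proof (rule graph_closure_limit)
  interpret star_carrier C_S by (rule star_carrier_C_S)
  show "[(U 1, b)] \<in> carrier CC" using b by (simp add: U_closed)
  fix e :: real assume e: "0 < e"
  let ?u = "U 1 :: ('n \<times> 'n) universal_elem"
  obtain x where x: "nrm C_S (diff C_S b (U x)) < e" using C_S_approx[OF b e] by blast
  have dC: "diff C_S b (U x) \<in> carrier C_S" using b by (simp add: diff_def U_closed)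
  have m: "(-1) \<odot>\<^bsub>C_S\<^esub> ?u \<in> carrier C_S" "(-1) \<odot>\<^bsub>C_S\<^esub> U x \<in> carrier C_S" by (simp_all add: U_closed)
  have C: "[(?u, b)] \<in> carrier CC" "[(?u, U x)] \<in> carrier CC" "[(?u, (-1) \<odot>\<^bsub>C_S\<^esub> U x)] \<in> carrier CC"
    "[((-1) \<odot>\<^bsub>C_S\<^esub> ?u, U x)] \<in> carrier CC"
    using b m by (simp_all add: U_closed)
  have "CC.d [(?u, b)] [(?u, U x)] = nrm CC ([(?u, b)] \<oplus>\<^bsub>CC\<^esub> [((-1) \<odot>\<^bsub>C_S\<^esub> ?u, U x)])"
    by (simp add: diff_def)
  \<comment> \<open>The difference of lists puts the factor -1 on the first component. It has to be
    moved to the second before additivity there can be used.\<close>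
  also have "\<dots> \<le> nrm CC ([(?u, b)] \<oplus>\<^bsub>CC\<^esub> [(?u, (-1) \<odot>\<^bsub>C_S\<^esub> U x)])"
    using CC.dist_add[OF C(1,4) C(1,3)] CC.dist_refl[OF C(1)] CC.dist_sym[OF C(3,4)]
      CC_dist_smult[OF U_closed[of 1] U_closed[of x], of "-1"]
      CC.nrm_lipschitz[OF CC.add_closed[OF C(1,4)] CC.add_closed[OF C(1,3)]] by linarith
  also have "\<dots> = nrm CC [(?u, diff C_S b (U x))]"
    unfolding diff_def by (subst CC_dist_add_right(2)) (simp_all add: b U_closed)
  also have "\<dots> \<le> nrm C_S ?u * nrm C_S (diff C_S b (U x))"
    by (rule nrm_CC_single[OF U_closed dC])
  also have "\<dots> \<le> 1 * nrm C_S (diff C_S b (U x))"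
    by (rule mult_right_mono[OF nrm_U_one_le C_S_dist_nonneg[OF b]])
  finally have "CC.d [(?u, b)] [(?u, U x)] < e" using x by simp
  then show "\<exists>s\<in>graph_closure. CC.d [(?u, b)] s < e" using graph_closure_U_right by blast
qed

text \<open>An elementary tensor is the product of \<open>a \<otimes> 1\<close> and
  \<open>1 \<otimes> b\<close>, both in the closure, and a list is a sum of elementary
  tensors.\<close>

lemma graph_dense: "t \<in> carrier CC \<Longrightarrow> t \<in> graph_closure"
proof (induction t)
  case Nil
  show ?case by (rule graph_closure_range[OF graph.zero])
next
  case (Cons z t)
  obtain a b where z: "z = (a, b)" "a \<in> carrier C_S" "b \<in> carrier C_S" and t: "t \<in> carrier CC"
    using Cons.prems by auto
  have "[(a, U 1)] \<otimes>\<^bsub>CC\<^esub> [(U 1, b)] \<in> graph_closure"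
    by (rule graph_closure_mult[OF graph_closure_left[OF z(2)] graph_closure_right[OF z(3)]])
  then have "[z] \<in> graph_closure" by (simp add: z C_S_mult_one)
  from graph_closure_add[OF this Cons.IH[OF t]] show ?case by simp
qed

section \<open>Identification of the domain and of the generators\<close>

lemma C_G_eq: "C_G = completion (free_star_algebra G_rels)"
  by (simp add: C_G_def universal_cstar_def)

lemma C_SS_eq: "C_SS = completion CC"
  by (simp add: C_SS_def min_tensor_def)

lemma v_range_eq: "v_range i j = embed (free_star_algebra G_rels) (gen (i, j) * free_adj (gen (i, j)))"
  by (simp add: v_range_def v_gen_def universal_gen_def C_G_eq FG.embed_hom)

lemma v_source_eq: "v_source i j = embed (free_star_algebra G_rels) (free_adj (gen (i, j)) * gen (i, j))"
  by (simp add: v_source_def v_gen_def universal_gen_def C_G_eq FG.embed_hom)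

lemma carrier_C_H: "carrier C_H = \<Gamma>.dom"
  unfolding C_H_def C_G_eq
proof (rule \<Gamma>.carrier_cstar_generated)
  fix a :: "('a \<times> 'a) universal_elem"
  assume "a \<in> {v_range i j | i j. True} \<union> {v_source i j | i j. True}"
  then obtain i j where "a = v_range i j \<or> a = v_source i j" by blast
  then show "a \<in> embed (free_star_algebra G_rels) ` Domain graph"
    using graph.range[of "(i, j)"] graph.source[of "(i, j)"] unfolding v_range_eq v_source_eq by blast
next
  let ?G = "free_star_algebra (G_rels :: ('a \<times> 'a) free_star set)"
  fix M and x :: "('a \<times> 'a) free_star" and t
  assume M: "cstar_subalgebra (completion ?G) M"
    and S: "{v_range i j | i j. True} \<union> {v_source i j | i j. True} \<subseteq> M" and x: "(x, t) \<in> graph"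
  have zero: "embed ?G 0 \<in> M"
  proof -
    have "\<zero>\<^bsub>completion ?G\<^esub> \<in> M" using M by (simp only: cstar_subalgebra_def)
    then show ?thesis by (simp add: FG.completion_zero embed_def)
  qed
  have cl: "X \<oplus>\<^bsub>completion ?G\<^esub> Y \<in> M" "X \<otimes>\<^bsub>completion ?G\<^esub> Y \<in> M"
      "c \<odot>\<^bsub>completion ?G\<^esub> X \<in> M" "star (completion ?G) X \<in> M"
    if "X \<in> M" "Y \<in> M" for c X Y
    using M that by (simp_all add: cstar_subalgebra_def)
  have plus: "embed ?G (x + y) \<in> M" and times: "embed ?G (x * y) \<in> M"
    if "embed ?G x \<in> M" "embed ?G y \<in> M" for x y
    using cl(1,2)[OF that] by (simp_all add: FG.embed_hom)
  have scale: "embed ?G (free_scale c x) \<in> M" and adj: "embed ?G (free_adj x) \<in> M"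
    if "embed ?G x \<in> M" for c x
    using cl(3,4)[OF that that] by (simp_all add: FG.embed_hom)
  have range: "embed ?G (gen b * free_adj (gen b)) \<in> M" for b
  proof -
    have "v_range (fst b) (snd b) \<in> M" by (rule subsetD[OF S]) blast
    then show ?thesis by (simp add: v_range_eq)
  qed
  have source: "embed ?G (free_adj (gen b) * gen b) \<in> M" for b
  proof -
    have "v_source (fst b) (snd b) \<in> M" by (rule subsetD[OF S]) blast
    then show ?thesis by (simp add: v_source_eq)
  qed
  have one: "embed ?G 1 \<in> M"
  proof -
    let ?s = "\<lambda>J. \<Sum>j\<in>J. gen (undefined, j) * free_adj (gen (undefined, j)) :: ('a \<times> 'a) free_star"
    have M: "embed ?G (?s J) \<in> M" for J
      by (induction J rule: infinite_finite_induct) (simp_all add: zero plus range)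
    have "?s UNIV - 1 \<in> magic_unitary_rels (\<lambda>i j. gen (i, j) * free_adj (gen (i, j)))"
      unfolding magic_unitary_rels_def by (rule UnI1, rule UnI2, rule range_eqI[of _ _ undefined], rule refl)
    then have "?s UNIV - 1 \<in> G_rels"
      unfolding G_rels_def Let_def by (simp only: Un_iff simp_thms)
    then have "embed ?G (?s UNIV) = embed ?G 1"
      by (subst FG.embed_eq_iff) (simp_all add: universal_seminorm_rel[OF bounding_G_rels])
    then show ?thesis using M[of UNIV] by simp
  qed
  show "embed ?G x \<in> M"
    using x
  proof (induction rule: graph.induct)
    case (add x s y t)
    then show ?case by (intro plus)
  next
    case (mult x s y t)
    then show ?case by (intro times)
  next
    case (smult x s c)
    then show ?case by (intro scale)
  next
    case (star x s)
    then show ?case by (intro adj)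
  qed (rule range source one zero)+
qed

theorem proposition5p12:
  assumes "CARD('n::finite) \<ge> 2"
  shows "\<exists>\<pi> :: ('n \<times> 'n) universal_elem \<Rightarrow> 'n SS_elem.
           star_hom C_H C_SS \<pi> \<and>
           \<pi> ` carrier C_H = carrier C_SS \<and>
           (\<forall>i j. \<pi> (v_gen i j \<otimes>\<^bsub>C_G\<^esub> star C_G (v_gen i j)) = P_gen i j \<and>
                  \<pi> (star C_G (v_gen i j) \<otimes>\<^bsub>C_G\<^esub> v_gen i j) = Q_gen i j)"
proof (intro exI conjI allI)
  let ?\<pi> = "\<Gamma>.hom :: ('n \<times> 'n) universal_elem \<Rightarrow> 'n SS_elem"
  show "star_hom C_H C_SS ?\<pi>"
    unfolding C_SS_eq
  proof (rule \<Gamma>.star_hom_hom)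
    have "C_H = C_G\<lparr>carrier := carrier C_H\<rparr>" by (simp add: C_H_def cstar_generated_def)
    then show "C_H = completion (free_star_algebra (G_rels :: ('n \<times> 'n) free_star set))\<lparr>carrier := \<Gamma>.dom\<rparr>"
      unfolding C_G_eq carrier_C_H .
  qed
  show "?\<pi> ` carrier C_H = carrier C_SS"
    unfolding C_SS_eq carrier_C_H
  \<comment> \<open>The constant comes from \<open>graph_lift\<close>: 8 for each of the real and
    imaginary parts.\<close>
  proof (rule \<Gamma>.hom_surj[where C = 16])
    fix x :: "('n \<times> 'n) free_star" and t
    assume "(x, t) \<in> graph"
    from graph_lift[OF this]
    show "\<exists>x' t'. (x', t') \<in> graph \<and> nrm (free_star_algebra G_rels) x' \<le> 16 * nrm CC t \<and> CC.d t t' \<le> nrm CC t / 2"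
      by simp
  next
    fix t :: "(('n \<times> 'n) universal_elem \<times> ('n \<times> 'n) universal_elem) list" and e :: real
    assume "t \<in> carrier CC" "0 < e"
    then show "\<exists>(x, s)\<in>graph. CC.d t s < e"
      using graph_closureE[OF graph_dense] by blast
  qed simp
  fix i j :: 'n
  have u: "u_gen i j = U (gen (i, j))" by (simp add: u_gen_def universal_gen_def U_def)
  show "?\<pi> (v_gen i j \<otimes>\<^bsub>C_G\<^esub> star C_G (v_gen i j)) = P_gen i j"
    unfolding v_range_def[symmetric] v_range_eq \<Gamma>.hom_embed(2)[OF graph.range]
    by (simp add: P_gen_def elem_tensor_def u U_hom)
  show "?\<pi> (star C_G (v_gen i j) \<otimes>\<^bsub>C_G\<^esub> v_gen i j) = Q_gen i j"
    unfolding v_source_def[symmetric] v_source_eq \<Gamma>.hom_embed(2)[OF graph.source]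
    by (simp add: Q_gen_def elem_tensor_def u U_hom)
qed

end
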